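(* Let $f:\mathbb{R}^2\to[0,\infty)$ be defined by $f(z)=e^{-\gamma|z|^2}$ with $\gamma>2\pi$. Suppose that $\Lambda\in\mathcal{L}$ satisfies $D(\Lambda)>4$. Let $$Z_\lambda,\quad\lambda\in\Lambda,$$ be a sequence of independent $\mathbb{R}^2$-valued random variables, where each $Z_\lambda$ is uniformly distributed on the disk $B_{f(\lambda)}(\lambda)$. Then $\mathcal{U}=\{Z_\lambda:\lambda\in\Lambda\}$ is separated and a uniqueness set for the Gabor phase retrieval problem in $L^2_e(\mathbb{R},\mathbb{R})$ almost surely.
   Context: The class of lattices $\mathcal{L}$ is $$\mathcal{L}=\left\{\begin{pmatrix}p&0\\ 0& q\end{pmatrix}\mathbb{Z}^2:\ p,q\in\mathbb{R}\setminus\{0\}\right\}\cup\left\{\begin{pmatrix}p&p\\ q&-q\end{pmatrix}\mathbb{Z}^2:\ p,q\in\mathbb{R}\setminus\{0\}\right\}.$$ The density of a lattice $\Lambda$ is $D(\Lambda)=1/s(\Lambda)$, where $s(\Lambda)$ is the area of a period parallelogram of $\Lambda$. $B_r(z)$ is the closed ball of radius $r$ around $z$ in $\mathbb{R}^2$. A set $\mathcal{U}\subseteq\mathbb{R}^2$ is separated if $\inf\{|u-u'|:u,u'\in\mathcal{U},\,u\ne u'\}>0$. $L^2(\mathbb{R})$ denotes the complex-valued square-integrable functions on $\mathbb{R}$ and $L^2_e(\mathbb{R},\mathbb{R})$ its subset of even real-valued functions. The Gabor transform of $g\in L^2(\mathbb{R})$ is $\mathcal{G}g(x,\omega)=\int_{\mathbb{R}}g(t)e^{-\pi(t-x)^2}e^{-2\pi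 i\omega t}\,dt$, $(x,\omega)\in\mathbb{R}^2$. A set $\mathcal{U}\subseteq\mathbb{R}^2$ is a uniqueness set for the Gabor phase retrieval problem in $X\subseteq L^2(\mathbb{R})$ if for all $g,h\in X$: whenever $|\mathcal{G}g(u)|=|\mathcal{G}h(u)|$ for all $u\in\mathcal{U}$, there is $\tau\in\mathbb{C}$ with $|\tau|=1$ and $g=\tau h$. *)

theory Defs
  imports "HOL-Probability.Probability"
begin

definition lattice_of :: "real^2^2 \<Rightarrow> (real^2) set" where
  "lattice_of A = {A *v z | z. \<forall>i. z $ i \<in> \<int>}"

definition rect_lattices :: "(real^2) set set" where
  "rect_lattices =
     {lattice_of (vector [vector [p, 0], vector [0, q]]) | p q. p \<noteq> 0 \<and> q \<noteq> 0} \<union>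
     {lattice_of (vector [vector [p, p], vector [q, -q]]) | p q. p \<noteq> 0 \<and> q \<noteq> 0}"

definition period_parallelogram :: "(real^2) set \<Rightarrow> (real^2) set \<Rightarrow> bool" where
  "period_parallelogram \<Lambda> P \<longleftrightarrow>
     (\<exists>A. invertible A \<and> \<Lambda> = lattice_of A \<and> P = (*v) A ` cbox 0 1)"

(* The area does not depend on the chosen parallelogram, see period_area_lattice_of below. *)
definition period_area :: "(real^2) set \<Rightarrow> real" where
  "period_area \<Lambda> = (THE s. \<exists>P. period_parallelogram \<Lambda> P \<and> s = measure lebesgue P)"

definition lattice_density :: "(real^2) set \<Rightarrow> real" where
  "lattice_density \<Lambda> = 1 / period_area \<Lambda>"

lemma area_parallelogram: "measure lebesgue ((*v) (A::real^2^2) ` cbox 0 1) = \<bar>det A\<bar>"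
proof -
  have "measure lebesgue ((*v) A ` cbox 0 1) = \<bar>det (matrix ((*v) A))\<bar> * measure lebesgue (cbox 0 (1::real^2))"
    by (rule measure_linear_image) auto
  moreover have "measure lebesgue (cbox 0 (1::real^2)) = 1"
    by (simp add: content_cbox_if_cart interval_eq_empty_cart)
  ultimately show ?thesis
    by simp
qed

lemma lattice_of_subset_imp_integer_matrix:
  assumes "lattice_of B \<subseteq> lattice_of A"
  obtains C :: "real^2^2" where "B = A ** C" "det C \<in> \<int>"
proof -
  have "\<exists>c. column j B = A *v c \<and> (\<forall>i. c $ i \<in> \<int>)" for j :: 2
  proof -
    have "B *v axis j 1 \<in> lattice_of B"
      unfolding lattice_of_def by (auto simp: axis_def)
    then show ?thesis
      using assms by (auto simp: lattice_of_def matrix_vector_mul_component matrix_vector_mult_basis)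
  qed
  then obtain c where c: "\<And>j. column j B = A *v c j" "\<And>i j. c j $ i \<in> \<int>"
    by metis
  let ?C = "(\<chi> i j. c j $ i) :: real^2^2"
  have "B = A ** ?C"
    using c(1) by (auto simp: vec_eq_iff column_def matrix_matrix_mult_def matrix_vector_mult_def)
  moreover have "det ?C \<in> \<int>"
    by (simp add: det_2 c(2))
  ultimately show thesis by (rule that)
qed

lemma lattice_of_eq_imp_abs_det_eq:
  assumes "lattice_of A = lattice_of B" "invertible A"
  shows "\<bar>det A\<bar> = \<bar>det B\<bar>"
proof -
  obtain C D :: "real^2^2" where C: "B = A ** C" "det C \<in> \<int>" and D: "A = B ** D" "det D \<in> \<int>"
    using assms(1) by (metis lattice_of_subset_imp_integer_matrix order_refl)
  have "det A = det A * (det C * det D)"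
    using C(1) D(1) by (metis det_mul mult.assoc)
  then have 1: "det C * det D = 1"
    using assms(2) by (simp add: invertible_det_nz)
  obtain m n :: int where mn: "det C = of_int m" "det D = of_int n"
    using C(2) D(2) by (auto elim!: Ints_cases)
  have "m * n = 1"
    using 1 unfolding mn by (metis of_int_eq_1_iff of_int_mult)
  then have "\<bar>m\<bar> = 1"
    by (metis abs_zmult_eq_1 abs_one)
  then have "\<bar>det C\<bar> = 1"
    using mn by (metis of_int_1 of_int_abs)
  then show ?thesis
    using C(1) by (simp add: det_mul abs_mult)
qed

lemma period_area_lattice_of:
  assumes "invertible A"
  shows "period_area (lattice_of A) = \<bar>det A\<bar>"
  unfolding period_area_def period_parallelogram_def
  using assms area_parallelogram lattice_of_eq_imp_abs_det_eq
  by (intro the_equality) metis+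

(* The infimum is taken in the extended reals so that the infimum of the empty set is infinity. *)
definition separated_set :: "'a::real_normed_vector set \<Rightarrow> bool" where
  "separated_set U \<longleftrightarrow> 0 < Inf {ereal (norm (u - u')) | u u'. u \<in> U \<and> u' \<in> U \<and> u \<noteq> u'}"

(* Elements of the L2 spaces are represented by functions; identities between
   them are understood almost everywhere. *)
definition L2 :: "(real \<Rightarrow> complex) set" where
  "L2 = {g \<in> borel_measurable lebesgue. integrable lebesgue (\<lambda>t. (norm (g t))\<^sup>2)}"

definition L2_even_real :: "(real \<Rightarrow> complex) set" where
  "L2_even_real =
     {g \<in> L2. (AE t in lebesgue. g t \<in> \<real>) \<and> (AE t in lebesgue. g (- t) = g t)}"

definition gabor :: "(real \<Rightarrow> complex) \<Rightarrow> real^2 \<Rightarrow> complex" where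
  "gabor g u = (LINT t|lebesgue. g t * of_real (exp (- pi * (t - u $ 1)\<^sup>2))
                   * exp (- 2 * of_real pi * \<i> * of_real (u $ 2) * of_real t))"

definition gabor_uniqueness_set :: "(real^2) set \<Rightarrow> (real \<Rightarrow> complex) set \<Rightarrow> bool" where
  "gabor_uniqueness_set U X \<longleftrightarrow>
     (\<forall>g\<in>X. \<forall>h\<in>X. (\<forall>u\<in>U. norm (gabor g u) = norm (gabor h u)) \<longrightarrow>
        (\<exists>\<tau>::complex. norm \<tau> = 1 \<and> (AE t in lebesgue. g t = \<tau> * h t)))"

end

theory Submission
  imports Defs "HOL-Complex_Analysis.Complex_Analysis" "HOL-Real_Asymp.Real_Asymp"
begin

text \<open>
Let \<open>F\<close> and \<open>H\<close> be the Bargmann transforms of two even real-valued functions \<open>g\<close> and \<open>h\<close>. They are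
entire, grow at most like \<open>exp (\<pi> \<bar>z\<bar>\<^sup>2 / 2)\<close>, are even, and commute with complex conjugation. Up to
a factor that depends only on the point, \<open>\<bar>F\<bar>\<close> is the modulus of the Gabor transform of \<open>g\<close>. By the
symmetries, a sample at one point determines \<open>\<bar>F\<bar>\<close> at its images under \<open>z \<mapsto> cnj z\<close> and \<open>z \<mapsto> - z\<close>.
If \<open>l\<close> is a lattice point off the axes, then the random points near \<open>l\<close>, \<open>cnj l\<close> and \<open>- l\<close> thus
provide three independent points of the tiny disc around \<open>l\<close> at which \<open>\<bar>F\<bar> = \<bar>H\<bar>\<close>.

Three independent uniform points of a disc of radius \<open>r\<close> rarely form a triangle whose area is much
smaller than \<open>r\<^sup>2\<close> (\<open>degenerate_triangle_prob\<close>). By the Borel-Cantelli lemma, almost surely all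
but finitely many of the triangles have area at least a constant times \<open>exp (- \<bar>l\<bar>\<^sup>2) r\<^sup>2\<close>. At the
vertices of such a triangle the function \<open>\<bar>F\<bar>\<^sup>2 - \<bar>H\<bar>\<^sup>2\<close> vanishes, so its gradient at a vertex is
tiny. Since also \<open>\<bar>F\<bar> = \<bar>H\<bar>\<close> there, the Wronskian \<open>F' H - H' F\<close> is tiny at the vertex and hence
at \<open>l\<close> (\<open>wronskian_small_near_triangle\<close>). The radii \<open>exp (- \<gamma> \<bar>l\<bar>\<^sup>2)\<close> beat the growth of the
functions involved, and the Wronskian is at most a constant times \<open>exp (- \<bar>l\<bar>\<^sup>2)\<close> at \<open>l\<close>.

The Wronskian grows at most like \<open>exp ((\<pi> + \<epsilon>) \<bar>z\<bar>\<^sup>2)\<close> for every \<open>\<epsilon> > 0\<close>. A function with this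
growth that decays like a Gaussian on a rectangular lattice of density greater than 2 is zero
(\<open>lattice_uniqueness\<close>). For the proof, divide it by a product of sines that vanishes on many rows of
the lattice and integrate over large rectangles; the residue theorem then expresses the function by
its values on the lattice with Gaussian weights, which forces it to tend to zero along the
boundaries of the rectangles. Lattice points on the axes, where nothing is known, are removed by
multiplication with two sines. Every lattice considered here with density greater than 4 contains a
rectangular lattice of density greater than 2 (\<open>dense_rect_lattice_between_grids\<close>).

So the Wronskian is zero and \<open>F = c H\<close>. As \<open>H\<close>, unless it is zero, cannot vanish at all sample
points, by the same uniqueness theorem, \<open>\<bar>c\<bar> = 1\<close>. Finally \<open>g = c h\<close> almost everywhere, because the
Bargmann transform is injective: on the imaginary axis it is essentially a Fourier transform.
The random points are separated because the radii of the discs tend to zero.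
\<close>

text \<open>The symbol \<open>$\<close> is to denote components of vectors only, not coefficients of power series.\<close>

no_notation fps_nth (infixl "$" 75)

section \<open>Sums over the rows of a lattice\<close>

lemma sum_geometric_int_le:
  fixes x :: real and m :: int
  assumes "0 < x" "x < 1" "finite A"
  shows "(\<Sum>n\<in>A. x ^ nat \<bar>n - m\<bar>) \<le> 2 / (1 - x)"
proof -
  have nat: "(\<Sum>k\<in>K. x ^ k) \<le> 1 / (1 - x)" if "finite K" for K :: "nat set"
  proof -
    have "(\<Sum>k\<in>K. x ^ k) \<le> (\<Sum>k. x ^ k)"
      using assms that by (intro sum_le_suminf summable_geometric) auto
    then show ?thesis
      using assms by (simp add: suminf_geometric)
  qed
  let ?g = "\<lambda>n. nat \<bar>n - m\<bar>"
  let ?P = "{n \<in> A. m \<le> n}" and ?Q = "{n \<in> A. n < m}"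
  have "(\<Sum>n\<in>A. x ^ ?g n) = (\<Sum>n\<in>?P. x ^ ?g n) + (\<Sum>n\<in>?Q. x ^ ?g n)"
    using assms(3) by (subst sum.union_disjoint[symmetric]) (auto intro!: sum.cong)
  moreover have "(\<Sum>n\<in>?P. x ^ ?g n) = (\<Sum>k\<in>?g ` ?P. x ^ k)"
    by (subst sum.reindex) (auto simp: inj_on_def)
  moreover have "(\<Sum>n\<in>?Q. x ^ ?g n) = (\<Sum>k\<in>?g ` ?Q. x ^ k)"
    by (subst sum.reindex) (auto simp: inj_on_def)
  ultimately show ?thesis
    using nat[of "?g ` ?P"] nat[of "?g ` ?Q"] assms(3) by simp
qed

text \<open>A bound, uniform in the real number \<open>y\<close>, for the sum of \<open>exp (- c \<bar>y - n b\<bar>)\<close> over all integers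
\<open>n\<close>.\<close>

definition row_bound :: "real \<Rightarrow> real \<Rightarrow> real" where
  "row_bound c b = 2 * exp (c * b) / (1 - exp (- (c * b)))"

text \<open>Let \<open>m = \<lfloor>y / b\<rfloor>\<close>. Then \<open>\<bar>y - n b\<bar> \<ge> b (\<bar>n - m\<bar> - 1)\<close>, so the sum is dominated by a two-sided
geometric series; the shift by one costs the factor \<open>exp (c b)\<close>.\<close>

lemma sum_exp_dist_rows_le:
  fixes b c y :: real
  assumes "b > 0" "c > 0" "finite A"
  shows "(\<Sum>n\<in>A. exp (- (c * \<bar>y - of_int n * b\<bar>))) \<le> row_bound c b"
proof -
  define m where "m = \<lfloor>y / b\<rfloor>"
  define x where "x = exp (- (c * b))"
  have m: "of_int m * b \<le> y" "y \<le> of_int m * b + b"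
    using assms(1) of_int_floor_le[of "y / b"] real_of_int_floor_add_one_ge[of "y / b"]
    unfolding m_def pos_le_divide_eq[OF assms(1)] pos_divide_le_eq[OF assms(1)]
    by (auto simp: distrib_right)
  have "exp (- (c * \<bar>y - of_int n * b\<bar>)) \<le> exp (c * b) * x ^ nat \<bar>n - m\<bar>" for n :: int
  proof -
    have "of_int \<bar>n - m\<bar> * b = \<bar>of_int n * b - of_int m * b\<bar>"
      using assms(1) by (simp add: abs_mult left_diff_distrib[symmetric])
    also have "\<dots> \<le> \<bar>y - of_int n * b\<bar> + b"
      using m by linarith
    finally have "c * (of_int \<bar>n - m\<bar> * b) \<le> c * (\<bar>y - of_int n * b\<bar> + b)"
      using assms(2) by (intro mult_left_mono) auto
    then have "- (c * \<bar>y - of_int n * b\<bar>) \<le> c * b + of_int \<bar>n - m\<bar> * (- (c * b))"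
      by (simp add: algebra_simps)
    then have "exp (- (c * \<bar>y - of_int n * b\<bar>)) \<le> exp (c * b) * exp (of_int \<bar>n - m\<bar> * (- (c * b)))"
      by (simp add: exp_add[symmetric])
    also have "exp (of_int \<bar>n - m\<bar> * (- (c * b))) = x ^ nat \<bar>n - m\<bar>"
      unfolding x_def by (subst exp_of_nat_mult[symmetric]) simp
    finally show ?thesis .
  qed
  then have "(\<Sum>n\<in>A. exp (- (c * \<bar>y - of_int n * b\<bar>))) \<le> exp (c * b) * (\<Sum>n\<in>A. x ^ nat \<bar>n - m\<bar>)"
    unfolding sum_distrib_left by (rule sum_mono)
  also have "\<dots> \<le> exp (c * b) * (2 / (1 - x))"
    using assms by (intro mult_left_mono sum_geometric_int_le) (auto simp: x_def)
  finally show ?thesis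
    by (simp add: row_bound_def x_def mult.commute)
qed

lemma sum_symmetric_Suc:
  fixes f :: "int \<Rightarrow> real"
  shows "(\<Sum>n\<in>{- int (Suc N)..int (Suc N)}. f n) =
     f (- int (Suc N)) + f (int (Suc N)) + (\<Sum>n\<in>{- int N..int N}. f n)"
proof -
  have "{- int (Suc N)..int (Suc N)} = insert (- int (Suc N)) (insert (int (Suc N)) {- int N..int N})"
    by auto
  then show ?thesis
    by simp
qed

lemma sum_abs_rows_outer:
  fixes v :: real
  assumes "real N \<le> \<bar>v\<bar>"
  shows "(\<Sum>n\<in>{- int N..int N}. \<bar>v - of_int n\<bar>) = (2 * real N + 1) * \<bar>v\<bar>"
  using assms
proof (induction N)
  case (Suc N)
  have "\<bar>v - of_int (- int (Suc N))\<bar> + \<bar>v - of_int (int (Suc N))\<bar> = 2 * \<bar>v\<bar>"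
    using Suc.prems by auto
  then show ?case
    using Suc unfolding sum_symmetric_Suc by (simp add: algebra_simps)
qed simp

text \<open>The sum is piecewise linear in \<open>v\<close> and interpolates the parabola \<open>v\<^sup>2 + N (N + 1)\<close> at the
integers, so it exceeds it by \<open>d - d\<^sup>2\<close>, where \<open>d\<close> is the fractional part of \<open>\<bar>v\<bar>\<close>. This is the source of
the Gaussian growth of a product of sines over equidistant rows.\<close>

lemma sum_abs_rows:
  fixes v :: real
  assumes "\<bar>v\<bar> \<le> real N + 1"
  shows "v\<^sup>2 + real N * (real N + 1) \<le> (\<Sum>n\<in>{- int N..int N}. \<bar>v - of_int n\<bar>) \<and>
         (\<Sum>n\<in>{- int N..int N}. \<bar>v - of_int n\<bar>) \<le> v\<^sup>2 + real N * (real N + 1) + 1 / 4"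
  using assms
proof (induction N)
  case 0
  have "v\<^sup>2 \<le> \<bar>v\<bar>"
    using 0 by (metis abs_le_square_iff abs_ge_zero abs_of_nonneg mult_left_le of_nat_0 add_0 power2_abs power2_eq_square)
  moreover have "\<bar>v\<bar> \<le> v\<^sup>2 + 1 / 4"
    using zero_le_power2[of "\<bar>v\<bar> - 1 / 2"] by (simp add: power2_eq_square algebra_simps)
  ultimately show ?case by simp
next
  case (Suc N)
  let ?T = "\<lambda>N. \<Sum>n\<in>{- int N..int N}. \<bar>v - of_int n\<bar>"
  show ?case
  proof (cases "\<bar>v\<bar> \<le> real N + 1")
    case True
    have "?T (Suc N) = ?T N + 2 * (real N + 1)"
      unfolding sum_symmetric_Suc using True by auto
    then show ?thesis
      using Suc.IH[OF True] by (simp add: algebra_simps)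
  next
    case False
    define d where "d = \<bar>v\<bar> - (real N + 1)"
    have d: "0 \<le> d" "d \<le> 1"
      using False Suc.prems by (auto simp: d_def)
    have v: "\<bar>v\<bar> = d + real N + 1" by (simp add: d_def)
    then have v2: "v\<^sup>2 = (d + real N + 1)\<^sup>2" by (metis power2_abs)
    have "?T (Suc N) = (2 * real (Suc N) + 1) * \<bar>v\<bar>"
      using False by (intro sum_abs_rows_outer) auto
    then have T: "?T (Suc N) = v\<^sup>2 + real (Suc N) * (real (Suc N) + 1) + (d - d\<^sup>2)"
      unfolding v v2 by (simp add: power2_eq_square algebra_simps)
    have "d\<^sup>2 \<le> d"
      using d by (simp add: power2_eq_square mult_left_le)
    moreover have "d \<le> d\<^sup>2 + 1 / 4"
      using zero_le_power2[of "d - 1 / 2"] by (simp add: power2_eq_square algebra_simps)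
    ultimately show ?thesis
      unfolding T by linarith
  qed
qed

lemma norm_sin_le: "cmod (sin w) \<le> exp \<bar>Im w\<bar> / 2 * (1 + exp (- (2 * \<bar>Im w\<bar>)))"
  and norm_sin_ge: "exp \<bar>Im w\<bar> / 2 * (1 - exp (- (2 * \<bar>Im w\<bar>))) \<le> cmod (sin w)"
proof -
  have s: "cmod (sin w) = cmod (exp (\<i> * w) - exp (- (\<i> * w))) / 2"
    by (simp add: sin_exp_eq norm_divide norm_mult)
  have e: "cmod (exp (\<i> * w)) = exp (- Im w)" "cmod (exp (- (\<i> * w))) = exp (Im w)"
    by simp_all
  have E: "exp \<bar>Im w\<bar> * exp (- (2 * \<bar>Im w\<bar>)) = exp (- \<bar>Im w\<bar>)"
    by (simp add: exp_add[symmetric])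
  show "cmod (sin w) \<le> exp \<bar>Im w\<bar> / 2 * (1 + exp (- (2 * \<bar>Im w\<bar>)))"
    using norm_triangle_ineq4[of "exp (\<i> * w)" "exp (- (\<i> * w))"] E
    unfolding s e by (cases "Im w \<ge> 0") (auto simp: algebra_simps)
  show "exp \<bar>Im w\<bar> / 2 * (1 - exp (- (2 * \<bar>Im w\<bar>))) \<le> cmod (sin w)"
    using norm_triangle_ineq2[of "exp (\<i> * w)" "exp (- (\<i> * w))"]
      norm_triangle_ineq2[of "exp (- (\<i> * w))" "exp (\<i> * w)"] E
    unfolding s e by (cases "Im w \<ge> 0") (auto simp: algebra_simps norm_minus_commute)
qed

text \<open>Halfway between two real zeros the modulus of the sine is a hyperbolic cosine, so it needs
no distance from the real axis to be large.\<close>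

lemma norm_sin_antinode:
  assumes "Re w = pi * (of_int m + 1 / 2)"
  shows "exp \<bar>Im w\<bar> / 2 \<le> cmod (sin w)"
proof -
  have "cos (2 * Re w) = cos (2 * pi * of_int m + pi)"
    unfolding assms by (simp add: algebra_simps)
  also have "\<dots> = - 1"
    by simp
  finally have "(cmod (sin w))\<^sup>2 = (exp (2 * Im w) + inverse (exp (2 * Im w)) + 2) / 4"
    by (simp add: norm_sin_squared)
  also have "\<dots> = (exp \<bar>Im w\<bar> / 2 * (1 + exp (- (2 * \<bar>Im w\<bar>))))\<^sup>2"
    by (cases "Im w \<ge> 0")
       (simp_all add: power2_eq_square field_simps exp_add[symmetric] exp_minus[symmetric])
  finally have "(cmod (sin w))\<^sup>2 = \<dots>" .
  then have "cmod (sin w) = exp \<bar>Im w\<bar> / 2 * (1 + exp (- (2 * \<bar>Im w\<bar>)))"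
    by (smt (verit) exp_gt_zero mult_pos_pos norm_ge_zero power2_eq_imp_eq half_gt_zero)
  also have "\<dots> \<ge> exp \<bar>Im w\<bar> / 2 * 1"
    by (intro mult_left_mono) auto
  finally show ?thesis by simp
qed

section \<open>An entire function with zeros on finitely many rows of a lattice\<close>

text \<open>The zeros of this sine are exactly the points \<open>(a m, b n)\<close>, with \<open>m\<close> an integer, of row number
\<open>n\<close>.\<close>

definition row_factor :: "real \<Rightarrow> real \<Rightarrow> int \<Rightarrow> complex \<Rightarrow> complex" where
  "row_factor a b n z = sin (of_real (pi / a) * (z - \<i> * of_real (of_int n * b)))"

lemma Im_row_arg:
  "Im (of_real (pi / a) * (z - \<i> * of_real (of_int n * b))) = pi / a * (Im z - of_int n * b)"
  by simp

lemma Re_row_arg: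
  "Re (of_real (pi / a) * (z - \<i> * of_real (of_int n * b))) = pi / a * Re z"
  by simp

text \<open>Each factor is \<open>exp (\<pi> d / a) / 2\<close> up to a relative error \<open>exp (- 2 \<pi> d / a)\<close>, where \<open>d\<close> is the
distance from \<open>z\<close> to the row. The errors are summable over the rows, uniformly in \<open>z\<close>.\<close>

lemma prod_row_factor_le:
  assumes "a > 0" "b > 0" "finite A"
  shows "cmod (\<Prod>n\<in>A. row_factor a b n z) \<le>
    exp (pi / a * (\<Sum>n\<in>A. \<bar>Im z - of_int n * b\<bar>)) / 2 ^ card A * exp (row_bound (2 * pi / a) b)"
proof -
  let ?d = "\<lambda>n. \<bar>Im z - of_int n * b\<bar>"
  have "cmod (row_factor a b n z) \<le> exp (pi / a * ?d n) / 2 * exp (exp (- (2 * pi / a * ?d n)))" for n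
  proof -
    have "cmod (row_factor a b n z) \<le> exp (pi / a * ?d n) / 2 * (1 + exp (- (2 * pi / a * ?d n)))"
      using norm_sin_le[of "of_real (pi / a) * (z - \<i> * of_real (of_int n * b))"] assms(1)
      unfolding Im_row_arg row_factor_def by (simp add: abs_mult mult.assoc)
    also have "\<dots> \<le> exp (pi / a * ?d n) / 2 * exp (exp (- (2 * pi / a * ?d n)))"
      by (intro mult_left_mono exp_ge_add_one_self) auto
    finally show ?thesis .
  qed
  then have "cmod (\<Prod>n\<in>A. row_factor a b n z) \<le>
      (\<Prod>n\<in>A. exp (pi / a * ?d n) / 2 * exp (exp (- (2 * pi / a * ?d n))))"
    unfolding prod_norm[symmetric] by (intro prod_mono) auto
  also have "\<dots> = exp (pi / a * (\<Sum>n\<in>A. ?d n)) / 2 ^ card A * exp (\<Sum>n\<in>A. exp (- (2 * pi / a * ?d n)))"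
    using assms(3) by (simp add: prod.distrib prod_dividef exp_sum sum_distrib_left)
  also have "\<dots> \<le> exp (pi / a * (\<Sum>n\<in>A. ?d n)) / 2 ^ card A * exp (row_bound (2 * pi / a) b)"
    using sum_exp_dist_rows_le[of b "2 * pi / a" A "Im z"] assms
    by (intro mult_left_mono) auto
  finally show ?thesis .
qed

text \<open>The lower bounds for products use this convex estimate, which turns products into sums as
long as the factors stay away from zero.\<close>

lemma one_minus_ge_exp:
  fixes x q :: real
  assumes "0 \<le> x" "x \<le> q" "q < 1"
  shows "exp (- (x / (1 - q))) \<le> 1 - x"
proof -
  have "1 / (1 - x) = 1 + x / (1 - x)"
    using assms by (simp add: field_simps)
  also have "\<dots> \<le> exp (x / (1 - x))"
    by (rule exp_ge_add_one_self)
  finally have "exp (- (x / (1 - x))) \<le> 1 - x"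
    using assms by (simp add: exp_minus field_simps)
  moreover have "x / (1 - x) \<le> x / (1 - q)"
    using assms by (intro divide_left_mono) auto
  ultimately show ?thesis
    by (meson exp_le_cancel_iff neg_le_iff_le order_trans)
qed

text \<open>A lower bound for the product of the correction factors \<open>1 - exp (- 2 \<pi> d / a)\<close> over rows at
distance \<open>d \<ge> b / 2\<close>.\<close>

definition row_const :: "real \<Rightarrow> real \<Rightarrow> real" where
  "row_const a b = exp (- (row_bound (2 * pi / a) b / (1 - exp (- (pi / a * b)))))"

lemma prod_row_factor_ge:
  assumes "a > 0" "b > 0" "finite A" and away: "\<And>n. n \<in> A \<Longrightarrow> b / 2 \<le> \<bar>Im z - of_int n * b\<bar>"
  shows "exp (pi / a * (\<Sum>n\<in>A. \<bar>Im z - of_int n * b\<bar>)) / 2 ^ card A * row_const a b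
    \<le> cmod (\<Prod>n\<in>A. row_factor a b n z)"
proof -
  let ?d = "\<lambda>n. \<bar>Im z - of_int n * b\<bar>"
  define q where "q = exp (- (pi / a * b))"
  have q: "q < 1" using assms by (simp add: q_def)
  have "exp (pi / a * ?d n) / 2 * exp (- (exp (- (2 * pi / a * ?d n)) / (1 - q))) \<le> cmod (row_factor a b n z)"
    if "n \<in> A" for n
  proof -
    have "pi / a * b \<le> 2 * pi / a * ?d n"
      using mult_left_mono[OF away[OF that], of "2 * pi / a"] assms(1) by simp
    then have "exp (- (exp (- (2 * pi / a * ?d n)) / (1 - q))) \<le> 1 - exp (- (2 * pi / a * ?d n))"
      using q by (intro one_minus_ge_exp) (auto simp: q_def)
    then have "exp (pi / a * ?d n) / 2 * exp (- (exp (- (2 * pi / a * ?d n)) / (1 - q)))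
        \<le> exp (pi / a * ?d n) / 2 * (1 - exp (- (2 * pi / a * ?d n)))"
      by (intro mult_left_mono) auto
    also have "\<dots> \<le> cmod (row_factor a b n z)"
      using norm_sin_ge[of "of_real (pi / a) * (z - \<i> * of_real (of_int n * b))"] assms(1)
      unfolding Im_row_arg row_factor_def by (simp add: abs_mult mult.assoc)
    finally show ?thesis .
  qed
  then have prod: "(\<Prod>n\<in>A. exp (pi / a * ?d n) / 2 * exp (- (exp (- (2 * pi / a * ?d n)) / (1 - q))))
      \<le> cmod (\<Prod>n\<in>A. row_factor a b n z)"
    unfolding prod_norm[symmetric] by (intro prod_mono) auto
  have "exp (pi / a * (\<Sum>n\<in>A. ?d n)) / 2 ^ card A * row_const a b
      \<le> exp (pi / a * (\<Sum>n\<in>A. ?d n)) / 2 ^ card A * exp (- ((\<Sum>n\<in>A. exp (- (2 * pi / a * ?d n))) / (1 - q)))"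
    using sum_exp_dist_rows_le[of b "2 * pi / a" A "Im z"] assms q
    unfolding row_const_def q_def[symmetric]
    by (intro mult_left_mono) (auto intro!: divide_right_mono)
  also have "\<dots> = (\<Prod>n\<in>A. exp (pi / a * ?d n) / 2 * exp (- (exp (- (2 * pi / a * ?d n)) / (1 - q))))"
    using assms(3) by (simp add: prod.distrib prod_dividef exp_sum[symmetric] sum_distrib_left sum_divide_distrib sum_negf)
  finally show ?thesis
    using prod by simp
qed

text \<open>A finite product that replaces the Weierstrass sigma function of the lattice \<open>(a m, b n)\<close>. In
the strip that contains the rows, the sines alone grow like \<open>exp (\<pi> y\<^sup>2 / (a b))\<close> in \<open>z = x + i y\<close>; the
exponential factor turns this into the rotation invariant growth \<open>exp (\<pi> \<bar>z\<bar>\<^sup>2 / (2 a b))\<close>.\<close>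

definition row_product :: "real \<Rightarrow> real \<Rightarrow> nat \<Rightarrow> complex \<Rightarrow> complex" where
  "row_product a b N z = exp (of_real (pi / (2 * a * b)) * z\<^sup>2) * (\<Prod>n\<in>{- int N..int N}. row_factor a b n z)"

text \<open>The normalisation of \<^const>\<open>row_product\<close>: the part of its size that depends on \<open>N\<close> but not on the
point. It cancels in the interpolation formula.\<close>

definition row_scale :: "real \<Rightarrow> real \<Rightarrow> nat \<Rightarrow> real" where
  "row_scale a b N = exp (pi * b / a * (real N * (real N + 1))) / 2 ^ (2 * N + 1)"

lemma row_scale_pos: "row_scale a b N > 0"
  by (simp add: row_scale_def)

lemma row_const_pos: "row_const a b > 0"
  by (simp add: row_const_def)

lemma card_rows: "card {- int N..int N} = 2 * N + 1"
  by simp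

lemma sum_dist_rows:
  assumes "b > 0" "\<bar>y\<bar> \<le> (real N + 1) * b"
  shows "y\<^sup>2 / b + b * (real N * (real N + 1)) \<le> (\<Sum>n\<in>{- int N..int N}. \<bar>y - of_int n * b\<bar>)"
    and "(\<Sum>n\<in>{- int N..int N}. \<bar>y - of_int n * b\<bar>) \<le> y\<^sup>2 / b + b * (real N * (real N + 1)) + b / 4"
proof -
  have "\<bar>y - of_int n * b\<bar> = b * \<bar>y / b - of_int n\<bar>" for n
  proof -
    have "y - of_int n * b = b * (y / b - of_int n)"
      using assms(1) by (simp add: algebra_simps)
    then show ?thesis
      using assms(1) by (simp add: abs_mult)
  qed
  then have sum: "(\<Sum>n\<in>{- int N..int N}. \<bar>y - of_int n * b\<bar>) = b * (\<Sum>n\<in>{- int N..int N}. \<bar>y / b - of_int n\<bar>)"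
    by (simp add: sum_distrib_left)
  have "\<bar>y / b\<bar> \<le> real N + 1"
    using assms by (simp add: field_simps)
  note * = sum_abs_rows[OF this]
  have y: "y\<^sup>2 / b = b * (y / b)\<^sup>2"
    using assms(1) by (simp add: power2_eq_square)
  show "y\<^sup>2 / b + b * (real N * (real N + 1)) \<le> (\<Sum>n\<in>{- int N..int N}. \<bar>y - of_int n * b\<bar>)"
    using mult_left_mono[OF conjunct1[OF *], of b] assms(1) unfolding sum y by (simp only: distrib_left)
  show "(\<Sum>n\<in>{- int N..int N}. \<bar>y - of_int n * b\<bar>) \<le> y\<^sup>2 / b + b * (real N * (real N + 1)) + b / 4"
    using mult_left_mono[OF conjunct2[OF *], of b] assms(1) unfolding sum y by (simp only: distrib_left) simp
qed

text \<open>The exponential factor of \<^const>\<open>row_product\<close> turns the growth in \<open>Im z\<close> that comes from the sines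
into growth in \<open>\<bar>z\<bar>\<close>.\<close>

lemma norm_gauss_factor:
  assumes "a > 0" "b > 0"
  shows "cmod (exp (of_real (pi / (2 * a * b)) * z\<^sup>2)) * exp (pi / a * ((Im z)\<^sup>2 / b + b * (real N * (real N + 1)))) / 2 ^ (2 * N + 1)
    = row_scale a b N * exp (pi / (2 * a * b) * (cmod z)\<^sup>2)"
proof -
  have "pi / (2 * a * b) * ((Re z)\<^sup>2 - (Im z)\<^sup>2) + pi / a * ((Im z)\<^sup>2 / b + b * (real N * (real N + 1)))
      = pi * b / a * (real N * (real N + 1)) + pi / (2 * a * b) * ((Re z)\<^sup>2 + (Im z)\<^sup>2)"
    using assms by (simp add: field_simps)
  then show ?thesis
    unfolding row_scale_def cmod_power2 norm_exp_eq_Re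
    by (simp add: exp_add[symmetric] Re_power2)
qed

lemma norm_row_product_le:
  assumes "a > 0" "b > 0" "\<bar>Im z\<bar> \<le> (real N + 1) * b"
  shows "cmod (row_product a b N z) \<le>
    exp (row_bound (2 * pi / a) b + pi * b / (4 * a)) * row_scale a b N * exp (pi / (2 * a * b) * (cmod z)\<^sup>2)"
proof -
  let ?E = "cmod (exp (of_real (pi / (2 * a * b)) * z\<^sup>2))"
  have "pi / a * (\<Sum>n\<in>{- int N..int N}. \<bar>Im z - of_int n * b\<bar>) \<le>
      pi / a * ((Im z)\<^sup>2 / b + b * (real N * (real N + 1)) + b / 4)"
    using assms by (intro mult_left_mono sum_dist_rows) auto
  also have "\<dots> = pi / a * ((Im z)\<^sup>2 / b + b * (real N * (real N + 1))) + pi * b / (4 * a)"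
    by (simp add: algebra_simps)
  finally have le: "exp (pi / a * (\<Sum>n\<in>{- int N..int N}. \<bar>Im z - of_int n * b\<bar>)) \<le>
      exp (pi / a * ((Im z)\<^sup>2 / b + b * (real N * (real N + 1)))) * exp (pi * b / (4 * a))"
    by (simp add: exp_add[symmetric])
  have "cmod (row_product a b N z) \<le> ?E * (exp (pi / a * (\<Sum>n\<in>{- int N..int N}. \<bar>Im z - of_int n * b\<bar>)) /
      2 ^ card {- int N..int N} * exp (row_bound (2 * pi / a) b))"
    unfolding row_product_def norm_mult using assms by (intro mult_left_mono prod_row_factor_le) auto
  also have "\<dots> \<le> ?E * ((exp (pi / a * ((Im z)\<^sup>2 / b + b * (real N * (real N + 1)))) * exp (pi * b / (4 * a))) /
      2 ^ card {- int N..int N} * exp (row_bound (2 * pi / a) b))"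
    by (intro mult_left_mono mult_right_mono divide_right_mono le) auto
  also have "\<dots> = (?E * exp (pi / a * ((Im z)\<^sup>2 / b + b * (real N * (real N + 1)))) / 2 ^ (2 * N + 1)) *
       exp (row_bound (2 * pi / a) b + pi * b / (4 * a))"
    unfolding card_rows by (simp add: exp_add mult_ac)
  finally show ?thesis
    unfolding norm_gauss_factor[OF assms(1,2)] by (simp add: mult_ac)
qed

lemma row_const_le_1:
  assumes "a > 0" "b > 0"
  shows "row_const a b \<le> 1"
  using assms by (auto simp: row_const_def row_bound_def intro!: divide_nonneg_nonneg)

lemma gauss_sum_ge:
  assumes "a > 0" "b > 0" "\<bar>Im z\<bar> \<le> (real N + 1) * b"
  shows "row_scale a b N * exp (pi / (2 * a * b) * (cmod z)\<^sup>2) \<le>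
    cmod (exp (of_real (pi / (2 * a * b)) * z\<^sup>2)) *
      (exp (pi / a * (\<Sum>n\<in>{- int N..int N}. \<bar>Im z - of_int n * b\<bar>)) / 2 ^ (2 * N + 1))"
proof -
  have "pi / a * ((Im z)\<^sup>2 / b + b * (real N * (real N + 1))) \<le>
      pi / a * (\<Sum>n\<in>{- int N..int N}. \<bar>Im z - of_int n * b\<bar>)"
    using assms by (intro mult_left_mono sum_dist_rows) auto
  then show ?thesis
    unfolding norm_gauss_factor[OF assms(1,2), symmetric] times_divide_eq_right
    by (intro divide_right_mono mult_left_mono) auto
qed

text \<open>The horizontal edges of the box run midway between two rows, so every row is at distance at
least \<open>b / 2\<close>.\<close>

lemma norm_row_product_ge_horizontal:
  assumes "a > 0" "b > 0" "\<bar>Im z\<bar> = (real N + 1 / 2) * b"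
  shows "row_const a b * row_scale a b N * exp (pi / (2 * a * b) * (cmod z)\<^sup>2) \<le> cmod (row_product a b N z)"
proof -
  let ?E = "cmod (exp (of_real (pi / (2 * a * b)) * z\<^sup>2))"
  have away: "b / 2 \<le> \<bar>Im z - of_int n * b\<bar>" if "n \<in> {- int N..int N}" for n
  proof -
    have "\<bar>of_int n\<bar> \<le> real N" using that by auto
    then have "\<bar>of_int n * b\<bar> \<le> real N * b"
      using assms(2) by (simp add: abs_mult mult_right_mono)
    then show ?thesis
      using assms(3) unfolding distrib_right by (auto simp: abs_if split: if_splits)
  qed
  have "(real N + 1 / 2) * b \<le> (real N + 1) * b"
    using assms by simp
  then have "row_const a b * (row_scale a b N * exp (pi / (2 * a * b) * (cmod z)\<^sup>2)) \<le> row_const a b *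
     (?E * (exp (pi / a * (\<Sum>n\<in>{- int N..int N}. \<bar>Im z - of_int n * b\<bar>)) / 2 ^ (2 * N + 1)))"
    using assms by (intro mult_left_mono gauss_sum_ge less_imp_le[OF row_const_pos]) auto
  also have "\<dots> = ?E * (exp (pi / a * (\<Sum>n\<in>{- int N..int N}. \<bar>Im z - of_int n * b\<bar>)) /
      2 ^ card {- int N..int N} * row_const a b)"
    unfolding card_rows by (simp add: mult_ac)
  also have "\<dots> \<le> cmod (row_product a b N z)"
    unfolding row_product_def norm_mult using assms by (intro mult_left_mono prod_row_factor_ge away) auto
  finally show ?thesis by (simp add: mult_ac)
qed

text \<open>On the vertical edges every sine is at an antinode, and each factor attains its asymptotic
size.\<close>

lemma norm_row_product_ge_vertical:
  assumes "a > 0" "b > 0" "\<bar>Im z\<bar> \<le> (real N + 1) * b" "Re z = a * (of_int m + 1 / 2)"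
  shows "row_const a b * row_scale a b N * exp (pi / (2 * a * b) * (cmod z)\<^sup>2) \<le> cmod (row_product a b N z)"
proof -
  let ?E = "cmod (exp (of_real (pi / (2 * a * b)) * z\<^sup>2))"
  let ?d = "\<lambda>n. \<bar>Im z - of_int n * b\<bar>"
  have "exp (pi / a * ?d n) / 2 \<le> cmod (row_factor a b n z)" for n
    using norm_sin_antinode[of "of_real (pi / a) * (z - \<i> * of_real (of_int n * b))" m] assms
    unfolding Im_row_arg Re_row_arg row_factor_def by (simp add: abs_mult)
  then have "(\<Prod>n\<in>{- int N..int N}. exp (pi / a * ?d n) / 2) \<le> cmod (\<Prod>n\<in>{- int N..int N}. row_factor a b n z)"
    unfolding prod_norm[symmetric] by (intro prod_mono) auto
  also have "(\<Prod>n\<in>{- int N..int N}. exp (pi / a * ?d n) / 2) =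
      exp (pi / a * (\<Sum>n\<in>{- int N..int N}. ?d n)) / 2 ^ (2 * N + 1)"
    unfolding card_rows[symmetric] by (simp only: prod_dividef prod_constant exp_sum sum_distrib_left finite_atLeastAtMost_int)
  finally have "?E * (exp (pi / a * (\<Sum>n\<in>{- int N..int N}. ?d n)) / 2 ^ (2 * N + 1)) \<le> cmod (row_product a b N z)"
    unfolding row_product_def norm_mult by (intro mult_left_mono) auto
  then have "row_scale a b N * exp (pi / (2 * a * b) * (cmod z)\<^sup>2) \<le> cmod (row_product a b N z)"
    using gauss_sum_ge[OF assms(1-3)] by linarith
  moreover have "row_const a b * (row_scale a b N * exp (pi / (2 * a * b) * (cmod z)\<^sup>2)) \<le>
      1 * (row_scale a b N * exp (pi / (2 * a * b) * (cmod z)\<^sup>2))"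
    using row_const_le_1[OF assms(1,2)] row_scale_pos[of a b N] by (intro mult_right_mono) auto
  ultimately show ?thesis by (simp add: mult_ac)
qed

lemma row_factor_eq_0_iff:
  assumes "a > 0"
  shows "row_factor a b n z = 0 \<longleftrightarrow> (\<exists>m::int. z = Complex (a * of_int m) (b * of_int n))"
proof -
  have "row_factor a b n z = 0 \<longleftrightarrow> (\<exists>m::int. of_real (pi / a) * (z - \<i> * of_real (of_int n * b)) = of_real (of_int m * pi))"
    unfolding row_factor_def sin_eq_0 by simp
  also have "\<dots> \<longleftrightarrow> (\<exists>m::int. z = Complex (a * of_int m) (b * of_int n))"
    using assms by (intro iff_exI) (auto simp: complex_eq_iff field_simps)
  finally show ?thesis .
qed

lemma row_product_eq_0_iff:
  assumes "a > 0"
  shows "row_product a b N z = 0 \<longleftrightarrow>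
    (\<exists>m n :: int. \<bar>n\<bar> \<le> int N \<and> z = Complex (a * of_int m) (b * of_int n))"
proof -
  have "row_product a b N z = 0 \<longleftrightarrow> (\<exists>n\<in>{- int N..int N}. row_factor a b n z = 0)"
    unfolding row_product_def by simp
  then show ?thesis
    unfolding row_factor_eq_0_iff[OF assms] Bex_def atLeastAtMost_iff abs_le_iff
    by (metis minus_le_iff)
qed

lemma row_product_holomorphic: "row_product a b N holomorphic_on A"
  unfolding row_product_def row_factor_def by (intro holomorphic_intros)

text \<open>Only the factor of the row through \<open>z\<close> vanishes, with derivative \<open>\<pi> / a\<close> in modulus; all other
rows are at distance at least \<open>b\<close>.\<close>

lemma row_product_deriv_at_zero:
  assumes "a > 0" "b > 0" "\<bar>n\<bar> \<le> int N" "z = Complex (a * of_int m) (b * of_int n)"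
  obtains D where "(row_product a b N has_field_derivative D) (at z)"
    and "pi / a * row_const a b * row_scale a b N * exp (pi / (2 * a * b) * (cmod z)\<^sup>2) \<le> cmod D"
proof -
  let ?I = "{- int N..int N}"
  let ?J = "?I - {n}"
  let ?E = "\<lambda>z. exp (of_real (pi / (2 * a * b)) * z\<^sup>2)"
  define R where "R = (\<lambda>z. ?E z * (\<Prod>k\<in>?J. row_factor a b k z))"
  let ?d = "\<lambda>k. \<bar>Im z - of_int k * b\<bar>"
  have n: "n \<in> ?I" using assms(3) by auto
  have split: "row_product a b N = (\<lambda>z. row_factor a b n z * R z)"
    unfolding row_product_def R_def by (rule ext, subst prod.remove[OF _ n]) (auto simp: mult_ac)
  have arg: "of_real (pi / a) * (z - \<i> * of_real (of_int n * b)) = of_real (pi * of_int m)"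
    using assms by (simp add: complex_eq_iff field_simps)
  have "cmod (cos (of_real (pi * of_int m) :: complex)) = \<bar>cos (pi * of_int m)\<bar>"
    by (metis cos_of_real norm_of_real)
  then have cos: "cmod (cos (of_real (pi * of_int m) :: complex)) = 1"
    by simp
  have "(row_factor a b n has_field_derivative cos (of_real (pi * of_int m)) * of_real (pi / a)) (at z)"
    unfolding row_factor_def arg[symmetric] using assms(1) by (auto intro!: derivative_eq_intros)
  note d1 = this
  have "R holomorphic_on UNIV"
    unfolding R_def row_factor_def by (intro holomorphic_intros)
  then have "(R has_field_derivative deriv R z) (at z)"
    by (simp add: holomorphic_derivI)
  note d2 = this
  have "row_factor a b n z = 0"
    using assms by (subst row_factor_eq_0_iff) auto
  then have D: "(row_product a b N has_field_derivative (cos (of_real (pi * of_int m)) * of_real (pi / a)) * R z) (at z)"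
    unfolding split using DERIV_mult[OF d1 d2] by simp
  have away: "b / 2 \<le> ?d k" if "k \<in> ?J" for k
  proof -
    have "1 \<le> \<bar>real_of_int n - of_int k\<bar>"
    proof -
      have "1 \<le> \<bar>n - k\<bar>" using that by auto
      then have "real_of_int 1 \<le> of_int \<bar>n - k\<bar>" by (simp only: of_int_le_iff)
      then show ?thesis by simp
    qed
    then have "1 * b \<le> \<bar>real_of_int n - of_int k\<bar> * b"
      using assms(2) by (intro mult_right_mono) auto
    also have "\<dots> = ?d k"
    proof -
      have "Im z - of_int k * b = (real_of_int n - of_int k) * b"
        using assms(4) by (simp add: algebra_simps)
      then show ?thesis
        using assms(2) by (simp add: abs_mult)
    qed
    finally show ?thesis using assms(2) by simp
  qed
  have card: "card ?J = 2 * N"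
    using n by simp
  have sumJ: "(\<Sum>k\<in>?J. ?d k) = (\<Sum>k\<in>?I. ?d k)"
    using sum.remove[OF _ n, of ?d] assms(4) by simp
  have "\<bar>real_of_int n\<bar> * b \<le> (real N + 1) * b"
    using assms(2,3) by (intro mult_right_mono) auto
  then have Im: "\<bar>Im z\<bar> \<le> (real N + 1) * b"
    using assms(2,4) by (simp add: abs_mult mult.commute)
  have "row_const a b * (row_scale a b N * exp (pi / (2 * a * b) * (cmod z)\<^sup>2)) \<le>
      row_const a b * (cmod (?E z) * (exp (pi / a * (\<Sum>k\<in>?I. ?d k)) / 2 ^ (2 * N + 1)))"
    using assms Im by (intro mult_left_mono gauss_sum_ge less_imp_le[OF row_const_pos]) auto
  also have "\<dots> \<le> row_const a b * (cmod (?E z) * (exp (pi / a * (\<Sum>k\<in>?I. ?d k)) / 2 ^ (2 * N)))"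
    using row_const_pos[of a b] by (intro mult_left_mono divide_left_mono) auto
  also have "\<dots> = cmod (?E z) * (exp (pi / a * (\<Sum>k\<in>?J. ?d k)) / 2 ^ card ?J * row_const a b)"
    unfolding card sumJ by (simp add: mult_ac)
  also have "\<dots> \<le> cmod (R z)"
    unfolding R_def norm_mult using assms by (intro mult_left_mono prod_row_factor_ge away) auto
  finally have "row_const a b * (row_scale a b N * exp (pi / (2 * a * b) * (cmod z)\<^sup>2)) \<le> cmod (R z)" .
  then have "pi / a * (row_const a b * (row_scale a b N * exp (pi / (2 * a * b) * (cmod z)\<^sup>2))) \<le> pi / a * cmod (R z)"
    using assms(1) by (intro mult_left_mono) auto
  also have "pi / a * cmod (R z) = cmod ((cos (of_real (pi * of_int m)) * of_real (pi / a)) * R z)"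
    unfolding norm_mult cos using assms(1) by (simp add: norm_divide)
  finally show thesis
    using D by (intro that) (simp_all only: mult.assoc)
qed

section \<open>Interpolation on a box by residues\<close>

lemma contour_integral_rectpath_bound:
  assumes cont: "continuous_on (path_image (rectpath p q)) f"
    and bound: "\<And>z. z \<in> path_image (rectpath p q) \<Longrightarrow> cmod (f z) \<le> B"
    and le: "Re p \<le> Re q" "Im p \<le> Im q"
  shows "cmod (contour_integral (rectpath p q) f) \<le> B * (2 * (Re q - Re p) + 2 * (Im q - Im p))"
proof -
  define r s where "r = Complex (Re q) (Im p)" and "s = Complex (Re p) (Im q)"
  have rp: "rectpath p q = linepath p r +++ linepath r q +++ linepath q s +++ linepath s p"
    by (simp add: rectpath_def Let_def r_def s_def)
  have image: "path_image (rectpath p q) = closed_segment p r \<union> closed_segment r q \<union> closed_segment q s \<union> closed_segment s p"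
    unfolding rp by (simp add: path_image_join Un_assoc)
  have B: "0 \<le> B"
    using bound[of p] pathstart_in_path_image[of "rectpath p q"] norm_ge_zero[of "f p"]
    by (simp add: order_trans[OF norm_ge_zero])
  have ci: "f contour_integrable_on linepath u v" if "closed_segment u v \<subseteq> path_image (rectpath p q)" for u v
    using that by (intro contour_integrable_continuous_linepath continuous_on_subset[OF cont])
  have int: "f contour_integrable_on linepath p r" "f contour_integrable_on linepath r q"
      "f contour_integrable_on linepath q s" "f contour_integrable_on linepath s p"
    by (rule ci, unfold image, blast)+
  define I where "I u v = contour_integral (linepath u v) f" for u v
  have le: "cmod (I u v) \<le> B * cmod (v - u)" if "closed_segment u v \<subseteq> path_image (rectpath p q)" for u v
    unfolding I_def using ci[OF that] B
  proof (rule contour_integral_bound_linepath)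
    fix x assume "x \<in> closed_segment u v"
    then show "cmod (f x) \<le> B"
      using that by (intro bound) (rule subsetD)
  qed
  have eq: "contour_integral (rectpath p q) f = I p r + (I r q + (I q s + I s p))"
    unfolding rp I_def using int by (simp add: contour_integrable_joinI valid_path_join)
  have "cmod (I p r) \<le> B * cmod (r - p)" "cmod (I r q) \<le> B * cmod (q - r)"
      "cmod (I q s) \<le> B * cmod (s - q)" "cmod (I s p) \<le> B * cmod (p - s)"
    by (rule le, unfold image, blast)+
  then have "cmod (contour_integral (rectpath p q) f) \<le>
      B * cmod (r - p) + (B * cmod (q - r) + (B * cmod (s - q) + B * cmod (p - s)))"
    using norm_triangle_ineq[of "I p r" "I r q + (I q s + I s p)"]
      norm_triangle_ineq[of "I r q" "I q s + I s p"] norm_triangle_ineq[of "I q s" "I s p"]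
    unfolding eq
    by linarith
  also have "\<dots> = B * (2 * (Re q - Re p) + 2 * (Im q - Im p))"
  proof -
    have "cmod (r - p) = Re q - Re p" "cmod (s - q) = Re q - Re p"
        "cmod (q - r) = Im q - Im p" "cmod (p - s) = Im q - Im p"
      using assms(3,4) by (simp_all add: r_def s_def cmod_def)
    note norms = this
    show ?thesis
      unfolding norms by (simp add: algebra_simps)
  qed
  finally show ?thesis .
qed

text \<open>The numerator may vanish at the point as well; the singularity is then removable and the
formula still holds.\<close>

lemma residue_simple_zero_denominator:
  assumes "f holomorphic_on S" "g holomorphic_on S" "open S" "z \<in> S"
    and D: "(g has_field_derivative D) (at z)" "D \<noteq> 0" "g z = 0"
    and nz: "\<And>w. w \<in> S \<Longrightarrow> w \<noteq> z \<Longrightarrow> g w \<noteq> 0"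
  shows "residue (\<lambda>w. f w / g w) z = f z / D"
proof (rule residue_simple'[OF assms(3,4)])
  show "(\<lambda>w. f w / g w) holomorphic_on S - {z}"
    using assms(1,2) nz by (intro holomorphic_on_divide) (auto intro: holomorphic_on_subset)
  have "((\<lambda>w. g w / (w - z)) \<longlongrightarrow> D) (at z)"
    using D(1,3) by (simp add: has_field_derivative_iff)
  moreover have "(f \<longlongrightarrow> f z) (at z)"
    using assms(1,3,4) by (metis continuous_on_eq_continuous_at holomorphic_on_imp_continuous_on isCont_def)
  ultimately have "((\<lambda>w. f w / (g w / (w - z))) \<longlongrightarrow> f z / D) (at z)"
    using D(2) by (intro tendsto_divide) auto
  then show "((\<lambda>w. f w / g w * (w - z)) \<longlongrightarrow> f z / D) (at z)"
    by (simp add: mult.commute)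
qed

text \<open>The residue theorem for \<open>V / (S (\<cdot> - z))\<close>, where \<open>S\<close> is \<^const>\<open>row_product\<close>, over the rectangle with
half axes \<open>(N + 1/2) a\<close> and \<open>(N + 1/2) b\<close>. The residue at \<open>z\<close> is \<open>V z / S z\<close>, the other residues involve
only the values of \<open>V\<close> on the lattice, and \<open>e\<close> controls the integral over the boundary. The constants
do not depend on \<open>N\<close>.\<close>

lemma box_interpolation:
  fixes V :: "complex \<Rightarrow> complex"
  assumes ab: "a > 0" "b > 0"
    and V: "V holomorphic_on UNIV"
    and z: "\<bar>Re z\<bar> < (real N + 1 / 2) * a" "\<bar>Im z\<bar> < (real N + 1 / 2) * b"
    and d: "d > 0" "\<And>m n :: int. d \<le> cmod (Complex (a * of_int m) (b * of_int n) - z)"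
    and bd: "\<And>\<zeta>. \<bar>Re \<zeta>\<bar> \<le> (real N + 1 / 2) * a \<Longrightarrow> \<bar>Im \<zeta>\<bar> \<le> (real N + 1 / 2) * b \<Longrightarrow>
      \<bar>Re \<zeta>\<bar> = (real N + 1 / 2) * a \<or> \<bar>Im \<zeta>\<bar> = (real N + 1 / 2) * b \<Longrightarrow>
      cmod (V \<zeta>) \<le> e * exp (pi / (2 * a * b) * (cmod \<zeta>)\<^sup>2) * cmod (\<zeta> - z)"
  shows "cmod (V z) \<le> exp (row_bound (2 * pi / a) b + pi * b / (4 * a)) / row_const a b * exp (pi / (2 * a * b) * (cmod z)\<^sup>2) *
    (a / (pi * d) * (\<Sum>(m,n)\<in>{- int N..int N} \<times> {- int N..int N}.
        cmod (V (Complex (a * of_int m) (b * of_int n))) * exp (- (pi / (2 * a * b) * (cmod (Complex (a * of_int m) (b * of_int n)))\<^sup>2)))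
     + (2 * real N + 1) * (a + b) / pi * e)"
proof -
  define s where "s = pi / (2 * a * b)"
  define K where "K = row_scale a b N"
  define c where "c = row_const a b"
  define C where "C = exp (row_bound (2 * pi / a) b + pi * b / (4 * a))"
  have pos: "K > 0" "c > 0" "C > 0"
    by (simp_all add: K_def c_def C_def row_scale_pos row_const_pos)
  define S where "S = row_product a b N"
  define I where "I = {- int N..int N}"
  define pt where "pt = (\<lambda>(m::int,n::int). Complex (a * of_int m) (b * of_int n))"
  define L where "L = pt ` (I \<times> I)"
  have inj: "inj_on pt (I \<times> I)"
    using ab by (auto simp: inj_on_def pt_def)
  have fin: "finite L"
    by (simp add: L_def I_def)
  define x y where "x = (real N + 1 / 2) * a" and "y = (real N + 1 / 2) * b"
  define G where "G = {w. \<bar>Re w\<bar> < (real N + 1) * a \<and> \<bar>Im w\<bar> < (real N + 1) * b}"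
  define Q where "Q = rectpath (Complex (- x) (- y)) (Complex x y)"
  have xy: "0 < x" "0 < y" "x < (real N + 1) * a" "y < (real N + 1) * b"
    using ab by (auto simp: x_def y_def intro!: mult_strict_right_mono)
  have Gbox: "G = box (Complex (- ((real N + 1) * a)) (- ((real N + 1) * b))) (Complex ((real N + 1) * a) ((real N + 1) * b))"
    by (auto simp: G_def in_box_complex_iff abs_less_iff)
  have G: "open G" "connected G"
    unfolding Gbox by (auto intro: convex_connected)
  have imQ: "w \<in> path_image Q \<longleftrightarrow> \<bar>Re w\<bar> \<le> x \<and> \<bar>Im w\<bar> \<le> y \<and> (\<bar>Re w\<bar> = x \<or> \<bar>Im w\<bar> = y)" for w
  proof -
    have A: "u \<in> {- r, r} \<longleftrightarrow> \<bar>u\<bar> = r" "u \<in> {- r..r} \<longleftrightarrow> \<bar>u\<bar> \<le> r" if "r > 0" for u r :: real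
      using that by auto
    have "Re (Complex (- x) (- y)) \<le> Re (Complex x y)" "Im (Complex (- x) (- y)) \<le> Im (Complex x y)"
      using xy by simp_all
    note path_image_rectpath[OF this]
    then have "path_image Q = {z. \<bar>Re z\<bar> = x \<and> \<bar>Im z\<bar> \<le> y} \<union> {z. \<bar>Im z\<bar> = y \<and> \<bar>Re z\<bar> \<le> x}"
      unfolding Q_def[symmetric] complex.sel A[OF xy(1)] A[OF xy(2)] .
    then show ?thesis
      by auto
  qed
  have zeros: "w \<in> L" if w: "w \<in> G" and S0: "S w = 0" for w
  proof -
    obtain m n :: int where mn: "w = Complex (a * of_int m) (b * of_int n)"
      using S0 unfolding S_def row_product_eq_0_iff[OF ab(1)] by blast
    have "\<bar>of_int m\<bar> * a < (real N + 1) * a" "\<bar>of_int n\<bar> * b < (real N + 1) * b"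
      using w ab by (auto simp: G_def mn abs_mult mult.commute)
    then have "\<bar>real_of_int m\<bar> < real N + 1" "\<bar>real_of_int n\<bar> < real N + 1"
      using ab by simp_all
    then have "m \<in> I" "n \<in> I"
      by (auto simp: I_def)
    then show ?thesis
      unfolding L_def mn pt_def by (intro image_eqI[of _ _ "(m, n)"]) auto
  qed
  have Lex: "\<exists>m\<in>I. \<exists>n\<in>I. w = Complex (a * of_int m) (b * of_int n)" if wL: "w \<in> L" for w
  proof -
    from wL have "w \<in> pt ` (I \<times> I)"
      by (simp only: L_def)
    then obtain u where u: "u \<in> I \<times> I" "w = pt u"
      by (rule imageE)
    obtain m n where mn: "u = (m, n)"
      by (rule prod.exhaust)
    have "m \<in> I" "n \<in> I" using u(1) unfolding mn by auto
    moreover have "w = Complex (a * of_int m) (b * of_int n)"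
      unfolding u(2) mn pt_def by simp
    ultimately show ?thesis by blast
  qed
  have LS: "S w = 0" if wL: "w \<in> L" for w
  proof -
    obtain m n where mn: "m \<in> I" "n \<in> I" "w = Complex (a * of_int m) (b * of_int n)"
      using Lex[OF wL] by blast
    then have "\<bar>n\<bar> \<le> int N" by (auto simp: I_def)
    then show ?thesis
      using mn(3) unfolding S_def row_product_eq_0_iff[OF ab(1)] by blast
  qed
  have Lin: "\<bar>Re w\<bar> < x \<and> \<bar>Im w\<bar> < y" if wL: "w \<in> L" for w
  proof -
    obtain m n where mn: "m \<in> I" "n \<in> I" "w = Complex (a * of_int m) (b * of_int n)"
      using Lex[OF wL] by blast
    have "\<bar>real_of_int m\<bar> < real N + 1 / 2" "\<bar>real_of_int n\<bar> < real N + 1 / 2"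
      using mn(1,2) by (auto simp: I_def)
    then have "\<bar>real_of_int m\<bar> * a < x" "\<bar>real_of_int n\<bar> * b < y"
      using ab unfolding x_def y_def by (auto intro!: mult_strict_right_mono)
    then show ?thesis
      using ab mn(3) by (simp add: abs_mult mult.commute)
  qed
  have zL: "z \<notin> L"
  proof
    assume "z \<in> L"
    then obtain m n :: int where "z = Complex (a * of_int m) (b * of_int n)"
      using Lex by blast
    then show False
      using d(1) d(2)[of m n] by simp
  qed
  have zG: "z \<in> G"
    using z xy by (auto simp: G_def x_def y_def)
  have LG: "L \<subseteq> G"
  proof
    fix w assume "w \<in> L"
    then show "w \<in> G"
      using Lin[of w] xy unfolding G_def by simp
  qed
  have zS: "S z \<noteq> 0"
    using zeros zG zL by blast
  let ?f = "\<lambda>w. V w / (S w * (w - z))"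
  have holS: "S holomorphic_on A" for A
    unfolding S_def by (rule row_product_holomorphic)
  have holV: "V holomorphic_on A" for A
    using V holomorphic_on_subset by blast
  have hol: "?f holomorphic_on G - insert z L"
    using zeros by (intro holomorphic_on_divide holomorphic_on_mult holS holV holomorphic_intros) auto
  have pathG: "path_image Q \<subseteq> G - insert z L"
  proof
    fix w assume "w \<in> path_image Q"
    then have w: "\<bar>Re w\<bar> \<le> x" "\<bar>Im w\<bar> \<le> y" "\<bar>Re w\<bar> = x \<or> \<bar>Im w\<bar> = y"
      using imQ by blast+
    have "w \<in> G"
      using w(1,2) xy(3,4) unfolding G_def by simp
    moreover have "w \<noteq> z"
      using w(3) z unfolding x_def y_def by auto
    moreover have "w \<notin> L"
      using w(3) Lin by fastforce
    ultimately show "w \<in> G - insert z L" by simp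
  qed
  have wind: "winding_number Q w = 1" if "\<bar>Re w\<bar> < x" "\<bar>Im w\<bar> < y" for w
    unfolding Q_def using that by (intro winding_number_rectpath) (auto simp: in_box_complex_iff)
  have wind0: "winding_number Q w = 0" if "w \<notin> G" for w
    unfolding Q_def using that xy by (intro winding_number_rectpath_outside) (auto simp: in_cbox_complex_iff G_def)
  have resz: "residue ?f z = V z / S z"
  proof -
    have "residue ?f z = residue (\<lambda>w. (V w / S w) / (w - z)) z"
      by simp
    also have "\<dots> = V z / S z / 1"
    proof (rule residue_simple_zero_denominator)
      show "open (G - L)" "z \<in> G - L"
        using G(1) fin zG zL by (auto intro: open_Diff finite_imp_closed)
      show "(\<lambda>w. V w / S w) holomorphic_on G - L"
        using zeros by (intro holomorphic_on_divide holS holV) auto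
    qed (auto intro!: holomorphic_intros derivative_eq_intros)
    finally show ?thesis by simp
  qed
  have resL: "cmod (residue ?f w) \<le> cmod (V w) * exp (- (s * (cmod w)\<^sup>2)) * (a / (pi * d)) / (c * K)" if w: "w \<in> L" for w
  proof -
    obtain m n where mn: "n \<in> I" "w = Complex (a * of_int m) (b * of_int n)"
      using Lex[OF w] by blast
    have "\<bar>n\<bar> \<le> int N"
      using mn(1) by (auto simp: I_def)
    then obtain D where D: "(S has_field_derivative D) (at w)"
        "pi / a * c * K * exp (s * (cmod w)\<^sup>2) \<le> cmod D"
      using row_product_deriv_at_zero[OF ab _ mn(2)] unfolding S_def c_def K_def s_def by blast
    have lb: "0 < pi / a * c * K * exp (s * (cmod w)\<^sup>2)"
      using ab pos by simp
    then have D0: "D \<noteq> 0"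
      using D(2) by auto
    have wz: "w \<noteq> z" "d \<le> cmod (w - z)"
      using w zL d(2)[of m n] mn(2) by auto
    have "residue ?f w = residue (\<lambda>u. (V u / (u - z)) / S u) w"
      by (simp add: mult.commute)
    also have "\<dots> = V w / (w - z) / D"
    proof (rule residue_simple_zero_denominator)
      let ?H = "G - insert z (L - {w})"
      show "open ?H" "w \<in> ?H"
        using G(1) fin wz LG w by (auto intro!: open_Diff finite_imp_closed)
      show "(\<lambda>u. V u / (u - z)) holomorphic_on ?H"
        by (intro holomorphic_intros holV) auto
      show "S u \<noteq> 0" if "u \<in> ?H" "u \<noteq> w" for u
        using that zeros by auto
    qed (use holS D(1) D0 LS w in auto)
    finally have "cmod (residue ?f w) = cmod (V w) / (cmod (w - z) * cmod D)"
      by (simp add: norm_divide norm_mult)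
    also have "\<dots> \<le> cmod (V w) / (d * (pi / a * c * K * exp (s * (cmod w)\<^sup>2)))"
      using lb wz d(1) D(2) pos ab D0 by (intro divide_left_mono mult_mono mult_pos_pos) simp_all
    also have "\<dots> = cmod (V w) * exp (- (s * (cmod w)\<^sup>2)) * (a / (pi * d)) / (c * K)"
      using ab d pos by (simp add: field_simps exp_minus)
    finally show ?thesis .
  qed
  have "contour_integral Q ?f = 2 * pi * \<i> * (\<Sum>p\<in>insert z L. winding_number Q p * residue ?f p)"
    using G fin hol pathG wind0 unfolding Q_def by (intro Residue_theorem) auto
  also have "(\<Sum>p\<in>insert z L. winding_number Q p * residue ?f p) = (\<Sum>p\<in>insert z L. residue ?f p)"
    using wind Lin z by (intro sum.cong) (auto simp: x_def y_def)
  also have "\<dots> = V z / S z + (\<Sum>p\<in>L. residue ?f p)"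
    using fin zL resz by simp
  finally have RT: "V z / S z = contour_integral Q ?f / (2 * pi * \<i>) - (\<Sum>p\<in>L. residue ?f p)"
    by simp
  have "cmod (contour_integral Q ?f) \<le> e / (c * K) * (2 * (Re (Complex x y) - Re (Complex (- x) (- y))) + 2 * (Im (Complex x y) - Im (Complex (- x) (- y))))"
    unfolding Q_def
  proof (rule contour_integral_rectpath_bound)
    show "continuous_on (path_image (rectpath (Complex (- x) (- y)) (Complex x y))) ?f"
      using hol pathG unfolding Q_def by (meson continuous_on_subset holomorphic_on_imp_continuous_on)
    fix w assume "w \<in> path_image (rectpath (Complex (- x) (- y)) (Complex x y))"
    then have w: "w \<in> path_image Q" unfolding Q_def .
    then have wQ: "\<bar>Re w\<bar> \<le> x" "\<bar>Im w\<bar> \<le> y" "\<bar>Re w\<bar> = x \<or> \<bar>Im w\<bar> = y"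
      using imQ by auto
    have wz: "w \<noteq> z" using w pathG by auto
    have Vw: "cmod (V w) \<le> e * exp (s * (cmod w)\<^sup>2) * cmod (w - z)"
      using bd wQ unfolding x_def y_def s_def by blast
    have Sw: "c * K * exp (s * (cmod w)\<^sup>2) \<le> cmod (S w)"
    proof (cases "\<bar>Im w\<bar> = y")
      case True
      then show ?thesis
        using norm_row_product_ge_horizontal[OF ab] unfolding c_def K_def s_def S_def y_def by blast
    next
      case False
      then have "\<bar>Re w\<bar> = x" using wQ by auto
      then have "Re w = x \<or> Re w = - x" by linarith
      then have "\<exists>m::int. Re w = a * (of_int m + 1 / 2)"
      proof
        assume "Re w = x"
        then show ?thesis by (intro exI[of _ "int N"]) (simp add: x_def mult.commute)
      next
        assume "Re w = - x"
        then show ?thesis by (intro exI[of _ "- int N - 1"]) (simp add: x_def algebra_simps)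
      qed
      then show ?thesis
        using norm_row_product_ge_vertical[OF ab] wQ(2) xy unfolding c_def K_def s_def S_def by force
    qed
    have "cmod (?f w) = cmod (V w) / (cmod (S w) * cmod (w - z))"
      by (simp add: norm_divide norm_mult)
    also have "\<dots> \<le> (e * exp (s * (cmod w)\<^sup>2) * cmod (w - z)) / ((c * K * exp (s * (cmod w)\<^sup>2)) * cmod (w - z))"
      using Vw Sw pos wz order_trans[OF norm_ge_zero Vw] by (intro frac_le mult_right_mono) auto
    also have "\<dots> = e / (c * K)"
      using wz by simp
    finally show "cmod (?f w) \<le> e / (c * K)" .
  qed (use xy in auto)
  also have "\<dots> = e / (c * K) * (2 * ((2 * real N + 1) * (a + b)))"
    by (simp add: x_def y_def algebra_simps)
  finally have "cmod (contour_integral Q ?f) \<le> e / (c * K) * (2 * ((2 * real N + 1) * (a + b)))" .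
  then have "cmod (contour_integral Q ?f) / (2 * pi) \<le> e / (c * K) * (2 * ((2 * real N + 1) * (a + b))) / (2 * pi)"
    by (rule divide_right_mono) simp
  also have "\<dots> = ((2 * real N + 1) * (a + b) / pi * e) / (c * K)"
    using pos by (simp add: field_simps)
  also have "cmod (contour_integral Q ?f) / (2 * pi) = cmod (contour_integral Q ?f / (2 * pi * \<i>))"
    by (simp add: norm_divide norm_mult)
  finally have int: "cmod (contour_integral Q ?f / (2 * pi * \<i>)) \<le> ((2 * real N + 1) * (a + b) / pi * e) / (c * K)" .
  have "cmod (\<Sum>p\<in>L. residue ?f p) \<le> (\<Sum>p\<in>L. cmod (V p) * exp (- (s * (cmod p)\<^sup>2)) * (a / (pi * d)) / (c * K))"
    by (intro sum_norm_le resL)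
  also have "\<dots> = (a / (pi * d) * (\<Sum>p\<in>L. cmod (V p) * exp (- (s * (cmod p)\<^sup>2)))) / (c * K)"
    by (simp add: sum_divide_distrib sum_distrib_left mult_ac)
  also have "(\<Sum>p\<in>L. cmod (V p) * exp (- (s * (cmod p)\<^sup>2))) =
      (\<Sum>(m,n)\<in>I \<times> I. cmod (V (Complex (a * of_int m) (b * of_int n))) * exp (- (s * (cmod (Complex (a * of_int m) (b * of_int n)))\<^sup>2)))"
    unfolding L_def by (subst sum.reindex[OF inj]) (auto simp: pt_def intro!: sum.cong)
  finally have sums: "cmod (\<Sum>p\<in>L. residue ?f p) \<le>
      (a / (pi * d) * (\<Sum>(m,n)\<in>I \<times> I. cmod (V (Complex (a * of_int m) (b * of_int n))) * exp (- (s * (cmod (Complex (a * of_int m) (b * of_int n)))\<^sup>2)))) / (c * K)"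
    (is "_ \<le> ?B / _") .
  let ?A = "(2 * real N + 1) * (a + b) / pi * e"
  have "cmod (V z / S z) \<le> ?A / (c * K) + ?B / (c * K)"
    unfolding RT by (rule order_trans[OF norm_triangle_ineq4 add_mono[OF int sums]])
  also have "\<dots> = (?B + ?A) / (c * K)"
    by (simp add: add_divide_distrib)
  finally have quot: "cmod (V z / S z) \<le> (?B + ?A) / (c * K)" .
  have "cmod (S z) \<le> C * K * exp (s * (cmod z)\<^sup>2)"
  proof -
    have "\<bar>Im z\<bar> \<le> (real N + 1) * b"
      using z(2) xy(4) unfolding y_def by linarith
    then show ?thesis
      using ab unfolding C_def K_def s_def S_def by (intro norm_row_product_le)
  qed
  then have "cmod (S z) * cmod (V z / S z) \<le> (C * K * exp (s * (cmod z)\<^sup>2)) * ((?B + ?A) / (c * K))"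
    using quot pos by (intro mult_mono) auto
  also have "cmod (S z) * cmod (V z / S z) = cmod (V z)"
    using zS by (simp add: norm_divide)
  also have "(C * K * exp (s * (cmod z)\<^sup>2)) * ((?B + ?A) / (c * K)) = C / c * exp (s * (cmod z)\<^sup>2) * (?B + ?A)"
    using pos by (simp add: field_simps)
  finally show ?thesis
    unfolding C_def c_def s_def I_def .
qed

section \<open>Entire functions that are small on a lattice\<close>

definition lattice_point :: "real \<Rightarrow> real \<Rightarrow> int \<times> int \<Rightarrow> complex" where
  "lattice_point a b k = Complex (a * of_int (fst k)) (b * of_int (snd k))"

text \<open>The sum factors over the two coordinates, and since \<open>m\<^sup>2 \<ge> \<bar>m\<bar>\<close> for integers, each factor is
dominated by a geometric series.\<close>

lemma lattice_gauss_sum_bound: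
  assumes "a > 0" "b > 0" "\<kappa> > 0"
  obtains B where "B > 0"
    "\<And>A. finite A \<Longrightarrow> (\<Sum>k\<in>A. exp (- (\<kappa> * (cmod (lattice_point a b k))\<^sup>2))) \<le> B"
proof -
  define x where "x c = exp (- (\<kappa> * c\<^sup>2))" for c :: real
  define B where "B = 2 / (1 - x a) * (2 / (1 - x b))"
  have x: "0 < x c" "x c < 1" if "c > 0" for c
    using that assms(3) by (auto simp: x_def)
  have one: "exp (- (\<kappa> * (c * of_int m)\<^sup>2)) \<le> x c ^ nat \<bar>m - 0\<bar>" if "c > 0" for c :: real and m :: int
  proof -
    have "\<bar>m\<bar> \<le> m\<^sup>2"
    proof (cases "m = 0")
      case False
      then have "\<bar>m\<bar> * 1 \<le> \<bar>m\<bar> * \<bar>m\<bar>"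
        by (intro mult_left_mono) auto
      then show ?thesis
        by (simp add: power2_eq_square)
    qed simp
    then have "real_of_int \<bar>m\<bar> \<le> real_of_int (m\<^sup>2)"
      by (simp only: of_int_le_iff)
    then have "\<kappa> * c\<^sup>2 * \<bar>real_of_int m\<bar> \<le> \<kappa> * c\<^sup>2 * (real_of_int m)\<^sup>2"
      using assms(3) by (intro mult_left_mono) auto
    then have "exp (- (\<kappa> * (c * of_int m)\<^sup>2)) \<le> exp (of_nat (nat \<bar>m\<bar>) * - (\<kappa> * c\<^sup>2))"
      by (simp add: power_mult_distrib algebra_simps)
    also have "\<dots> = x c ^ nat \<bar>m\<bar>"
      unfolding x_def by (rule exp_of_nat_mult)
    finally show ?thesis by simp
  qed
  have "(\<Sum>k\<in>A. exp (- (\<kappa> * (cmod (lattice_point a b k))\<^sup>2))) \<le> B" if A: "finite A" for A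
  proof -
    have "(\<Sum>k\<in>A. exp (- (\<kappa> * (cmod (lattice_point a b k))\<^sup>2)))
        \<le> (\<Sum>k\<in>fst ` A \<times> snd ` A. exp (- (\<kappa> * (cmod (lattice_point a b k))\<^sup>2)))"
      using A by (intro sum_mono2 subset_fst_snd) auto
    also have "\<dots> \<le> (\<Sum>k\<in>fst ` A \<times> snd ` A. x a ^ nat \<bar>fst k - 0\<bar> * x b ^ nat \<bar>snd k - 0\<bar>)"
    proof (rule sum_mono)
      fix k
      have "exp (- (\<kappa> * (cmod (lattice_point a b k))\<^sup>2)) =
          exp (- (\<kappa> * (a * of_int (fst k))\<^sup>2)) * exp (- (\<kappa> * (b * of_int (snd k))\<^sup>2))"
        by (simp add: lattice_point_def cmod_power2 exp_add[symmetric] distrib_left)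
      also have "\<dots> \<le> x a ^ nat \<bar>fst k - 0\<bar> * x b ^ nat \<bar>snd k - 0\<bar>"
        using one[of a] one[of b] assms x[of a] x[of b] by (intro mult_mono) auto
      finally show "exp (- (\<kappa> * (cmod (lattice_point a b k))\<^sup>2)) \<le> x a ^ nat \<bar>fst k - 0\<bar> * x b ^ nat \<bar>snd k - 0\<bar>" .
    qed
    also have "\<dots> = (\<Sum>m\<in>fst ` A. x a ^ nat \<bar>m - 0\<bar>) * (\<Sum>n\<in>snd ` A. x b ^ nat \<bar>n - 0\<bar>)"
      by (simp add: sum_product sum.cartesian_product case_prod_beta)
    also have "\<dots> \<le> B"
      unfolding B_def using A assms x by (intro mult_mono sum_geometric_int_le) (auto intro!: sum_nonneg simp: less_imp_le)
    finally show ?thesis .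
  qed
  moreover have "B > 0"
    using x assms by (simp add: B_def)
  ultimately show thesis
    using that by blast
qed

definition gaussian_growth :: "real \<Rightarrow> (complex \<Rightarrow> complex) \<Rightarrow> bool" where
  "gaussian_growth \<sigma> F \<longleftrightarrow> (\<exists>C>0. \<forall>z. cmod (F z) \<le> C * exp (\<sigma> * (cmod z)\<^sup>2))"

lemma linear_le_quadratic:
  fixes c e t :: real
  assumes "e > 0"
  shows "c * t \<le> e * t\<^sup>2 + c\<^sup>2 / (4 * e)"
proof -
  have "0 \<le> e * (t - c / (2 * e))\<^sup>2"
    using assms by simp
  also have "\<dots> = e * t\<^sup>2 - c * t + c\<^sup>2 / (4 * e)"
    using assms by (simp add: power2_eq_square field_simps)
  finally show ?thesis by simp
qed

text \<open>Apply \<open>box_interpolation\<close> to \<open>V w = W w * exp (2 s (cnj z) w)\<close>, where \<open>s = \<pi> / (2 a b)\<close>. The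
exponential has order one, so it does not disturb the growth condition on \<open>W\<close>, but at the fixed
point \<open>z\<close> it recentres the Gaussian: the lattice point \<open>l\<close> enters with the weight \<open>exp (- s \<bar>z - l\<bar>\<^sup>2)\<close>.
Together with the decay of \<open>W\<close> on the lattice this makes \<open>W z\<close> decay like a Gaussian for \<open>z\<close> away from
the lattice.\<close>

lemma lattice_interpolation_bound:
  assumes ab: "a > 0" "b > 0"
    and W: "W holomorphic_on UNIV"
    and \<sigma>: "0 \<le> \<sigma>" "\<sigma> < pi / (2 * a * b)" "gaussian_growth \<sigma> W"
    and d: "d > 0" and \<eta>: "\<eta> > 0" and C2: "C\<^sub>2 > 0"
    and small: "\<And>k. cmod (W (lattice_point a b k)) \<le> C\<^sub>2 * exp (- (\<eta> * (cmod (lattice_point a b k))\<^sup>2))"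
  obtains A \<kappa> where "A > 0" "\<kappa> > 0"
    "\<forall>z. (\<forall>k. d \<le> cmod (lattice_point a b k - z)) \<longrightarrow> cmod (W z) \<le> A * exp (- (\<kappa> * (cmod z)\<^sup>2))"
proof -
  define s where "s = pi / (2 * a * b)"
  have s: "s > 0" "\<sigma> < s"
    using ab \<sigma> by (simp_all add: s_def)
  define P where "P = exp (row_bound (2 * pi / a) b + pi * b / (4 * a)) / row_const a b"
  have P: "P > 0"
    by (simp add: P_def row_const_pos)
  define \<kappa> where "\<kappa> = min s \<eta> / 4"
  have \<kappa>: "\<kappa> > 0"
    using s \<eta> by (simp add: \<kappa>_def)
  obtain B where B: "B > 0"
    "\<And>A. finite A \<Longrightarrow> (\<Sum>k\<in>A. exp (- (\<eta> / 2 * (cmod (lattice_point a b k))\<^sup>2))) \<le> B"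
    using lattice_gauss_sum_bound[OF ab, of "\<eta> / 2"] \<eta> by auto
  define A where "A = P * (a / (pi * d)) * (C\<^sub>2 * B)"
  have A: "A > 0"
    using P ab d C2 B by (simp add: A_def)
  obtain C where C: "C > 0" "\<And>z. cmod (W z) \<le> C * exp (\<sigma> * (cmod z)\<^sup>2)"
    using \<sigma>(3) unfolding gaussian_growth_def by blast
  have "cmod (W z) \<le> A * exp (- (\<kappa> * (cmod z)\<^sup>2))"
    if away: "\<And>k. d \<le> cmod (lattice_point a b k - z)" for z
  proof -
    \<comment> \<open>Times \<open>exp (- s \<bar>w\<bar>\<^sup>2)\<close>, the modulus of this factor is proportional to
      \<open>exp (- s \<bar>w - z\<bar>\<^sup>2)\<close>.\<close>
    define V where "V w = W w * exp (of_real (2 * s) * cnj z * w)" for w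
    have normE: "cmod (exp (of_real (2 * s) * cnj z * w)) = exp (2 * s * Re (cnj z * w))" for w
      by (simp add: mult.assoc)
    have normV: "cmod (V w) = cmod (W w) * exp (2 * s * Re (cnj z * w))" for w
      unfolding V_def norm_mult normE ..
    have Vz: "cmod (V z) = cmod (W z) * exp (2 * s * (cmod z)\<^sup>2)"
    proof -
      have "Re (cnj z * z) = (cmod z)\<^sup>2"
        unfolding cmod_power2 by (simp add: power2_eq_square)
      then show ?thesis
        unfolding normV by simp
    qed
    define \<mu> where "\<mu> = min a b"
    have \<mu>: "\<mu> > 0" using ab by (simp add: \<mu>_def)
    define c1 where "c1 = (2 * s * cmod z)\<^sup>2 / (4 * ((s - \<sigma>) / 2))"
    define k where "k = (s - \<sigma>) / 2"
    have k: "k > 0" using s by (simp add: k_def)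
    define e where "e N = C * exp c1 * exp (- (k * ((real N + 1 / 2) * \<mu>)\<^sup>2))" for N :: nat
    define R where "R N = (2 * real N + 1) * (a + b) / pi * e N" for N :: nat
    have Rlim: "(\<lambda>N. P * R N * exp (- (s * (cmod z)\<^sup>2))) \<longlonglongrightarrow> 0"
    proof -
      have "(\<lambda>N. (2 * real N + 1) * exp (- (k * ((real N + 1 / 2) * \<mu>)\<^sup>2))) \<longlonglongrightarrow> 0"
        using k \<mu> by real_asymp
      from tendsto_mult[OF this tendsto_const[of "P * (a + b) / pi * (C * exp c1) * exp (- (s * (cmod z)\<^sup>2))"]]
      show ?thesis
        by (simp add: R_def e_def mult_ac)
    qed
    have bound: "cmod (W z) \<le> A * exp (- (\<kappa> * (cmod z)\<^sup>2)) + P * R N * exp (- (s * (cmod z)\<^sup>2))"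
      if N: "(cmod z + 1) / \<mu> \<le> real N" for N
    proof -
      have N': "cmod z + 1 \<le> real N * \<mu>"
        using N \<mu> by (simp add: field_simps)
      have half: "real N * \<mu> < (real N + 1 / 2) * \<mu>" "(real N + 1 / 2) * \<mu> \<le> (real N + 1 / 2) * a"
          "(real N + 1 / 2) * \<mu> \<le> (real N + 1 / 2) * b"
        using \<mu> by (auto simp: \<mu>_def intro!: mult_strict_right_mono mult_left_mono)
      have "cmod (V z) \<le> P * exp (s * (cmod z)\<^sup>2) *
        (a / (pi * d) * (\<Sum>(m,n)\<in>{- int N..int N} \<times> {- int N..int N}.
          cmod (V (Complex (a * of_int m) (b * of_int n))) * exp (- (s * (cmod (Complex (a * of_int m) (b * of_int n)))\<^sup>2)))
         + (2 * real N + 1) * (a + b) / pi * e N)"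
        unfolding P_def s_def
      proof (rule box_interpolation[OF ab])
        show "V holomorphic_on UNIV"
          unfolding V_def by (intro holomorphic_intros W)
        show "\<bar>Re z\<bar> < (real N + 1 / 2) * a"
          using abs_Re_le_cmod[of z] N' half by linarith
        show "\<bar>Im z\<bar> < (real N + 1 / 2) * b"
          using abs_Im_le_cmod[of z] N' half by linarith
        show "d \<le> cmod (Complex (a * of_int m) (b * of_int n) - z)" for m n
          using away[of "(m, n)"] by (simp add: lattice_point_def)
        fix \<zeta>
        assume "\<bar>Re \<zeta>\<bar> = (real N + 1 / 2) * a \<or> \<bar>Im \<zeta>\<bar> = (real N + 1 / 2) * b"
        then have t: "(real N + 1 / 2) * \<mu> \<le> cmod \<zeta>"
          using half abs_Re_le_cmod[of \<zeta>] abs_Im_le_cmod[of \<zeta>] by linarith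
        then have "1 \<le> cmod \<zeta> - cmod z"
          using N' half by linarith
        also have "\<dots> \<le> cmod (\<zeta> - z)"
          by (rule norm_triangle_ineq2)
        finally have dist: "1 \<le> cmod (\<zeta> - z)" .
        have "2 * s * Re (cnj z * \<zeta>) \<le> 2 * s * (cmod z * cmod \<zeta>)"
          using complex_Re_le_cmod[of "cnj z * \<zeta>"] s by (intro mult_left_mono) (auto simp: norm_mult)
        also have "\<dots> \<le> (s - \<sigma>) / 2 * (cmod \<zeta>)\<^sup>2 + c1"
          using linear_le_quadratic[of "(s - \<sigma>) / 2" "2 * s * cmod z" "cmod \<zeta>"] s
          unfolding c1_def by (simp add: mult.assoc)
        finally have lin: "2 * s * Re (cnj z * \<zeta>) \<le> k * (cmod \<zeta>)\<^sup>2 + c1"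
          by (simp add: k_def)
        have "\<sigma> * (cmod \<zeta>)\<^sup>2 + (k * (cmod \<zeta>)\<^sup>2 + c1) = c1 - k * (cmod \<zeta>)\<^sup>2 + s * (cmod \<zeta>)\<^sup>2"
          by (simp add: k_def field_simps)
        also have "\<dots> \<le> c1 - k * ((real N + 1 / 2) * \<mu>)\<^sup>2 + s * (cmod \<zeta>)\<^sup>2"
          using k \<mu> t by (auto intro!: power_mono)
        finally have ex: "\<sigma> * (cmod \<zeta>)\<^sup>2 + 2 * s * Re (cnj z * \<zeta>) \<le> c1 - k * ((real N + 1 / 2) * \<mu>)\<^sup>2 + s * (cmod \<zeta>)\<^sup>2"
          using lin by linarith
        have "cmod (V \<zeta>) \<le> C * exp (\<sigma> * (cmod \<zeta>)\<^sup>2) * exp (2 * s * Re (cnj z * \<zeta>))"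
          unfolding normV using C by (intro mult_right_mono) auto
        also have "\<dots> = C * exp (\<sigma> * (cmod \<zeta>)\<^sup>2 + 2 * s * Re (cnj z * \<zeta>))"
          by (simp add: exp_add)
        also have "\<dots> \<le> C * exp (c1 - k * ((real N + 1 / 2) * \<mu>)\<^sup>2 + s * (cmod \<zeta>)\<^sup>2)"
          using C ex by (intro mult_left_mono) auto
        also have "\<dots> = e N * exp (s * (cmod \<zeta>)\<^sup>2) * 1"
          by (simp add: e_def exp_add[symmetric] mult.assoc)
        also have "\<dots> \<le> e N * exp (s * (cmod \<zeta>)\<^sup>2) * cmod (\<zeta> - z)"
          using dist C by (intro mult_left_mono) (auto simp: e_def)
        finally show "cmod (V \<zeta>) \<le> e N * exp (pi / (2 * a * b) * (cmod \<zeta>)\<^sup>2) * cmod (\<zeta> - z)"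
          unfolding s_def .
      qed (use d in auto)
      also have "(\<Sum>(m,n)\<in>{- int N..int N} \<times> {- int N..int N}.
          cmod (V (Complex (a * of_int m) (b * of_int n))) * exp (- (s * (cmod (Complex (a * of_int m) (b * of_int n)))\<^sup>2))) =
          (\<Sum>k\<in>{- int N..int N} \<times> {- int N..int N}.
          cmod (V (lattice_point a b k)) * exp (- (s * (cmod (lattice_point a b k))\<^sup>2)))"
        by (simp add: lattice_point_def case_prod_beta)
      also have "(2 * real N + 1) * (a + b) / pi * e N = R N"
        by (simp add: R_def)
      finally have V1: "cmod (V z) \<le> P * exp (s * (cmod z)\<^sup>2) * (a / (pi * d) *
          (\<Sum>k\<in>{- int N..int N} \<times> {- int N..int N}.
             cmod (V (lattice_point a b k)) * exp (- (s * (cmod (lattice_point a b k))\<^sup>2))) + R N)" .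
      have term_le: "cmod (V l) * exp (- (s * (cmod l)\<^sup>2)) \<le>
          exp (s * (cmod z)\<^sup>2) * exp (- (\<kappa> * (cmod z)\<^sup>2)) * C\<^sub>2 * exp (- (\<eta> / 2 * (cmod l)\<^sup>2))"
        if l: "l = lattice_point a b k" for l k
      proof -
        have sq: "(cmod (l - z))\<^sup>2 = (cmod l)\<^sup>2 + (cmod z)\<^sup>2 - 2 * Re (cnj z * l)"
          unfolding cmod_power2 by (simp add: power2_eq_square algebra_simps)
        have "cmod z \<le> cmod (l - z) + cmod l"
          using norm_triangle_ineq[of "z - l" l] by (simp add: norm_minus_commute)
        then have "(cmod z)\<^sup>2 \<le> (cmod (l - z) + cmod l)\<^sup>2"
          by (intro power_mono) auto
        also have "\<dots> \<le> 2 * (cmod (l - z))\<^sup>2 + 2 * (cmod l)\<^sup>2"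
          using zero_le_power2[of "cmod (l - z) - cmod l"] by (simp add: power2_eq_square algebra_simps)
        finally have k1: "2 * \<kappa> * (cmod z)\<^sup>2 \<le> 2 * \<kappa> * (2 * (cmod (l - z))\<^sup>2 + 2 * (cmod l)\<^sup>2)"
          using \<kappa> by (intro mult_left_mono) auto
        have k2: "4 * \<kappa> * (cmod (l - z))\<^sup>2 \<le> s * (cmod (l - z))\<^sup>2"
          by (intro mult_right_mono) (auto simp: \<kappa>_def)
        have k3: "4 * \<kappa> * (cmod l)\<^sup>2 \<le> \<eta> * (cmod l)\<^sup>2"
          by (intro mult_right_mono) (auto simp: \<kappa>_def)
        have "\<kappa> * (cmod z)\<^sup>2 + \<eta> / 2 * (cmod l)\<^sup>2 \<le> s * (cmod (l - z))\<^sup>2 + \<eta> * (cmod l)\<^sup>2"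
          using k1 k2 k3 mult_nonneg_nonneg[OF less_imp_le[OF s(1)] zero_le_power2[of "cmod (l - z)"]]
          unfolding distrib_left by linarith
        then have ex: "- (\<eta> * (cmod l)\<^sup>2) + 2 * s * Re (cnj z * l) - s * (cmod l)\<^sup>2 \<le>
            s * (cmod z)\<^sup>2 + - (\<kappa> * (cmod z)\<^sup>2) + - (\<eta> / 2 * (cmod l)\<^sup>2)"
          unfolding sq by (simp add: algebra_simps)
        have "cmod (V l) * exp (- (s * (cmod l)\<^sup>2)) \<le>
            C\<^sub>2 * exp (- (\<eta> * (cmod l)\<^sup>2)) * exp (2 * s * Re (cnj z * l)) * exp (- (s * (cmod l)\<^sup>2))"
          unfolding normV using small[of k] l by (intro mult_right_mono) auto
        also have "\<dots> = C\<^sub>2 * exp (- (\<eta> * (cmod l)\<^sup>2) + 2 * s * Re (cnj z * l) - s * (cmod l)\<^sup>2)"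
          by (simp add: exp_add exp_diff exp_minus field_simps)
        also have "\<dots> \<le> C\<^sub>2 * exp (s * (cmod z)\<^sup>2 + - (\<kappa> * (cmod z)\<^sup>2) + - (\<eta> / 2 * (cmod l)\<^sup>2))"
          using ex C2 by (intro mult_left_mono) auto
        also have "\<dots> = exp (s * (cmod z)\<^sup>2) * exp (- (\<kappa> * (cmod z)\<^sup>2)) * C\<^sub>2 * exp (- (\<eta> / 2 * (cmod l)\<^sup>2))"
          unfolding exp_add by (simp only: mult_ac)
        finally show ?thesis .
      qed
      have "(\<Sum>k\<in>{- int N..int N} \<times> {- int N..int N}.
             cmod (V (lattice_point a b k)) * exp (- (s * (cmod (lattice_point a b k))\<^sup>2)))
          \<le> exp (s * (cmod z)\<^sup>2) * exp (- (\<kappa> * (cmod z)\<^sup>2)) * C\<^sub>2 *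
            (\<Sum>k\<in>{- int N..int N} \<times> {- int N..int N}. exp (- (\<eta> / 2 * (cmod (lattice_point a b k))\<^sup>2)))"
        unfolding sum_distrib_left by (intro sum_mono term_le) auto
      also have "\<dots> \<le> exp (s * (cmod z)\<^sup>2) * exp (- (\<kappa> * (cmod z)\<^sup>2)) * C\<^sub>2 * B"
        using C2 by (intro mult_left_mono B) auto
      finally have "cmod (V z) \<le> P * exp (s * (cmod z)\<^sup>2) * (a / (pi * d) *
          (exp (s * (cmod z)\<^sup>2) * exp (- (\<kappa> * (cmod z)\<^sup>2)) * C\<^sub>2 * B) + R N)"
        using P ab d by (intro order_trans[OF V1] mult_left_mono add_right_mono) auto
      also have "\<dots> = (A * exp (- (\<kappa> * (cmod z)\<^sup>2)) + P * R N * exp (- (s * (cmod z)\<^sup>2))) * exp (2 * s * (cmod z)\<^sup>2)"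
      proof -
        define X where "X = exp (s * (cmod z)\<^sup>2)"
        have "exp (2 * s * (cmod z)\<^sup>2) = X * X" "exp (- (s * (cmod z)\<^sup>2)) = 1 / X" "X > 0"
          by (simp_all add: X_def exp_add[symmetric] exp_minus field_simps)
        then show ?thesis
          unfolding A_def X_def[symmetric] by (simp add: field_simps)
      qed
      finally show ?thesis
        unfolding Vz by simp
    qed
    have "\<forall>\<^sub>F N in sequentially. cmod (W z) \<le> A * exp (- (\<kappa> * (cmod z)\<^sup>2)) + P * R N * exp (- (s * (cmod z)\<^sup>2))"
      using eventually_ge_at_top[of "nat \<lceil>(cmod z + 1) / \<mu>\<rceil>"]
      by eventually_elim (rule bound, linarith)
    moreover have "(\<lambda>N. A * exp (- (\<kappa> * (cmod z)\<^sup>2)) + P * R N * exp (- (s * (cmod z)\<^sup>2)))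
        \<longlonglongrightarrow> A * exp (- (\<kappa> * (cmod z)\<^sup>2)) + 0"
      by (intro tendsto_add tendsto_const Rlim)
    ultimately have "cmod (W z) \<le> A * exp (- (\<kappa> * (cmod z)\<^sup>2)) + 0"
      by (intro tendsto_lowerbound[where F=sequentially]) auto
    then show ?thesis by simp
  qed
  then show thesis
    using that A \<kappa> by blast
qed

lemma cmod_half_lattice_dist:
  assumes "\<bar>x\<bar> = (real M + 1 / 2) * a" "a > 0"
  shows "a / 2 \<le> \<bar>a * of_int m - x\<bar>"
proof -
  have *: "1 / 2 \<le> \<bar>real_of_int j + 1 / 2\<bar>" for j
  proof -
    have "j \<ge> 0 \<or> j \<le> -1" by linarith
    then show ?thesis by (auto simp: abs_if) 
  qed
  have "x = (real M + 1 / 2) * a \<or> x = - ((real M + 1 / 2) * a)"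
    using assms by linarith
  then have "\<exists>j. \<bar>a * of_int m - x\<bar> = a * \<bar>real_of_int j + 1 / 2\<bar>"
  proof
    assume x: "x = (real M + 1 / 2) * a"
    have "a * of_int m - x = a * (of_int (m - int M - 1) + 1 / 2)"
      unfolding x by (simp add: algebra_simps)
    then show ?thesis using assms(2) by (metis abs_mult abs_of_pos)
  next
    assume x: "x = - ((real M + 1 / 2) * a)"
    have "a * of_int m - x = a * (of_int (m + int M) + 1 / 2)"
      unfolding x by (simp add: algebra_simps)
    then show ?thesis using assms(2) by (metis abs_mult abs_of_pos)
  qed
  then obtain j where "\<bar>a * of_int m - x\<bar> = a * \<bar>real_of_int j + 1 / 2\<bar>" ..
  then show ?thesis
    using mult_left_mono[OF *[of j], of a] assms(2) by simp
qed

text \<open>The boundaries of the rectangles with half axes \<open>(M + 1/2) a\<close> and \<open>(M + 1/2) b\<close> keep away from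
the lattice. There \<open>W\<close> tends to zero as \<open>M\<close> grows, by \<open>lattice_interpolation_bound\<close>, and the maximum
principle carries this to the interior.\<close>

theorem lattice_uniqueness:
  assumes ab: "a > 0" "b > 0"
    and W: "W holomorphic_on UNIV"
    and \<sigma>: "0 \<le> \<sigma>" "\<sigma> < pi / (2 * a * b)" "gaussian_growth \<sigma> W"
    and \<eta>: "\<eta> > 0"
    and small: "\<And>k. cmod (W (lattice_point a b k)) \<le> C * exp (- (\<eta> * (cmod (lattice_point a b k))\<^sup>2))"
  shows "W w = 0"
proof -
  define \<mu> where "\<mu> = min a b"
  have \<mu>: "\<mu> > 0" using ab by (simp add: \<mu>_def)
  have small': "cmod (W (lattice_point a b k)) \<le> (\<bar>C\<bar> + 1) * exp (- (\<eta> * (cmod (lattice_point a b k))\<^sup>2))" for k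
    by (rule order_trans[OF small mult_right_mono]) auto
  have d: "0 < \<mu> / 2" "0 < \<bar>C\<bar> + 1"
    using \<mu> by auto
  obtain A \<kappa> where A: "A > 0" "\<kappa> > 0"
    "\<forall>z. (\<forall>k. \<mu> / 2 \<le> cmod (lattice_point a b k - z)) \<longrightarrow> cmod (W z) \<le> A * exp (- (\<kappa> * (cmod z)\<^sup>2))"
    by (rule lattice_interpolation_bound[OF ab W \<sigma> d(1) \<eta> d(2) small'])
  have bound: "cmod (W w) \<le> A * exp (- (\<kappa> * ((real M + 1 / 2) * \<mu>)\<^sup>2))" if M: "cmod w / \<mu> \<le> real M" for M
  proof -
    define x y where "x = (real M + 1 / 2) * a" and "y = (real M + 1 / 2) * b"
    have xy: "(real M + 1 / 2) * \<mu> \<le> x" "(real M + 1 / 2) * \<mu> \<le> y"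
      by (auto simp: x_def y_def \<mu>_def intro!: mult_left_mono)
    have "cmod w \<le> real M * \<mu>"
      using M \<mu> by (simp add: field_simps)
    also have "\<dots> \<le> (real M + 1 / 2) * \<mu>"
      using \<mu> by simp
    finally have wle: "cmod w \<le> (real M + 1 / 2) * \<mu>" .
    let ?S = "cbox (Complex (- x) (- y)) (Complex x y)"
    show ?thesis
    proof (rule maximum_modulus_frontier[of W ?S])
      show "W holomorphic_on interior ?S"
        using W holomorphic_on_subset by blast
      show "continuous_on (closure ?S) W"
        using W holomorphic_on_imp_continuous_on continuous_on_subset by blast
      show "w \<in> ?S"
        using wle xy abs_Re_le_cmod[of w] abs_Im_le_cmod[of w] by (auto simp: in_cbox_complex_iff)
      fix z assume "z \<in> frontier ?S"
      then have "\<bar>Re z\<bar> = x \<or> \<bar>Im z\<bar> = y"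
        by (auto simp: frontier_cbox in_cbox_complex_iff in_box_complex_iff)
      then consider "\<bar>Re z\<bar> = x" | "\<bar>Im z\<bar> = y" by blast
      then have "(real M + 1 / 2) * \<mu> \<le> cmod z \<and> (\<forall>k. \<mu> / 2 \<le> cmod (lattice_point a b k - z))"
      proof cases
        case 1
        have "\<mu> / 2 \<le> cmod (lattice_point a b k - z)" for k
        proof -
          have "\<mu> / 2 \<le> a / 2" by (simp add: \<mu>_def)
          also have "\<dots> \<le> \<bar>a * of_int (fst k) - Re z\<bar>"
            using 1 ab(1) unfolding x_def by (rule cmod_half_lattice_dist)
          also have "\<dots> \<le> cmod (lattice_point a b k - z)"
            using abs_Re_le_cmod[of "lattice_point a b k - z"] by (simp add: lattice_point_def)
          finally show ?thesis .
        qed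
        then show ?thesis
          using 1 xy abs_Re_le_cmod[of z] by auto
      next
        case 2
        have "\<mu> / 2 \<le> cmod (lattice_point a b k - z)" for k
        proof -
          have "\<mu> / 2 \<le> b / 2" by (simp add: \<mu>_def)
          also have "\<dots> \<le> \<bar>b * of_int (snd k) - Im z\<bar>"
            using 2 ab(2) unfolding y_def by (rule cmod_half_lattice_dist)
          also have "\<dots> \<le> cmod (lattice_point a b k - z)"
            using abs_Im_le_cmod[of "lattice_point a b k - z"] by (simp add: lattice_point_def)
          finally show ?thesis .
        qed
        then show ?thesis
          using 2 xy abs_Im_le_cmod[of z] by auto
      qed
      then have z: "(real M + 1 / 2) * \<mu> \<le> cmod z" "cmod (W z) \<le> A * exp (- (\<kappa> * (cmod z)\<^sup>2))"
        using A(3) by auto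
      have "((real M + 1 / 2) * \<mu>)\<^sup>2 \<le> (cmod z)\<^sup>2"
        using z(1) \<mu> by (intro power_mono) auto
      then have "A * exp (- (\<kappa> * (cmod z)\<^sup>2)) \<le> A * exp (- (\<kappa> * ((real M + 1 / 2) * \<mu>)\<^sup>2))"
        using A by (intro mult_left_mono) auto
      then show "cmod (W z) \<le> A * exp (- (\<kappa> * ((real M + 1 / 2) * \<mu>)\<^sup>2))"
        using z(2) by simp
    qed (rule bounded_cbox)
  qed
  have "\<forall>\<^sub>F M in sequentially. cmod (W w) \<le> A * exp (- (\<kappa> * ((real M + 1 / 2) * \<mu>)\<^sup>2))"
    using eventually_ge_at_top[of "nat \<lceil>cmod w / \<mu>\<rceil>"]
    by eventually_elim (rule bound, linarith)
  moreover have "(\<lambda>M. A * exp (- (\<kappa> * ((real M + 1 / 2) * \<mu>)\<^sup>2))) \<longlonglongrightarrow> 0"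
    using \<mu> A(2) by real_asymp
  ultimately have "cmod (W w) \<le> 0"
    by (intro tendsto_lowerbound[where F=sequentially]) auto
  then show ?thesis by simp
qed

section \<open>Local consequences of Gaussian growth\<close>

text \<open>Moving the point by at most 2 changes \<open>\<sigma> \<bar>z\<bar>\<^sup>2\<close> by a linear term, which any larger Gaussian
rate absorbs.\<close>

lemma gaussian_growth_near:
  assumes "gaussian_growth \<sigma> F" "0 \<le> \<sigma>" "\<sigma> < \<tau>"
  obtains C where "C > 0" "\<forall>z w. cmod (w - z) \<le> 2 \<longrightarrow> cmod (F w) \<le> C * exp (\<tau> * (cmod z)\<^sup>2)"
proof -
  obtain K where K: "K > 0" "\<And>z. cmod (F z) \<le> K * exp (\<sigma> * (cmod z)\<^sup>2)"
    using assms(1) unfolding gaussian_growth_def by blast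
  define c where "c = (4 * \<sigma>)\<^sup>2 / (4 * (\<tau> - \<sigma>)) + 4 * \<sigma>"
  have "cmod (F w) \<le> K * exp c * exp (\<tau> * (cmod z)\<^sup>2)" if wz: "cmod (w - z) \<le> 2" for w z
  proof -
    have "cmod w \<le> cmod z + 2"
      using norm_triangle_ineq[of z "w - z"] wz by simp
    then have "\<sigma> * (cmod w)\<^sup>2 \<le> \<sigma> * (cmod z + 2)\<^sup>2"
      using assms(2) by (intro mult_left_mono power_mono) auto
    also have "\<dots> = \<sigma> * (cmod z)\<^sup>2 + 4 * \<sigma> * cmod z + 4 * \<sigma>"
      by (simp add: power2_eq_square algebra_simps)
    also have "\<dots> \<le> \<sigma> * (cmod z)\<^sup>2 + ((\<tau> - \<sigma>) * (cmod z)\<^sup>2 + (4 * \<sigma>)\<^sup>2 / (4 * (\<tau> - \<sigma>))) + 4 * \<sigma>"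
      using linear_le_quadratic[of "\<tau> - \<sigma>" "4 * \<sigma>" "cmod z"] assms(3) by (intro add_mono) auto
    also have "\<dots> = c + \<tau> * (cmod z)\<^sup>2"
      by (simp add: c_def algebra_simps)
    finally have le: "\<sigma> * (cmod w)\<^sup>2 \<le> c + \<tau> * (cmod z)\<^sup>2" .
    have "cmod (F w) \<le> K * exp (\<sigma> * (cmod w)\<^sup>2)"
      by (rule K)
    also have "\<dots> \<le> K * exp (c + \<tau> * (cmod z)\<^sup>2)"
      using K(1) le by (intro mult_left_mono) auto
    finally show ?thesis
      by (simp add: exp_add)
  qed
  then show thesis
    using that[of "K * exp c"] K(1) by simp
qed

text \<open>Cauchy's inequality on circles of radius 1.\<close>

lemma gaussian_growth_deriv:
  assumes "gaussian_growth \<sigma> F" "0 \<le> \<sigma>" "\<sigma> < \<tau>" "F holomorphic_on UNIV"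
  shows "gaussian_growth \<tau> (deriv F)"
proof -
  obtain C where C: "C > 0" "\<forall>z w. cmod (w - z) \<le> 2 \<longrightarrow> cmod (F w) \<le> C * exp (\<tau> * (cmod z)\<^sup>2)"
    by (rule gaussian_growth_near[OF assms(1-3)])
  have "cmod (deriv F z) \<le> C * exp (\<tau> * (cmod z)\<^sup>2)" for z
  proof -
    have "cmod ((deriv ^^ 1) F z) \<le> fact 1 * (C * exp (\<tau> * (cmod z)\<^sup>2)) / 1 ^ 1"
    proof (rule Cauchy_inequality)
      show "F holomorphic_on ball z 1"
        using assms(4) holomorphic_on_subset by blast
      show "continuous_on (cball z 1) F"
        using assms(4) holomorphic_on_imp_continuous_on continuous_on_subset by blast
      show "cmod (F w) \<le> C * exp (\<tau> * (cmod z)\<^sup>2)" if "cmod (z - w) = 1" for w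
        using C(2) that by (simp add: norm_minus_commute)
    qed simp
    then show ?thesis by simp
  qed
  then show ?thesis
    unfolding gaussian_growth_def using C(1) by blast
qed

lemma gaussian_growth_mult:
  assumes "gaussian_growth \<sigma> F" "gaussian_growth \<tau> G"
  shows "gaussian_growth (\<sigma> + \<tau>) (\<lambda>z. F z * G z)"
proof -
  obtain C D where C: "C > 0" "\<And>z. cmod (F z) \<le> C * exp (\<sigma> * (cmod z)\<^sup>2)"
    and D: "D > 0" "\<And>z. cmod (G z) \<le> D * exp (\<tau> * (cmod z)\<^sup>2)"
    using assms unfolding gaussian_growth_def by blast
  have "cmod (F z * G z) \<le> (C * D) * exp ((\<sigma> + \<tau>) * (cmod z)\<^sup>2)" for z
  proof -
    have "cmod (F z * G z) \<le> (C * exp (\<sigma> * (cmod z)\<^sup>2)) * (D * exp (\<tau> * (cmod z)\<^sup>2))"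
      unfolding norm_mult using C D by (intro mult_mono) auto
    then show ?thesis
      by (simp add: exp_add distrib_right mult_ac)
  qed
  then show ?thesis
    unfolding gaussian_growth_def using C(1) D(1) by (intro exI[of _ "C * D"]) auto
qed

lemma gaussian_growth_diff:
  assumes "gaussian_growth \<sigma> F" "gaussian_growth \<sigma> G"
  shows "gaussian_growth \<sigma> (\<lambda>z. F z - G z)"
proof -
  obtain C D where C: "C > 0" "\<And>z. cmod (F z) \<le> C * exp (\<sigma> * (cmod z)\<^sup>2)"
    and D: "D > 0" "\<And>z. cmod (G z) \<le> D * exp (\<sigma> * (cmod z)\<^sup>2)"
    using assms unfolding gaussian_growth_def by blast
  have "cmod (F z - G z) \<le> (C + D) * exp (\<sigma> * (cmod z)\<^sup>2)" for z
    using norm_triangle_ineq4[of "F z" "G z"] C(2)[of z] D(2)[of z] by (simp add: distrib_right)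
  then show ?thesis
    unfolding gaussian_growth_def using C(1) D(1) by (intro exI[of _ "C + D"]) auto
qed

text \<open>Multiplying \<open>W\<close> by two sines that vanish at the lattice points on the two axes reduces this
to \<open>lattice_uniqueness\<close>: sines have order one, and a larger constant takes care of the finite set \<open>E\<close>.\<close>

theorem lattice_uniqueness_off_axes:
  assumes ab: "a > 0" "b > 0"
    and W: "W holomorphic_on UNIV"
    and \<sigma>: "0 \<le> \<sigma>" "\<sigma> < pi / (2 * a * b)" "gaussian_growth \<sigma> W"
    and \<eta>: "\<eta> > 0" and E: "finite E"
    and small: "\<And>k. k \<notin> E \<Longrightarrow> fst k \<noteq> 0 \<Longrightarrow> snd k \<noteq> 0 \<Longrightarrow>
      cmod (W (lattice_point a b k)) \<le> C * exp (- (\<eta> * (cmod (lattice_point a b k))\<^sup>2))"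
  shows "W w = 0"
proof -
  \<comment> \<open>The first sine vanishes at the lattice points on the real axis, the second at those on the
    imaginary axis.\<close>
  define T where "T z = sin (of_real (pi / a) * z) * sin (\<i> * of_real (pi / b) * z)" for z
  define V where "V z = W z * T z" for z
  define c where "c = pi / a + pi / b"
  have sin_le: "cmod (sin u) \<le> exp (cmod u)" for u
  proof -
    have "cmod (sin u) \<le> exp \<bar>Im u\<bar> / 2 * (1 + exp (- (2 * \<bar>Im u\<bar>)))"
      by (rule norm_sin_le)
    also have "\<dots> \<le> exp \<bar>Im u\<bar> / 2 * 2"
      by (intro mult_left_mono) auto
    also have "\<dots> \<le> exp (cmod u)"
      using abs_Im_le_cmod[of u] by simp
    finally show ?thesis .
  qed
  have T_le: "cmod (T z) \<le> exp (c * cmod z)" for z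
  proof -
    have "cmod (T z) \<le> exp (cmod (of_real (pi / a) * z)) * exp (cmod (\<i> * of_real (pi / b) * z))"
      unfolding T_def norm_mult[of "sin _"] by (intro mult_mono sin_le) auto
    also have "\<dots> = exp (c * cmod z)"
      using ab by (simp add: c_def norm_mult norm_divide exp_add[symmetric] distrib_right)
    finally show ?thesis .
  qed
  obtain K where K: "K > 0" "\<And>z. cmod (W z) \<le> K * exp (\<sigma> * (cmod z)\<^sup>2)"
    using \<sigma>(3) unfolding gaussian_growth_def by blast
  define \<tau> where "\<tau> = (\<sigma> + pi / (2 * a * b)) / 2"
  have \<tau>: "0 \<le> \<tau>" "\<sigma> < \<tau>" "\<tau> < pi / (2 * a * b)"
    using \<sigma> by (auto simp: \<tau>_def)
  have V: "V holomorphic_on UNIV"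
    unfolding V_def T_def by (intro holomorphic_intros W)
  have "gaussian_growth \<tau> V"
  proof -
    define D where "D = K * exp (c\<^sup>2 / (4 * (\<tau> - \<sigma>)))"
    have "cmod (V z) \<le> D * exp (\<tau> * (cmod z)\<^sup>2)" for z
    proof -
      have "\<sigma> * (cmod z)\<^sup>2 + c * cmod z \<le> c\<^sup>2 / (4 * (\<tau> - \<sigma>)) + \<tau> * (cmod z)\<^sup>2"
        using linear_le_quadratic[of "\<tau> - \<sigma>" c "cmod z"] \<tau> by (simp add: algebra_simps)
      moreover have "cmod (V z) \<le> K * exp (\<sigma> * (cmod z)\<^sup>2) * exp (c * cmod z)"
        unfolding V_def norm_mult using K T_le by (intro mult_mono) auto
      ultimately have "cmod (V z) \<le> K * exp (c\<^sup>2 / (4 * (\<tau> - \<sigma>)) + \<tau> * (cmod z)\<^sup>2)"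
        using K(1) by (simp add: mult.assoc exp_add[symmetric]) (meson exp_le_cancel_iff mult_left_mono less_imp_le order_trans)
      then show ?thesis
        by (simp add: D_def exp_add)
    qed
    then show ?thesis
      unfolding gaussian_growth_def using K(1) by (intro exI[of _ D]) (auto simp: D_def)
  qed
  define g where "g k = cmod (V (lattice_point a b k)) * exp (\<eta> / 2 * (cmod (lattice_point a b k))\<^sup>2)" for k
  define C' where "C' = \<bar>C\<bar> * exp (c\<^sup>2 / (4 * (\<eta> / 2))) + sum g E"
  have g: "0 \<le> g k" for k by (simp add: g_def)
  have "g k \<le> C'" for k
  proof (cases "fst k = 0 \<or> snd k = 0 \<or> k \<in> E")
    case True
    then consider "fst k = 0" | "snd k = 0" | "k \<in> E" by blast
    then show ?thesis
    proof cases
      case 1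
      have "\<i> * of_real (pi / b) * lattice_point a b k = of_real (of_int (- snd k) * pi)"
        using ab 1 by (simp add: lattice_point_def complex_eq_iff)
      then have "sin (\<i> * of_real (pi / b) * lattice_point a b k) = 0"
        unfolding sin_eq_0 by blast
      then show ?thesis
        using E g by (simp add: g_def V_def T_def C'_def sum_nonneg)
    next
      case 2
      have "of_real (pi / a) * lattice_point a b k = of_real (of_int (fst k) * pi)"
        using ab 2 by (simp add: lattice_point_def complex_eq_iff)
      then have "sin (of_real (pi / a) * lattice_point a b k) = 0"
        unfolding sin_eq_0 by blast
      then show ?thesis
        using E g by (simp add: g_def V_def T_def C'_def sum_nonneg)
    next
      case 3
      then have "g k \<le> sum g E"
        using E g by (intro member_le_sum) auto
      then show ?thesis
        by (simp add: C'_def add_increasing)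
    qed
  next
    case False
    define l where "l = lattice_point a b k"
    have "cmod (W l) \<le> \<bar>C\<bar> * exp (- (\<eta> * (cmod l)\<^sup>2))"
      using False small[of k] unfolding l_def by (intro order_trans[OF small mult_right_mono]) auto
    then have "cmod (V l) \<le> \<bar>C\<bar> * exp (- (\<eta> * (cmod l)\<^sup>2)) * exp (c * cmod l)"
      unfolding V_def norm_mult using T_le by (intro mult_mono) auto
    then have "g k \<le> \<bar>C\<bar> * exp (- (\<eta> * (cmod l)\<^sup>2)) * exp (c * cmod l) * exp (\<eta> / 2 * (cmod l)\<^sup>2)"
      unfolding g_def l_def[symmetric] by (intro mult_right_mono) auto
    also have "\<dots> = \<bar>C\<bar> * exp (- (\<eta> * (cmod l)\<^sup>2) + c * cmod l + \<eta> / 2 * (cmod l)\<^sup>2)"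
      by (simp only: exp_add mult.assoc)
    also have "\<dots> \<le> \<bar>C\<bar> * exp (c\<^sup>2 / (4 * (\<eta> / 2)))"
      using linear_le_quadratic[of "\<eta> / 2" c "cmod l"] \<eta> by (intro mult_left_mono) auto
    also have "\<dots> \<le> C'"
      using E g by (simp add: C'_def sum_nonneg)
    finally show ?thesis .
  qed
  then have V_small: "cmod (V (lattice_point a b k)) \<le> C' * exp (- (\<eta> / 2 * (cmod (lattice_point a b k))\<^sup>2))" for k
    unfolding g_def by (simp add: exp_minus field_simps)
  have V0: "V z = 0" for z
    by (rule lattice_uniqueness[OF ab V \<tau>(1,3) \<open>gaussian_growth \<tau> V\<close> _ V_small]) (use \<eta> in simp)
  have T0: "T z \<noteq> 0" if z: "Re z > 0" "Im z > 0" for z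
  proof
    assume "T z = 0"
    then consider n :: int where "of_real (pi / a) * z = of_real (of_int n * pi)"
      | n :: int where "\<i> * of_real (pi / b) * z = of_real (of_int n * pi)"
      unfolding T_def mult_eq_0_iff sin_eq_0 by blast
    then show False
    proof cases
      case 1
      then have "Im (of_real (pi / a) * z) = 0" by simp
      then show False using z ab by simp
    next
      case 2
      then have "Im (\<i> * of_real (pi / b) * z) = 0" by simp
      then show False using z ab by simp
    qed
  qed
  show ?thesis
  proof (rule analytic_continuation_open[of "{z. Re z > 0 \<and> Im z > 0}" UNIV W "\<lambda>_. 0"])
    show "open {z. Re z > 0 \<and> Im z > 0}"
      by (intro open_Collect_conj open_halfspace_Re_gt open_halfspace_Im_gt)
    show "{z. Re z > 0 \<and> Im z > 0} \<noteq> {}"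
      by (auto intro: exI[of _ "Complex 1 1"])
    show "W z = 0" if "z \<in> {z. Re z > 0 \<and> Im z > 0}" for z
      using V0[of z] T0[of z] that by (simp add: V_def)
  qed (use W in auto)
qed

section \<open>From three moduli to the Wronskian\<close>

abbreviation jet_bound :: "(complex \<Rightarrow> complex) \<Rightarrow> complex \<Rightarrow> real \<Rightarrow> bool" where
  "jet_bound F u m \<equiv> cmod (F u) \<le> m \<and> cmod (deriv F u) \<le> m \<and> cmod (deriv (deriv F) u) \<le> m"

text \<open>Taylor expansion of \<open>\<bar>F\<bar>\<^sup>2\<close> at \<open>p\<close>; the linear term is \<open>2 Re (cnj (F p) F' (p) (q - p))\<close>.\<close>

lemma norm_square_expansion:
  assumes F: "F holomorphic_on UNIV"
    and bd: "\<And>u. cmod (u - l) \<le> 1 \<Longrightarrow> jet_bound F u m"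
    and p: "cmod (p - l) \<le> 1" and q: "cmod (q - l) \<le> 1"
  shows "\<bar>(cmod (F q))\<^sup>2 - (cmod (F p))\<^sup>2 - 2 * Re (cnj (F p) * deriv F p * (q - p))\<bar> \<le> 11 * m\<^sup>2 * (cmod (q - p))\<^sup>2"
proof -
  define A B \<beta> where "A = F p" and "B = deriv F p" and "\<beta> = q - p"
  define \<rho> where "\<rho> = F q - (A + B * \<beta>)"
  have dF: "deriv F holomorphic_on UNIV"
    using F by (intro holomorphic_deriv) auto
  have m: "0 \<le> m"
    using bd[OF p] norm_ge_zero order_trans by blast
  have AB: "cmod A \<le> m" "cmod B \<le> m"
    using bd[OF p] by (simp_all add: A_def B_def)
  have \<beta>: "cmod \<beta> \<le> 2"
    using norm_triangle_ineq4[of "q - l" "p - l"] p q by (simp add: \<beta>_def)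
  have "cmod ((deriv ^^ 0) F q - (\<Sum>i\<le>1. (deriv ^^ i) F p * (q - p) ^ i / fact i)) \<le> m * cmod (q - p) ^ Suc 1 / fact 1"
  proof (rule complex_Taylor[of "cball l 1"])
    show "((deriv ^^ i) F has_field_derivative (deriv ^^ Suc i) F x) (at x within cball l 1)" if "i \<le> 1" for i x
    proof -
      have "(deriv ^^ i) F holomorphic_on UNIV"
        using F by (intro holomorphic_higher_deriv) auto
      then have "((deriv ^^ i) F has_field_derivative deriv ((deriv ^^ i) F) x) (at x)"
        by (intro holomorphic_derivI[of _ UNIV]) auto
      then show ?thesis
        by (simp add: has_field_derivative_at_within)
    qed
    show "cmod ((deriv ^^ Suc 1) F x) \<le> m" if "x \<in> cball l 1" for x
      using bd[of x] that by (simp add: dist_norm norm_minus_commute)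
  qed (use p q in \<open>auto simp: dist_norm norm_minus_commute\<close>)
  then have \<rho>: "cmod \<rho> \<le> m * (cmod \<beta>)\<^sup>2"
    by (simp add: \<rho>_def A_def B_def \<beta>_def power2_eq_square)
  have Fq: "F q = A + (B * \<beta> + \<rho>)"
    by (simp add: \<rho>_def)
  have sq: "(cmod (A + X))\<^sup>2 = (cmod A)\<^sup>2 + 2 * Re (cnj A * X) + (cmod X)\<^sup>2" for X
    unfolding cmod_power2 by (simp add: power2_eq_square algebra_simps)
  have "(cmod (F q))\<^sup>2 - (cmod A)\<^sup>2 - 2 * Re (cnj A * B * \<beta>) = 2 * Re (cnj A * \<rho>) + (cmod (B * \<beta> + \<rho>))\<^sup>2"
    unfolding Fq sq by (simp add: algebra_simps)
  also have "\<bar>\<dots>\<bar> \<le> 2 * \<bar>Re (cnj A * \<rho>)\<bar> + (cmod (B * \<beta> + \<rho>))\<^sup>2"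
  proof -
    have "\<bar>2 * x + y\<^sup>2\<bar> \<le> 2 * \<bar>x\<bar> + y\<^sup>2" for x y :: real
      using abs_triangle_ineq[of "2 * x" "y\<^sup>2"] by (simp add: abs_mult)
    then show ?thesis .
  qed
  also have "\<dots> \<le> 2 * (m * (m * (cmod \<beta>)\<^sup>2)) + (3 * m * cmod \<beta>)\<^sup>2"
  proof (intro add_mono mult_left_mono power_mono)
    have "\<bar>Re (cnj A * \<rho>)\<bar> \<le> cmod A * cmod \<rho>"
      using abs_Re_le_cmod[of "cnj A * \<rho>"] by (simp add: norm_mult)
    also have "\<dots> \<le> m * (m * (cmod \<beta>)\<^sup>2)"
      using AB \<rho> m by (intro mult_mono) auto
    finally show "\<bar>Re (cnj A * \<rho>)\<bar> \<le> m * (m * (cmod \<beta>)\<^sup>2)" .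
    have "cmod (B * \<beta> + \<rho>) \<le> cmod B * cmod \<beta> + cmod \<rho>"
      using norm_triangle_ineq[of "B * \<beta>" \<rho>] by (simp add: norm_mult)
    also have "\<dots> \<le> m * cmod \<beta> + m * (cmod \<beta> * cmod \<beta>)"
      using AB \<rho> by (intro add_mono mult_right_mono) (auto simp: power2_eq_square)
    also have "m * (cmod \<beta> * cmod \<beta>) \<le> m * (2 * cmod \<beta>)"
      using m \<beta> by (intro mult_left_mono mult_right_mono) auto
    finally show "cmod (B * \<beta> + \<rho>) \<le> 3 * m * cmod \<beta>"
      by simp
  qed auto
  also have "\<dots> = 11 * m\<^sup>2 * (cmod \<beta>)\<^sup>2"
    by (simp add: power2_eq_square)
  finally show ?thesis
    unfolding A_def B_def \<beta>_def .
qed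

text \<open>A vector in the plane is determined by its inner products with two independent vectors;
this is Cramer's rule with the determinant \<open>Im (cnj \<beta> * \<gamma>)\<close>.\<close>

lemma norm_le_of_two_directions:
  fixes q \<beta> \<gamma> :: complex
  shows "cmod q * \<bar>Im (cnj \<beta> * \<gamma>)\<bar> \<le> \<bar>Re (q * \<beta>)\<bar> * cmod \<gamma> + \<bar>Re (q * \<gamma>)\<bar> * cmod \<beta>"
proof -
  have "of_real (Re (q * \<beta>)) * \<gamma> - of_real (Re (q * \<gamma>)) * \<beta> = cnj q * (\<i> * of_real (Im (cnj \<beta> * \<gamma>)))"
    by (simp add: complex_eq_iff algebra_simps)
  then have "cmod q * \<bar>Im (cnj \<beta> * \<gamma>)\<bar> = cmod (of_real (Re (q * \<beta>)) * \<gamma> - of_real (Re (q * \<gamma>)) * \<beta>)"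
    by (simp only: norm_mult complex_mod_cnj norm_of_real norm_ii mult_1)
  also have "\<dots> \<le> \<bar>Re (q * \<beta>)\<bar> * cmod \<gamma> + \<bar>Re (q * \<gamma>)\<bar> * cmod \<beta>"
    using norm_triangle_ineq4[of "of_real (Re (q * \<beta>)) * \<gamma>" "of_real (Re (q * \<gamma>)) * \<beta>"] by (simp only: norm_mult norm_of_real)
  finally show ?thesis .
qed

definition wronskian :: "(complex \<Rightarrow> complex) \<Rightarrow> (complex \<Rightarrow> complex) \<Rightarrow> complex \<Rightarrow> complex" where
  "wronskian F H z = deriv F z * H z - deriv H z * F z"

text \<open>If \<open>\<bar>F\<bar> = \<bar>H\<bar>\<close> at \<open>p\<close>, then multiplying the gradient defect by \<open>F p * H p\<close> gives \<open>\<bar>F p\<bar>\<^sup>2\<close> times the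
Wronskian, and the factors \<open>\<bar>F p\<bar>\<^sup>2\<close> cancel. If \<open>F\<close> vanishes at \<open>p\<close>, so does \<open>H\<close>, and the Wronskian is
zero. Thus no lower bound for \<open>F\<close> is needed.\<close>

lemma wronskian_eq_gradient_defect:
  assumes "cmod (F p) = cmod (H p)"
  shows "cmod (wronskian F H p) \<le> cmod (cnj (F p) * deriv F p - cnj (H p) * deriv H p)"
proof (cases "F p = 0")
  case True
  then show ?thesis using assms by (simp add: wronskian_def)
next
  case False
  let ?q = "cnj (F p) * deriv F p - cnj (H p) * deriv H p"
  have "F p * H p * ?q = of_real ((cmod (F p))\<^sup>2) * H p * deriv F p - of_real ((cmod (H p))\<^sup>2) * F p * deriv H p"
    unfolding complex_norm_square by (simp add: algebra_simps)
  also have "\<dots> = of_real ((cmod (F p))\<^sup>2) * wronskian F H p"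
    unfolding assms wronskian_def by (simp add: algebra_simps)
  finally have "cmod (F p * H p * ?q) = cmod (of_real ((cmod (F p))\<^sup>2) * wronskian F H p)"
    by simp
  then have "(cmod (F p))\<^sup>2 * cmod ?q = (cmod (F p))\<^sup>2 * cmod (wronskian F H p)"
    unfolding norm_mult norm_of_real assms by (simp add: power2_eq_square)
  then show ?thesis
    using False by simp
qed

text \<open>The function \<open>\<bar>F\<bar>\<^sup>2 - \<bar>H\<bar>\<^sup>2\<close> vanishes at the vertices of a triangle of size \<open>r\<close>. Its derivatives
along the two sides at \<open>p\<close>, which are vectors of length at most \<open>2 r\<close>, are of order \<open>r\<^sup>2\<close>, and since the
triangle is not too thin, its gradient at \<open>p\<close> is of order \<open>r / \<delta>\<close>. By \<open>wronskian_eq_gradient_defect\<close> the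
Wronskian at \<open>p\<close> is as small, and \<open>l\<close> is within \<open>r\<close> of \<open>p\<close>.\<close>

lemma wronskian_small_near_triangle:
  assumes F: "F holomorphic_on UNIV" and H: "H holomorphic_on UNIV"
    and bF: "\<And>u. cmod (u - l) \<le> 1 \<Longrightarrow> jet_bound F u m"
    and bH: "\<And>u. cmod (u - l) \<le> 1 \<Longrightarrow> jet_bound H u m"
    and r: "0 < r" "r \<le> 1" and \<delta>: "0 < \<delta>" "\<delta> \<le> 1"
    and near: "cmod (p - l) \<le> r" "cmod (q - l) \<le> r" "cmod (s - l) \<le> r"
    and eq: "cmod (F p) = cmod (H p)" "cmod (F q) = cmod (H q)" "cmod (F s) = cmod (H s)"
    and area: "\<delta> * r\<^sup>2 \<le> \<bar>Im (cnj (q - p) * (s - p))\<bar>"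
  shows "cmod (wronskian F H l) \<le> 178 * m\<^sup>2 * r / \<delta>"
proof -
  define d where "d = cnj (F p) * deriv F p - cnj (H p) * deriv H p"
  have near1: "cmod (p - l) \<le> 1" "cmod (q - l) \<le> 1" "cmod (s - l) \<le> 1"
    using near r by auto
  have dir: "\<bar>Re (d * (t - p))\<bar> \<le> 11 * m\<^sup>2 * (cmod (t - p))\<^sup>2"
    if t: "cmod (t - l) \<le> 1" "cmod (F t) = cmod (H t)" for t
  proof -
    have "2 * Re (d * (t - p)) = 2 * Re (cnj (F p) * deriv F p * (t - p)) - 2 * Re (cnj (H p) * deriv H p * (t - p))"
      by (simp add: d_def algebra_simps)
    then show ?thesis
      using norm_square_expansion[OF F bF near1(1) t(1)] norm_square_expansion[OF H bH near1(1) t(1)]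
      unfolding t(2) eq(1) by linarith
  qed
  have \<beta>: "cmod (q - p) \<le> 2 * r" "cmod (s - p) \<le> 2 * r"
    using norm_triangle_ineq4[of "q - l" "p - l"] norm_triangle_ineq4[of "s - l" "p - l"] near by auto
  have m: "0 \<le> m"
    using bF[OF near1(1)] norm_ge_zero order_trans by blast
  have sqle: "(cmod (q - p))\<^sup>2 \<le> (2 * r)\<^sup>2" "(cmod (s - p))\<^sup>2 \<le> (2 * r)\<^sup>2"
    using power_mono[OF \<beta>(1), of 2] power_mono[OF \<beta>(2), of 2] by simp_all
  have dq: "\<bar>Re (d * (q - p))\<bar> \<le> 11 * m\<^sup>2 * (2 * r)\<^sup>2"
    by (rule order_trans[OF dir[OF near1(2) eq(2)] mult_left_mono[OF sqle(1)]]) simp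
  have ds: "\<bar>Re (d * (s - p))\<bar> \<le> 11 * m\<^sup>2 * (2 * r)\<^sup>2"
    by (rule order_trans[OF dir[OF near1(3) eq(3)] mult_left_mono[OF sqle(2)]]) simp
  have "cmod d * (\<delta> * r\<^sup>2) \<le> cmod d * \<bar>Im (cnj (q - p) * (s - p))\<bar>"
    using area by (intro mult_left_mono) auto
  also have "\<dots> \<le> \<bar>Re (d * (q - p))\<bar> * cmod (s - p) + \<bar>Re (d * (s - p))\<bar> * cmod (q - p)"
    by (rule norm_le_of_two_directions)
  also have "\<dots> \<le> (11 * m\<^sup>2 * (2 * r)\<^sup>2) * (2 * r) + (11 * m\<^sup>2 * (2 * r)\<^sup>2) * (2 * r)"
    by (rule add_mono[OF mult_mono[OF dq \<beta>(2)] mult_mono[OF ds \<beta>(1)]]) simp_all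
  also have "\<dots> = 176 * m\<^sup>2 * r * r\<^sup>2"
    by (simp add: power2_eq_square)
  finally have "(cmod d * \<delta>) * r\<^sup>2 \<le> (176 * m\<^sup>2 * r) * r\<^sup>2"
    by (simp add: mult.assoc)
  then have "cmod d * \<delta> \<le> 176 * m\<^sup>2 * r"
    using r by simp
  then have d: "cmod d \<le> 176 * m\<^sup>2 * r / \<delta>"
    using \<delta> by (simp add: field_simps)
  have "cmod (wronskian F H l - wronskian F H p) \<le> (2 * m\<^sup>2) * cmod (l - p)"
  proof (rule field_differentiable_bound[of "cball l 1"])
    fix u assume u: "u \<in> cball l 1"
    have diff: "(G has_field_derivative deriv G u) (at u)" if "G holomorphic_on UNIV" for G
      using that by (intro holomorphic_derivI[of _ UNIV]) auto
    have dF: "deriv F holomorphic_on UNIV" and dH: "deriv H holomorphic_on UNIV"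
      using F H by (auto intro!: holomorphic_deriv)
    have "(wronskian F H has_field_derivative
        (deriv (deriv F) u * H u + deriv H u * deriv F u) - (deriv (deriv H) u * F u + deriv F u * deriv H u)) (at u)"
      unfolding wronskian_def by (intro DERIV_diff DERIV_mult diff F H dF dH)
    moreover have "(deriv (deriv F) u * H u + deriv H u * deriv F u) - (deriv (deriv H) u * F u + deriv F u * deriv H u)
        = deriv (deriv F) u * H u - deriv (deriv H) u * F u"
      by (simp add: mult.commute)
    ultimately show "(wronskian F H has_field_derivative deriv (deriv F) u * H u - deriv (deriv H) u * F u) (at u within cball l 1)"
      by (metis has_field_derivative_at_within)
    have u1: "cmod (u - l) \<le> 1"
      using u by (simp add: dist_norm norm_minus_commute)
    have "cmod (deriv (deriv F) u * H u - deriv (deriv H) u * F u) \<le>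
        cmod (deriv (deriv F) u) * cmod (H u) + cmod (deriv (deriv H) u) * cmod (F u)"
      using norm_triangle_ineq4 by (metis norm_mult)
    also have "\<dots> \<le> m * m + m * m"
      using bF[OF u1] bH[OF u1] m by (intro add_mono mult_mono) auto
    finally show "cmod (deriv (deriv F) u * H u - deriv (deriv H) u * F u) \<le> 2 * m\<^sup>2"
      by (simp add: power2_eq_square)
  qed (use near1 in \<open>auto simp: dist_norm norm_minus_commute\<close>)
  also have "\<dots> \<le> (2 * m\<^sup>2) * r"
    using near(1) by (intro mult_left_mono) (auto simp: norm_minus_commute)
  also have "\<dots> \<le> 2 * m\<^sup>2 * r / \<delta>"
    using r \<delta> by (simp add: field_simps mult_left_le_one_le)
  finally have "cmod (wronskian F H l - wronskian F H p) \<le> 2 * m\<^sup>2 * r / \<delta>" .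
  moreover have "cmod (wronskian F H p) \<le> 176 * m\<^sup>2 * r / \<delta>"
    using wronskian_eq_gradient_defect[of F p H] eq(1) d by (simp add: d_def)
  ultimately have "cmod (wronskian F H l) \<le> 2 * m\<^sup>2 * r / \<delta> + 176 * m\<^sup>2 * r / \<delta>"
    using norm_triangle_sub[of "wronskian F H l" "wronskian F H p"] by linarith
  also have "\<dots> = 178 * m\<^sup>2 * r / \<delta>"
    by (simp add: add_divide_distrib[symmetric] distrib_right[symmetric] del: distrib_right_numeral)
  finally show ?thesis .
qed

lemma derivatives_growth_near:
  assumes F: "F holomorphic_on UNIV" "gaussian_growth \<sigma> F" and \<sigma>: "0 \<le> \<sigma>" "\<sigma> < \<tau>"
  obtains C where "C > 0" "\<forall>z u. cmod (u - z) \<le> 1 \<longrightarrow> jet_bound F u (C * exp (\<tau> * (cmod z)\<^sup>2))"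
proof -
  define \<sigma>1 \<sigma>2 where "\<sigma>1 = (2 * \<sigma> + \<tau>) / 3" and "\<sigma>2 = (\<sigma> + 2 * \<tau>) / 3"
  have s: "0 \<le> \<sigma>1" "\<sigma> < \<sigma>1" "0 \<le> \<sigma>2" "\<sigma>1 < \<sigma>2" "\<sigma>2 < \<tau>" "\<sigma>1 < \<tau>"
    using \<sigma> by (auto simp: \<sigma>1_def \<sigma>2_def)
  have g1: "gaussian_growth \<sigma>1 (deriv F)"
    by (rule gaussian_growth_deriv[OF F(2) \<sigma>(1) s(2) F(1)])
  have "deriv F holomorphic_on UNIV"
    using F(1) by (intro holomorphic_deriv) auto
  then have g2: "gaussian_growth \<sigma>2 (deriv (deriv F))"
    by (rule gaussian_growth_deriv[OF g1 s(1,4)])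
  obtain C0 where C0: "C0 > 0" "\<forall>z u. cmod (u - z) \<le> 2 \<longrightarrow> cmod (F u) \<le> C0 * exp (\<tau> * (cmod z)\<^sup>2)"
    by (rule gaussian_growth_near[OF F(2) \<sigma>])
  obtain C1 where C1: "C1 > 0" "\<forall>z u. cmod (u - z) \<le> 2 \<longrightarrow> cmod (deriv F u) \<le> C1 * exp (\<tau> * (cmod z)\<^sup>2)"
    by (rule gaussian_growth_near[OF g1 s(1,6)])
  obtain C2 where C2: "C2 > 0" "\<forall>z u. cmod (u - z) \<le> 2 \<longrightarrow> cmod (deriv (deriv F) u) \<le> C2 * exp (\<tau> * (cmod z)\<^sup>2)"
    by (rule gaussian_growth_near[OF g2 s(3,5)])
  have le: "C0 * exp x \<le> (C0 + C1 + C2) * exp x" "C1 * exp x \<le> (C0 + C1 + C2) * exp x" "C2 * exp x \<le> (C0 + C1 + C2) * exp x" for x :: real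
    using C0(1) C1(1) C2(1) by (intro mult_right_mono; simp)+
  show thesis
  proof (rule that[of "C0 + C1 + C2"], goal_cases)
    case 2
    show ?case
    proof (intro allI impI)
      fix z u :: complex
      assume "cmod (u - z) \<le> 1"
      then have "cmod (u - z) \<le> 2" by simp
      then show "jet_bound F u ((C0 + C1 + C2) * exp (\<tau> * (cmod z)\<^sup>2))"
        using C0(2) C1(2) C2(2) le by (meson order_trans)
    qed
  qed (use C0 C1 C2 in auto)
qed

text \<open>The Wronskian is the numerator of the derivative of \<open>F / H\<close>. So the quotient is constant near
\<open>z0\<close>, and the identity \<open>F = c H\<close> extends by analytic continuation.\<close>

lemma proportional_of_wronskian_zero:
  assumes F: "F holomorphic_on UNIV" and H: "H holomorphic_on UNIV"
    and W: "\<And>z. wronskian F H z = 0" and z0: "H z0 \<noteq> 0"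
  obtains c where "\<And>z. F z = c * H z"
proof -
  have "continuous_on UNIV H"
    using H by (rule holomorphic_on_imp_continuous_on)
  then have "continuous (at z0) H"
    by (simp add: continuous_on_eq_continuous_at)
  then obtain e where e: "e > 0" "\<And>z. dist z0 z < e \<Longrightarrow> H z \<noteq> 0"
    using continuous_at_avoid[of z0 H 0] z0 by blast
  have "\<exists>c. \<forall>z\<in>ball z0 e. F z / H z = c"
  proof (rule has_field_derivative_zero_constant)
    fix z assume z: "z \<in> ball z0 e"
    have "(F has_field_derivative deriv F z) (at z)" "(H has_field_derivative deriv H z) (at z)"
      using F H by (auto intro!: holomorphic_derivI[of _ UNIV])
    moreover have "H z \<noteq> 0" using e(2) z by simp
    ultimately have "((\<lambda>z. F z / H z) has_field_derivative (deriv F z * H z - F z * deriv H z) / (H z * H z)) (at z)"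
      by (rule DERIV_divide)
    moreover have "deriv F z * H z - F z * deriv H z = 0"
      using W[of z] by (simp add: wronskian_def mult.commute)
    ultimately show "((\<lambda>z. F z / H z) has_field_derivative 0) (at z within ball z0 e)"
      by (simp add: has_field_derivative_at_within)
  qed simp
  then obtain c where c: "\<And>z. z \<in> ball z0 e \<Longrightarrow> F z / H z = c"
    by blast
  have "F z = c * H z" for z
  proof (rule analytic_continuation_open[of "ball z0 e" UNIV F "\<lambda>z. c * H z"])
    show "F z = c * H z" if "z \<in> ball z0 e" for z
      using c[OF that] e(2)[of z] that by (simp add: field_simps)
    show "(\<lambda>z. c * H z) holomorphic_on UNIV"
      by (intro holomorphic_intros H)
  qed (use F e in auto)
  then show thesis
    using that by blast
qed

text \<open>In the disc around the lattice point \<open>l\<close> the functions and their first two derivatives are at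
most a constant times \<open>exp (5 \<pi> \<bar>l\<bar>\<^sup>2 / 8)\<close>. The radius is at most \<open>exp (- 2 \<pi> \<bar>l\<bar>\<^sup>2)\<close> and the triangle
costs \<open>exp (\<bar>l\<bar>\<^sup>2)\<close>, so the Wronskian is at most a constant times
\<open>exp ((5 \<pi> / 4 - 2 \<pi> + 1) \<bar>l\<bar>\<^sup>2) \<le> exp (- \<bar>l\<bar>\<^sup>2)\<close> on the lattice. Its growth rate exceeds \<open>\<pi>\<close> by an
arbitrarily small amount, while \<open>2 a b < 1\<close> means \<open>\<pi> < \<pi> / (2 a b)\<close>. Hence it vanishes, by
\<open>lattice_uniqueness_off_axes\<close>, and \<open>F = c H\<close>. The same uniqueness theorem shows that \<open>H\<close>, unless it is
zero, cannot vanish at all the vertices \<open>p\<close>, and this forces \<open>\<bar>c\<bar> = 1\<close>.\<close>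

theorem entire_phase_retrieval:
  fixes F H :: "complex \<Rightarrow> complex" and a b \<gamma> :: real
  assumes ab: "a > 0" "b > 0" "2 * a * b < 1" and \<gamma>: "2 * pi \<le> \<gamma>"
    and F: "F holomorphic_on UNIV" "gaussian_growth (pi / 2) F"
    and H: "H holomorphic_on UNIV" "gaussian_growth (pi / 2) H"
    and E: "finite E"
    and triangle: "\<And>k l r. k \<notin> E \<Longrightarrow> fst k \<noteq> 0 \<Longrightarrow> snd k \<noteq> 0 \<Longrightarrow>
      l = lattice_point a b k \<Longrightarrow> r = exp (- (\<gamma> * (cmod l)\<^sup>2)) \<Longrightarrow>
      \<exists>p q s. cmod (p - l) \<le> r \<and> cmod (q - l) \<le> r \<and> cmod (s - l) \<le> r \<and>
        cmod (F p) = cmod (H p) \<and> cmod (F q) = cmod (H q) \<and> cmod (F s) = cmod (H s) \<and>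
        exp (- (cmod l)\<^sup>2) * r\<^sup>2 \<le> \<bar>Im (cnj (q - p) * (s - p))\<bar>"
  obtains c where "cmod c = 1" "\<And>z. F z = c * H z"
proof -
  have dens: "pi < pi / (2 * a * b)"
    using ab by (simp add: field_simps)
  have mid: "0 \<le> (pi + x) / 2 \<and> (pi + x) / 2 < x" if "pi < x" for x
  proof -
    have "0 \<le> pi + x"
      using that pi_gt_zero by linarith
    then show ?thesis
      using that by simp
  qed
  \<comment> \<open>Any rate above \<open>\<pi> / 2\<close> with \<open>2 \<tau> - 2 \<pi> + 1 \<le> - 1\<close> will do.\<close>
  define \<tau> where "\<tau> = 5 * pi / 8"
  have \<tau>: "0 \<le> pi / 2" "pi / 2 < \<tau>"
    by (auto simp: \<tau>_def)
  obtain A where A: "A > 0" "\<forall>z u. cmod (u - z) \<le> 1 \<longrightarrow> jet_bound F u (A * exp (\<tau> * (cmod z)\<^sup>2))"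
    by (rule derivatives_growth_near[OF F \<tau>])
  obtain B where B: "B > 0" "\<forall>z u. cmod (u - z) \<le> 1 \<longrightarrow> jet_bound H u (B * exp (\<tau> * (cmod z)\<^sup>2))"
    by (rule derivatives_growth_near[OF H \<tau>])
  have r1: "exp (- (\<gamma> * (cmod l)\<^sup>2)) \<le> 1" for l
  proof -
    have "0 \<le> \<gamma>"
      using \<gamma> pi_gt_zero by linarith
    then show ?thesis by simp
  qed
  \<comment> \<open>A zero in the tiny disc around \<open>l\<close> makes \<open>G l\<close> tiny.\<close>
  have vanish: "G z = 0" if G: "G holomorphic_on UNIV" "gaussian_growth (pi / 2) G"
      and zero: "\<And>k l r. k \<notin> E \<Longrightarrow> fst k \<noteq> 0 \<Longrightarrow> snd k \<noteq> 0 \<Longrightarrow>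
        l = lattice_point a b k \<Longrightarrow> r = exp (- (\<gamma> * (cmod l)\<^sup>2)) \<Longrightarrow> \<exists>p. cmod (p - l) \<le> r \<and> G p = 0"
    for G z
  proof -
    obtain D where D: "D > 0" "\<forall>z u. cmod (u - z) \<le> 1 \<longrightarrow> jet_bound G u (D * exp (\<tau> * (cmod z)\<^sup>2))"
      by (rule derivatives_growth_near[OF G \<tau>])
    show ?thesis
    proof (rule lattice_uniqueness_off_axes[OF ab(1,2) G(1) \<tau>(1) _ G(2) _ E, of 1 D])
      show "pi / 2 < pi / (2 * a * b)"
        using dens pi_gt_zero by linarith
      fix k :: "int \<times> int" assume k: "k \<notin> E" "fst k \<noteq> 0" "snd k \<noteq> 0"
      define l where "l = lattice_point a b k"
      define r where "r = exp (- (\<gamma> * (cmod l)\<^sup>2))"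
      obtain p where p: "cmod (p - l) \<le> r" "G p = 0"
        using zero[OF k l_def r_def] by blast
      have "cmod (G l - G p) \<le> (D * exp (\<tau> * (cmod l)\<^sup>2)) * cmod (l - p)"
      proof (rule field_differentiable_bound[of "cball l 1"])
        fix u assume u: "u \<in> cball l 1"
        have "(G has_field_derivative deriv G u) (at u)"
          using G(1) by (intro holomorphic_derivI[of _ UNIV]) auto
        then show "(G has_field_derivative deriv G u) (at u within cball l 1)"
          by (rule has_field_derivative_at_within)
        have "cmod (u - l) \<le> 1"
          using u by (simp add: dist_norm norm_minus_commute)
        then show "cmod (deriv G u) \<le> D * exp (\<tau> * (cmod l)\<^sup>2)"
          using D(2) by blast
      next
        have "cmod (p - l) \<le> 1"
          using p(1) r1[of l] unfolding r_def by linarith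
        then show "p \<in> cball l 1"
          by (simp add: dist_norm norm_minus_commute)
      qed auto
      also have "\<dots> \<le> (D * exp (\<tau> * (cmod l)\<^sup>2)) * r"
        using p(1) D(1) by (intro mult_left_mono) (auto simp: norm_minus_commute)
      also have "\<dots> = D * exp ((\<tau> - \<gamma>) * (cmod l)\<^sup>2)"
        by (simp add: r_def exp_add[symmetric] left_diff_distrib)
      also have "\<dots> \<le> D * exp (- (1 * (cmod l)\<^sup>2))"
      proof -
        have "\<tau> - \<gamma> \<le> -1"
          using \<gamma> pi_gt3 unfolding \<tau>_def by linarith
        then have "(\<tau> - \<gamma>) * (cmod l)\<^sup>2 \<le> -1 * (cmod l)\<^sup>2"
          by (rule mult_right_mono) simp
        then show ?thesis
          using D(1) by (intro mult_left_mono) auto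
      qed
      finally show "cmod (G (lattice_point a b k)) \<le> D * exp (- (1 * (cmod (lattice_point a b k))\<^sup>2))"
        using p(2) unfolding l_def by simp
    qed auto
  qed
  have W0: "wronskian F H z = 0" for z
  proof (rule lattice_uniqueness_off_axes[OF ab(1,2) _ _ _ _ _ E, of "wronskian F H" "(pi + pi / (2 * a * b)) / 2" 1 "178 * (A + B)\<^sup>2"])
    define \<epsilon> where "\<epsilon> = (pi / (2 * a * b) - pi) / 2"
    have \<epsilon>: "\<epsilon> > 0" "(pi + pi / (2 * a * b)) / 2 = pi / 2 + \<epsilon> + pi / 2"
      using dens by (auto simp: \<epsilon>_def field_simps)
    have dF: "deriv F holomorphic_on UNIV" and dH: "deriv H holomorphic_on UNIV"
      using F H by (auto intro!: holomorphic_deriv)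
    show "wronskian F H holomorphic_on UNIV"
      unfolding wronskian_def by (intro holomorphic_intros F H dF dH)
    have "gaussian_growth (pi / 2 + \<epsilon>) (deriv F)" "gaussian_growth (pi / 2 + \<epsilon>) (deriv H)"
      using F H \<epsilon>(1) by (auto intro!: gaussian_growth_deriv[of "pi / 2"])
    then show "gaussian_growth ((pi + pi / (2 * a * b)) / 2) (wronskian F H)"
      unfolding wronskian_def \<epsilon>(2) by (intro gaussian_growth_diff gaussian_growth_mult F H)
    show "0 \<le> (pi + pi / (2 * a * b)) / 2" "(pi + pi / (2 * a * b)) / 2 < pi / (2 * a * b)"
      using mid[OF dens] by auto
    fix k :: "int \<times> int" assume k: "k \<notin> E" "fst k \<noteq> 0" "snd k \<noteq> 0"
    define l where "l = lattice_point a b k"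
    define r where "r = exp (- (\<gamma> * (cmod l)\<^sup>2))"
    define m where "m = (A + B) * exp (\<tau> * (cmod l)\<^sup>2)"
    obtain p q s where pqs: "cmod (p - l) \<le> r" "cmod (q - l) \<le> r" "cmod (s - l) \<le> r"
        "cmod (F p) = cmod (H p)" "cmod (F q) = cmod (H q)" "cmod (F s) = cmod (H s)"
        "exp (- (cmod l)\<^sup>2) * r\<^sup>2 \<le> \<bar>Im (cnj (q - p) * (s - p))\<bar>"
      using triangle[OF k l_def r_def] by blast
    have mono: "A * exp x \<le> (A + B) * exp x" "B * exp x \<le> (A + B) * exp x" for x
      using A(1) B(1) by (auto intro!: mult_right_mono)
    have "cmod (wronskian F H l) \<le> 178 * m\<^sup>2 * r / exp (- (cmod l)\<^sup>2)"
    proof (rule wronskian_small_near_triangle[OF F(1) H(1) _ _ _ _ _ _ pqs])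
      show "jet_bound F u m" if "cmod (u - l) \<le> 1" for u
        using A(2) that mono(1) unfolding m_def by (meson order_trans)
      show "jet_bound H u m" if "cmod (u - l) \<le> 1" for u
        using B(2) that mono(2) unfolding m_def by (meson order_trans)
    qed (use r1 in \<open>auto simp: r_def\<close>)
    also have "\<dots> = 178 * (A + B)\<^sup>2 * exp ((2 * \<tau> - \<gamma> + 1) * (cmod l)\<^sup>2)"
    proof -
      have "178 * m\<^sup>2 * r / exp (- (cmod l)\<^sup>2) =
          178 * (A + B)\<^sup>2 * (exp (\<tau> * (cmod l)\<^sup>2) * exp (\<tau> * (cmod l)\<^sup>2) * r * exp ((cmod l)\<^sup>2))"
        by (simp add: m_def power2_eq_square exp_minus field_simps)
      also have "exp (\<tau> * (cmod l)\<^sup>2) * exp (\<tau> * (cmod l)\<^sup>2) * r * exp ((cmod l)\<^sup>2) = exp ((2 * \<tau> - \<gamma> + 1) * (cmod l)\<^sup>2)"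
        by (simp add: r_def exp_add[symmetric] algebra_simps)
      finally show ?thesis .
    qed
    also have "\<dots> \<le> 178 * (A + B)\<^sup>2 * exp (- (1 * (cmod l)\<^sup>2))"
    proof -
      have "2 * \<tau> - \<gamma> + 1 \<le> -1"
        using \<gamma> pi_gt3 unfolding \<tau>_def by linarith
      then have "(2 * \<tau> - \<gamma> + 1) * (cmod l)\<^sup>2 \<le> -1 * (cmod l)\<^sup>2"
        by (rule mult_right_mono) simp
      then show ?thesis
        by (intro mult_left_mono) auto
    qed
    finally show "cmod (wronskian F H (lattice_point a b k)) \<le> 178 * (A + B)\<^sup>2 * exp (- (1 * (cmod (lattice_point a b k))\<^sup>2))"
      unfolding l_def .
  qed auto
  show thesis
  proof (cases "\<forall>z. H z = 0")
    case True
    have "F z = 0" for z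
    proof (rule vanish[OF F])
      fix k :: "int \<times> int" and l r
      assume k: "k \<notin> E" "fst k \<noteq> 0" "snd k \<noteq> 0" "l = lattice_point a b k" "r = exp (- (\<gamma> * (cmod l)\<^sup>2))"
      then obtain p where "cmod (p - l) \<le> r" "cmod (F p) = cmod (H p)"
        using triangle[OF k] by blast
      then show "\<exists>p. cmod (p - l) \<le> r \<and> F p = 0"
        using True by auto
    qed
    then show thesis
      using that[of 1] True by simp
  next
    case False
    then obtain z0 where "H z0 \<noteq> 0" by blast
    then obtain c where c: "\<And>z. F z = c * H z"
      using proportional_of_wronskian_zero[OF F(1) H(1) W0] by blast
    have "cmod c = 1"
    proof (rule ccontr)
      assume c1: "cmod c \<noteq> 1"
      have "H z = 0" for z
      proof (rule vanish[OF H])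
        fix k :: "int \<times> int" and l r
        assume k: "k \<notin> E" "fst k \<noteq> 0" "snd k \<noteq> 0" "l = lattice_point a b k" "r = exp (- (\<gamma> * (cmod l)\<^sup>2))"
        then obtain p where p: "cmod (p - l) \<le> r" "cmod (F p) = cmod (H p)"
          using triangle[OF k] by blast
        then have "H p = 0"
          using c1 c[of p] by (simp add: norm_mult)
        then show "\<exists>p. cmod (p - l) \<le> r \<and> H p = 0"
          using p by blast
      qed
      then show False
        using False by blast
    qed
    then show thesis
      using that c by blast
  qed
qed

section \<open>The Bargmann transform and the Gabor transform\<close>

lemma gaussian_eq_normal_density:
  "exp (- pi * (t - x)\<^sup>2) = normal_density x (1 / sqrt (2 * pi)) t"
  by (simp add: normal_density_def power_divide real_sqrt_mult field_simps)

lemma integrable_gaussian: "integrable lebesgue (\<lambda>t. exp (- pi * (t - x)\<^sup>2))"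
proof -
  have "integrable lborel (normal_density x (1 / sqrt (2 * pi)))"
    by (rule integrable_normal_density) simp
  then show ?thesis
    unfolding gaussian_eq_normal_density by (subst integrable_completion) auto
qed

lemma integral_gaussian: "(LINT t|lebesgue. exp (- pi * (t - x)\<^sup>2)) = 1"
proof -
  have "(LINT t|lborel. normal_density x (1 / sqrt (2 * pi)) t) = 1"
    by (rule integral_normal_density) simp
  then show ?thesis
    unfolding gaussian_eq_normal_density by (subst integral_completion) auto
qed

lemma L2_measurable: "g \<in> L2 \<Longrightarrow> g \<in> borel_measurable lebesgue"
  by (simp add: L2_def)

lemma measurable_lebesgue_of_borel:
  assumes "f \<in> borel_measurable borel"
  shows "f \<in> borel_measurable lebesgue"
  by (rule measurable_completion) (simp add: assms)

abbreviation gauss_kernel :: "real \<Rightarrow> complex \<Rightarrow> complex" where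
  "gauss_kernel t z \<equiv> exp (of_real (- pi * t\<^sup>2) + of_real (2 * pi * t) * z)"

lemma borel_measurable_lebesgue_gauss_kernel [measurable]:
  "(\<lambda>t::real. gauss_kernel t z) \<in> borel_measurable lebesgue"
  by (intro measurable_lebesgue_of_borel borel_measurable_continuous_onI continuous_intros)

text \<open>By \<open>x y \<le> x\<^sup>2 + y\<^sup>2\<close> it suffices that the square of the second factor is integrable, and this
square is at most a constant times \<open>exp (- \<pi> t\<^sup>2)\<close>.\<close>

lemma L2_gaussian_integrable:
  assumes g: "g \<in> L2"
  shows "integrable lebesgue (\<lambda>t. cmod (g t) * exp (- pi * t\<^sup>2 + c * \<bar>t\<bar>))"
proof (rule Bochner_Integration.integrable_bound)
  define K where "K = exp ((2 * c)\<^sup>2 / (4 * pi))"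
  show "integrable lebesgue (\<lambda>t. (cmod (g t))\<^sup>2 + K * exp (- pi * (t - 0)\<^sup>2))"
    using g integrable_gaussian[of 0] by (intro Bochner_Integration.integrable_add integrable_mult_right) (auto simp: L2_def)
  show "(\<lambda>t. cmod (g t) * exp (- pi * t\<^sup>2 + c * \<bar>t\<bar>)) \<in> borel_measurable lebesgue"
  proof (rule borel_measurable_times)
    show "(\<lambda>t. cmod (g t)) \<in> borel_measurable lebesgue"
      using L2_measurable[OF g] by measurable
    show "(\<lambda>t. exp (- pi * t\<^sup>2 + c * \<bar>t\<bar>)) \<in> borel_measurable lebesgue"
      by (intro measurable_lebesgue_of_borel borel_measurable_continuous_onI continuous_intros)
  qed
  have "cmod (g t) * exp (- pi * t\<^sup>2 + c * \<bar>t\<bar>) \<le> (cmod (g t))\<^sup>2 + K * exp (- pi * (t - 0)\<^sup>2)" for t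
  proof -
    define y where "y = exp (- pi * t\<^sup>2 + c * \<bar>t\<bar>)"
    have "y\<^sup>2 = exp (2 * (- pi * t\<^sup>2 + c * \<bar>t\<bar>))"
      unfolding y_def power2_eq_square by (simp add: exp_add[symmetric])
    also have "\<dots> \<le> exp ((2 * c)\<^sup>2 / (4 * pi) + - pi * (t - 0)\<^sup>2)"
      using linear_le_quadratic[of pi "2 * c" "\<bar>t\<bar>"] by simp
    also have "\<dots> = K * exp (- pi * (t - 0)\<^sup>2)"
      by (simp only: K_def exp_add)
    finally have y: "y\<^sup>2 \<le> K * exp (- pi * (t - 0)\<^sup>2)" .
    have "0 \<le> (cmod (g t) - y)\<^sup>2" "0 \<le> cmod (g t) * y"
      by (simp_all add: y_def)
    moreover have "(cmod (g t) - y)\<^sup>2 = (cmod (g t))\<^sup>2 + y\<^sup>2 - 2 * (cmod (g t) * y)"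
      by (simp add: power2_eq_square algebra_simps)
    ultimately have "cmod (g t) * y \<le> (cmod (g t))\<^sup>2 + y\<^sup>2"
      by linarith
    then show ?thesis
      using y unfolding y_def by linarith
  qed
  then show "AE t in lebesgue. norm (cmod (g t) * exp (- pi * t\<^sup>2 + c * \<bar>t\<bar>))
      \<le> norm ((cmod (g t))\<^sup>2 + K * exp (- pi * (t - 0)\<^sup>2))"
    by (intro AE_I2) (simp add: K_def)
qed

text \<open>The two-sided Laplace transform of \<open>g t * exp (- \<pi> t\<^sup>2)\<close>, dilated by \<open>2 \<pi>\<close>.\<close>

definition laplace_gauss :: "(real \<Rightarrow> complex) \<Rightarrow> complex \<Rightarrow> complex" where
  "laplace_gauss g z = (LINT t|lebesgue. g t * gauss_kernel t z)"

text \<open>The Bargmann transform, up to normalisation.\<close>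

definition bargmann :: "(real \<Rightarrow> complex) \<Rightarrow> complex \<Rightarrow> complex" where
  "bargmann g z = exp (- of_real (pi / 2) * z\<^sup>2) * laplace_gauss g z"

lemma laplace_gauss_integrable:
  assumes g: "g \<in> L2"
  shows "integrable lebesgue (\<lambda>t. g t * gauss_kernel t z)"
proof (rule Bochner_Integration.integrable_bound[OF L2_gaussian_integrable[OF g, of "2 * pi * cmod z"]])
  show "(\<lambda>t. g t * gauss_kernel t z) \<in> borel_measurable lebesgue"
    using L2_measurable[OF g] borel_measurable_lebesgue_gauss_kernel by (rule borel_measurable_times)
  have "t * Re z \<le> \<bar>t\<bar> * cmod z" for t
    using abs_Re_le_cmod[of z] abs_ge_self[of "t * Re z"] mult_left_mono[of "\<bar>Re z\<bar>" "cmod z" "\<bar>t\<bar>"]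
    by (simp add: abs_mult)
  then have "2 * pi * (t * Re z) \<le> 2 * pi * (\<bar>t\<bar> * cmod z)" for t
    by (intro mult_left_mono) auto
  then show "AE t in lebesgue. norm (g t * gauss_kernel t z)
      \<le> norm (cmod (g t) * exp (- pi * t\<^sup>2 + 2 * pi * cmod z * \<bar>t\<bar>))"
    by (intro AE_I2) (auto simp: norm_mult mult_ac intro!: mult_left_mono)
qed

text \<open>Completing the square pulls out \<open>exp (\<pi> (Re z)\<^sup>2)\<close> and leaves the integral of
\<open>\<bar>g t\<bar> exp (- \<pi> (t - Re z)\<^sup>2)\<close>, which is bounded uniformly in \<open>z\<close> since the integral of the Gaussian is
invariant under translation.\<close>

lemma laplace_gauss_growth:
  assumes g: "g \<in> L2"
  obtains C where "C > 0" "\<And>z. cmod (laplace_gauss g z) \<le> C * exp (pi * (Re z)\<^sup>2)"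
proof -
  define C where "C = (LINT t|lebesgue. (cmod (g t))\<^sup>2) + 1"
  have "cmod (laplace_gauss g z) \<le> C * exp (pi * (Re z)\<^sup>2)" for z
  proof -
    have gi: "integrable lebesgue (\<lambda>t. (cmod (g t))\<^sup>2)"
      using g by (simp add: L2_def)
    have "cmod (laplace_gauss g z) \<le> (LINT t|lebesgue. cmod (g t * gauss_kernel t z))"
      unfolding laplace_gauss_def by (rule integral_norm_bound)
    also have "\<dots> \<le> (LINT t|lebesgue. exp (pi * (Re z)\<^sup>2) * ((cmod (g t))\<^sup>2 + exp (- pi * (t - Re z)\<^sup>2)))"
    proof (rule integral_mono)
      show "integrable lebesgue (\<lambda>t. cmod (g t * gauss_kernel t z))"
        by (intro integrable_norm laplace_gauss_integrable g)
      show "integrable lebesgue (\<lambda>t. exp (pi * (Re z)\<^sup>2) * ((cmod (g t))\<^sup>2 + exp (- pi * (t - Re z)\<^sup>2)))"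
        by (intro integrable_mult_right Bochner_Integration.integrable_add gi integrable_gaussian)
      fix t
      define y where "y = exp (- pi * (t - Re z)\<^sup>2)"
      have "y * y \<le> y * 1"
        unfolding y_def by (intro mult_left_mono) auto
      moreover have "0 \<le> (cmod (g t) - y)\<^sup>2" "0 \<le> cmod (g t) * y"
        by (simp_all add: y_def)
      moreover have "(cmod (g t) - y)\<^sup>2 = (cmod (g t))\<^sup>2 + y * y - 2 * (cmod (g t) * y)"
        by (simp add: power2_eq_square algebra_simps)
      ultimately have "cmod (g t) * y \<le> (cmod (g t))\<^sup>2 + y"
        by linarith
      then have "exp (pi * (Re z)\<^sup>2) * (cmod (g t) * y) \<le> exp (pi * (Re z)\<^sup>2) * ((cmod (g t))\<^sup>2 + y)"
        by (intro mult_left_mono) auto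
      moreover have "cmod (g t * gauss_kernel t z) = exp (pi * (Re z)\<^sup>2) * (cmod (g t) * y)"
        unfolding y_def by (simp add: norm_mult exp_add[symmetric] power2_eq_square algebra_simps)
      ultimately show "cmod (g t * gauss_kernel t z)
          \<le> exp (pi * (Re z)\<^sup>2) * ((cmod (g t))\<^sup>2 + exp (- pi * (t - Re z)\<^sup>2))"
        unfolding y_def by simp
    qed
    also have "\<dots> = exp (pi * (Re z)\<^sup>2) * C"
      unfolding C_def using gi integrable_gaussian[of "Re z"] integral_gaussian[of "Re z"] by simp
    finally show ?thesis by (simp add: mult.commute)
  qed
  moreover have "C > 0"
    unfolding C_def by (rule add_nonneg_pos) auto
  ultimately show thesis
    using that by blast
qed

lemma bargmann_growth:
  assumes g: "g \<in> L2"
  shows "gaussian_growth (pi / 2) (bargmann g)"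
proof -
  obtain C where C: "C > 0" "\<And>z. cmod (laplace_gauss g z) \<le> C * exp (pi * (Re z)\<^sup>2)"
    using laplace_gauss_growth[OF g] by blast
  have "cmod (bargmann g z) \<le> C * exp (pi / 2 * (cmod z)\<^sup>2)" for z
  proof -
    have "cmod (bargmann g z) = exp (- (pi / 2) * ((Re z)\<^sup>2 - (Im z)\<^sup>2)) * cmod (laplace_gauss g z)"
      by (simp add: bargmann_def norm_mult Re_power2)
    also have "\<dots> \<le> exp (- (pi / 2) * ((Re z)\<^sup>2 - (Im z)\<^sup>2)) * (C * exp (pi * (Re z)\<^sup>2))"
      by (intro mult_left_mono C) auto
    also have "\<dots> = C * exp (pi / 2 * (cmod z)\<^sup>2)"
      by (simp add: exp_add[symmetric] cmod_power2 algebra_simps)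
    finally show ?thesis .
  qed
  then show ?thesis
    unfolding gaussian_growth_def using C(1) by blast
qed

text \<open>Expanding \<open>exp (2 \<pi> t z)\<close> under the integral gives a power series that converges everywhere:
its partial sums are dominated by \<open>\<bar>g t\<bar> exp (- \<pi> t\<^sup>2 + 2 \<pi> \<bar>z\<bar> \<bar>t\<bar>)\<close>.\<close>

lemma laplace_gauss_holomorphic:
  assumes g: "g \<in> L2"
  shows "laplace_gauss g holomorphic_on UNIV"
proof -
  define u where "u n z t = g t * exp (of_real (- pi * t\<^sup>2)) * ((of_real (2 * pi * t) * z) ^ n / fact n)" for n z and t :: real
  define a where "a n = (LINT t|lebesgue. u n 1 t)" for n
  have gm: "g \<in> borel_measurable lebesgue"
    by (rule L2_measurable[OF g])
  have um: "u n z \<in> borel_measurable lebesgue" for n z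
    unfolding u_def
    by (intro borel_measurable_times gm measurable_lebesgue_of_borel borel_measurable_continuous_onI continuous_intros) auto
  have partial: "(\<Sum>n<N. cmod (w ^ n / fact n)) \<le> exp (cmod w)" for w :: complex and N
  proof -
    have s: "(\<lambda>n. cmod w ^ n / fact n) sums exp (cmod w)"
      using exp_converges[of "cmod w"] by (simp add: field_simps)
    have "(\<Sum>n<N. cmod w ^ n / fact n) \<le> (\<Sum>n. cmod w ^ n / fact n)"
      using s by (intro sum_le_suminf sums_summable) auto
    also have "\<dots> = exp (cmod w)"
      using s by (rule sums_unique[symmetric])
    finally show ?thesis
      by (simp add: norm_divide norm_power)
  qed
  define B where "B z t = cmod (g t) * exp (- pi * t\<^sup>2 + (2 * pi * cmod z) * \<bar>t\<bar>)" for z t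
  have Bi: "integrable lebesgue (B z)" for z
    unfolding B_def by (rule L2_gaussian_integrable[OF g])
  have sum_le: "(\<Sum>n<N. cmod (u n z t)) \<le> B z t" for N z t
  proof -
    have "(\<Sum>n<N. cmod (u n z t)) = cmod (g t) * exp (- pi * t\<^sup>2) * (\<Sum>n<N. cmod ((of_real (2 * pi * t) * z) ^ n / fact n))"
      unfolding u_def norm_mult[of "_ * _"] sum_distrib_left by (simp add: norm_mult)
    also have "\<dots> \<le> cmod (g t) * exp (- pi * t\<^sup>2) * exp (cmod (of_real (2 * pi * t) * z))"
      by (intro mult_left_mono partial) auto
    also have "\<dots> = B z t"
    proof -
      have "cmod (of_real (2 * pi * t) * z) = (2 * pi * cmod z) * \<bar>t\<bar>"
        by (simp add: norm_mult)
      then show ?thesis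
        unfolding B_def exp_add by (simp only: mult.assoc)
    qed
    finally show ?thesis .
  qed
  have ui: "integrable lebesgue (u n z)" for n z
  proof (rule Bochner_Integration.integrable_bound[OF Bi[of z] um])
    have "cmod (u n z t) \<le> B z t" for t
      using sum_le[of z t "Suc n"] sum_nonneg[of "{..<n}" "\<lambda>n. cmod (u n z t)"] by simp
    then show "AE t in lebesgue. norm (u n z t) \<le> norm (B z t)"
      by (intro AE_I2) (auto simp: B_def)
  qed
  have "(\<lambda>n. a n * (z - 0) ^ n) sums laplace_gauss g z" for z
  proof -
    have "(\<lambda>N. LINT t|lebesgue. (\<Sum>n<N. u n z t)) \<longlonglongrightarrow>
        (LINT t|lebesgue. g t * gauss_kernel t z)"
    proof (rule integral_dominated_convergence[OF _ _ Bi[of z]])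
      show "(\<lambda>t. g t * gauss_kernel t z) \<in> borel_measurable lebesgue"
        using gm borel_measurable_lebesgue_gauss_kernel by (rule borel_measurable_times)
      show "(\<lambda>t. \<Sum>n<N. u n z t) \<in> borel_measurable lebesgue" for N
        by (intro borel_measurable_sum um)
      have "(\<lambda>n. (of_real (2 * pi * t) * z) ^ n / fact n) sums exp (of_real (2 * pi * t) * z)" for t :: real
        using exp_converges[of "of_real (2 * pi * t) * z"] by (simp add: scaleR_conv_of_real field_simps)
      then have "(\<lambda>n. u n z t) sums (g t * exp (of_real (- pi * t\<^sup>2)) * exp (of_real (2 * pi * t) * z))" for t
        unfolding u_def by (rule sums_mult)
      then have "(\<lambda>n. u n z t) sums (g t * gauss_kernel t z)" for t
        by (simp only: exp_add mult.assoc)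
      then show "AE t in lebesgue. (\<lambda>N. \<Sum>n<N. u n z t) \<longlonglongrightarrow> g t * gauss_kernel t z"
        unfolding sums_def by (intro AE_I2) auto
      show "AE t in lebesgue. norm (\<Sum>n<N. u n z t) \<le> B z t" for N
        by (intro AE_I2 order_trans[OF norm_sum] sum_le)
    qed
    moreover have "(LINT t|lebesgue. (\<Sum>n<N. u n z t)) = (\<Sum>n<N. a n * (z - 0) ^ n)" for N
    proof -
      have coeff: "(LINT t|lebesgue. u n z t) = a n * (z - 0) ^ n" for n
      proof -
        have "u n z t = u n 1 t * z ^ n" for t
          by (simp add: u_def power_mult_distrib)
        then show ?thesis
          unfolding a_def using ui[of n 1] by simp
      qed
      have "(LINT t|lebesgue. (\<Sum>n<N. u n z t)) = (\<Sum>n<N. LINT t|lebesgue. u n z t)"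
        by (intro Bochner_Integration.integral_sum ui)
      also have "\<dots> = (\<Sum>n<N. a n * (z - 0) ^ n)"
        by (simp only: coeff)
      finally show ?thesis .
    qed
    ultimately show ?thesis
      unfolding sums_def laplace_gauss_def by simp
  qed
  then have "laplace_gauss g holomorphic_on ball 0 r" for r
    by (intro power_series_holomorphic[of 0 r a]) auto
  then have "laplace_gauss g field_differentiable at z" for z
    by (intro holomorphic_on_imp_differentiable_at[of _ "ball 0 (cmod z + 1)"]) auto
  then show ?thesis
    by (simp add: holomorphic_on_def field_differentiable_at_within)
qed

lemma bargmann_holomorphic:
  assumes "g \<in> L2"
  shows "bargmann g holomorphic_on UNIV"
  unfolding bargmann_def using laplace_gauss_holomorphic[OF assms] by (intro holomorphic_intros)

text \<open>Expanding the square in the window \<open>exp (- \<pi> (t - x)\<^sup>2)\<close> turns the Gabor transform at \<open>(x, \<omega>)\<close>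
into \<open>exp (- \<pi> x\<^sup>2)\<close> times the Laplace transform at \<open>x - i \<omega>\<close>.\<close>

lemma norm_gabor_eq_bargmann:
  "cmod (gabor g u) = exp (- (pi / 2) * (cmod (Complex (u $ 1) (- u $ 2)))\<^sup>2) * cmod (bargmann g (Complex (u $ 1) (- u $ 2)))"
proof -
  define z where "z = Complex (u $ 1) (- u $ 2)"
  have comm: "G * A * B = C * (G * D)" if "A * B = C * D" for A B C D G :: complex
    using that by (simp add: mult.assoc mult.left_commute)
  have "gabor g u = (LINT t|lebesgue. of_real (exp (- pi * (Re z)\<^sup>2)) * (g t * gauss_kernel t z))"
    unfolding gabor_def
  proof (rule Bochner_Integration.integral_cong)
    fix t
    have "of_real (- pi * (t - u $ 1)\<^sup>2) + (- 2 * of_real pi * \<i> * of_real (u $ 2) * of_real t) =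
        of_real (- pi * (Re z)\<^sup>2) + (of_real (- pi * t\<^sup>2) + of_real (2 * pi * t) * z)"
      by (simp add: z_def complex_eq_iff power2_eq_square algebra_simps)
    then have "of_real (exp (- pi * (t - u $ 1)\<^sup>2)) * exp (- 2 * of_real pi * \<i> * of_real (u $ 2) * of_real t) =
        of_real (exp (- pi * (Re z)\<^sup>2)) * gauss_kernel t z"
      unfolding exp_of_real[symmetric] exp_add[symmetric] by simp
    then show "g t * of_real (exp (- pi * (t - u $ 1)\<^sup>2)) * exp (- 2 * of_real pi * \<i> * of_real (u $ 2) * of_real t) =
        of_real (exp (- pi * (Re z)\<^sup>2)) * (g t * gauss_kernel t z)"
      by (rule comm)
  qed simp
  then have "gabor g u = of_real (exp (- pi * (Re z)\<^sup>2)) * laplace_gauss g z"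
    by (simp add: laplace_gauss_def)
  then have "cmod (gabor g u) = exp (- pi * (Re z)\<^sup>2) * cmod (laplace_gauss g z)"
    by (simp add: norm_mult)
  moreover have "cmod (bargmann g z) = exp (- (pi / 2) * ((Re z)\<^sup>2 - (Im z)\<^sup>2)) * cmod (laplace_gauss g z)"
    by (simp add: bargmann_def norm_mult Re_power2)
  moreover have "exp (- (pi / 2) * (cmod z)\<^sup>2) * exp (- (pi / 2) * ((Re z)\<^sup>2 - (Im z)\<^sup>2)) = exp (- pi * (Re z)\<^sup>2)"
    by (simp add: exp_add[symmetric] cmod_power2 algebra_simps)
  ultimately show ?thesis
    unfolding z_def[symmetric] by (simp add: mult.assoc[symmetric])
qed

lemma bargmann_cnj:
  assumes "g \<in> L2" "AE t in lebesgue. g t \<in> \<real>"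
  shows "bargmann g (cnj z) = cnj (bargmann g z)"
proof -
  have "cnj (laplace_gauss g z) = (LINT t|lebesgue. cnj (g t * gauss_kernel t z))"
    unfolding laplace_gauss_def by (rule Bochner_Integration.integral_cnj[symmetric])
  also have "\<dots> = (LINT t|lebesgue. g t * gauss_kernel t (cnj z))"
  proof (rule integral_cong_AE)
    show "(\<lambda>t. g t * gauss_kernel t (cnj z)) \<in> borel_measurable lebesgue"
      using laplace_gauss_integrable[OF assms(1)] by (rule borel_measurable_integrable)
    show "(\<lambda>t. cnj (g t * gauss_kernel t z)) \<in> borel_measurable lebesgue"
      using laplace_gauss_integrable[OF assms(1), of z] by (intro borel_measurable_integrable) (simp only: integrable_cnj)
    show "AE t in lebesgue. cnj (g t * gauss_kernel t z) =
        g t * gauss_kernel t (cnj z)"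
      using assms(2) by eventually_elim (simp add: exp_cnj Reals_cnj_iff)
  qed
  finally show ?thesis
    by (simp add: bargmann_def laplace_gauss_def exp_cnj)
qed

lemma bargmann_even:
  assumes "g \<in> L2" "AE t in lebesgue. g (- t) = g t"
  shows "bargmann g (- z) = bargmann g z"
proof -
  have "laplace_gauss g (- z) = (LINT t|lebesgue. g (- t) * exp (of_real (- pi * (- t)\<^sup>2) + of_real (2 * pi * (- t)) * (- z)))"
    unfolding laplace_gauss_def by (subst lebesgue_integral_real_affine[of "-1" _ 0]) auto
  also have "\<dots> = laplace_gauss g z"
    unfolding laplace_gauss_def
  proof (rule integral_cong_AE)
    show "(\<lambda>t. g t * gauss_kernel t z) \<in> borel_measurable lebesgue"
      using laplace_gauss_integrable[OF assms(1)] by (rule borel_measurable_integrable)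
    show "(\<lambda>t. g (- t) * exp (of_real (- pi * (- t)\<^sup>2) + of_real (2 * pi * (- t)) * (- z))) \<in> borel_measurable lebesgue"
      using laplace_gauss_integrable[OF assms(1), of "- z"] lebesgue_integrable_real_affine_iff[of "-1" "\<lambda>t. g t * gauss_kernel t (- z)" 0]
      by (intro borel_measurable_integrable) simp
    show "AE t in lebesgue. g (- t) * exp (of_real (- pi * (- t)\<^sup>2) + of_real (2 * pi * (- t)) * (- z)) =
        g t * gauss_kernel t z"
      using assms(2) by eventually_elim simp
  qed
  finally show ?thesis
    by (simp add: bargmann_def)
qed

section \<open>Injectivity of the Bargmann transform\<close>

text \<open>The positive and the negative part of \<open>\<phi>\<close> have the same Fourier transform, in particular the
same integral \<open>m\<close>. If \<open>m > 0\<close>, then after division by \<open>m\<close> both are probability densities with the same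
characteristic function, so they agree almost everywhere by Levy's theorem. As their product is
zero, both vanish.\<close>

lemma fourier_injective_real:
  fixes \<phi> :: "real \<Rightarrow> real"
  assumes int: "integrable lebesgue \<phi>"
    and zero: "\<And>w. (LINT t|lebesgue. of_real (\<phi> t) * iexp (w * t)) = 0"
  shows "AE t in lebesgue. \<phi> t = 0"
proof -
  obtain f where f[measurable]: "f \<in> borel_measurable lborel" and \<phi>f: "AE x in lborel. \<phi> x = f x"
    using completion_ex_borel_measurable_real[of \<phi> lborel] borel_measurable_integrable[OF int] by auto
  have \<phi>f': "AE x in lebesgue. \<phi> x = f x"
    using \<phi>f by (rule AE_completion)
  have fL: "f \<in> borel_measurable lebesgue"
    using f by (rule measurable_completion)
  have "integrable lebesgue f"
    using int \<phi>f' borel_measurable_integrable[OF int] fL integrable_cong_AE by blast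
  then have fi: "integrable lborel f"
    using f by (simp add: integrable_completion)
  have iexp_meas [measurable]: "(\<lambda>t. iexp (w * t)) \<in> borel_measurable borel" for w
    by measurable
  have f0: "(LINT t|lborel. of_real (f t) * iexp (w * t)) = 0" for w
  proof -
    have "(LINT t|lborel. of_real (f t) * iexp (w * t)) = (LINT t|lebesgue. of_real (f t) * iexp (w * t))"
      by (rule integral_completion[symmetric]) measurable
    also have "\<dots> = (LINT t|lebesgue. of_real (\<phi> t) * iexp (w * t))"
    proof (rule integral_cong_AE)
      have m: "(\<lambda>t. iexp (w * t)) \<in> borel_measurable lebesgue"
        by (rule measurable_completion) (simp add: iexp_meas)
      show "(\<lambda>t. of_real (f t) * iexp (w * t)) \<in> borel_measurable lebesgue"
        by (intro borel_measurable_times m measurable_compose[OF fL borel_measurable_of_real])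
      show "(\<lambda>t. of_real (\<phi> t) * iexp (w * t)) \<in> borel_measurable lebesgue"
        by (intro borel_measurable_times m measurable_compose[OF borel_measurable_integrable[OF int] borel_measurable_of_real])
      show "AE t in lebesgue. of_real (f t) * iexp (w * t) = of_real (\<phi> t) * iexp (w * t)"
        using \<phi>f' by eventually_elim simp
    qed
    finally show ?thesis
      using zero by simp
  qed
  define P Q where "P x = max 0 (f x)" and "Q x = max 0 (- f x)" for x
  have PQm[measurable]: "P \<in> borel_measurable lborel" "Q \<in> borel_measurable lborel"
    unfolding P_def Q_def by measurable
  have PQ: "f x = P x - Q x" "0 \<le> P x" "0 \<le> Q x" for x
    by (auto simp: P_def Q_def)
  have Pi: "integrable lborel P" and Qi: "integrable lborel Q"
    using fi unfolding P_def Q_def by (auto intro!: integrable_max)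
  have times_i: "integrable lborel (\<lambda>t. of_real (R t) * iexp (w * t))" if "integrable lborel R" for R :: "real \<Rightarrow> real" and w
  proof (rule Bochner_Integration.integrable_bound[OF that])
    show "(\<lambda>t. of_real (R t) * iexp (w * t)) \<in> borel_measurable lborel"
      using borel_measurable_integrable[OF that] by measurable
  qed (simp add: norm_mult)
  have eq: "(LINT t|lborel. of_real (P t) * iexp (w * t)) = (LINT t|lborel. of_real (Q t) * iexp (w * t))" for w
  proof -
    have "(LINT t|lborel. of_real (f t) * iexp (w * t)) =
        (LINT t|lborel. of_real (P t) * iexp (w * t)) - (LINT t|lborel. of_real (Q t) * iexp (w * t))"
      using times_i[OF Pi] times_i[OF Qi] by (simp add: PQ(1) left_diff_distrib)
    then show ?thesis
      using f0 by simp
  qed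
  define m where "m = (LINT t|lborel. P t)"
  have "complex_of_real (LINT t|lborel. P t) = of_real (LINT t|lborel. Q t)"
    using eq[of 0] by simp
  then have mQ: "m = (LINT t|lborel. Q t)"
    unfolding m_def by (simp only: of_real_eq_iff)
  have m0: "0 \<le> m"
    unfolding m_def using PQ by (intro integral_nonneg_AE) auto
  have "AE t in lborel. P t = Q t"
  proof (cases "m = 0")
    case True
    then have "AE t in lborel. P t = 0" "AE t in lborel. Q t = 0"
      using integral_nonneg_eq_0_iff_AE[OF Pi] integral_nonneg_eq_0_iff_AE[OF Qi] PQ mQ unfolding m_def by auto
    then show ?thesis
      by eventually_elim simp
  next
    case False
    then have mpos: "m > 0" using m0 by simp
    have dist: "real_distribution (density lborel (\<lambda>x. ennreal (R x / m)))"
      if R: "integrable lborel R" "\<And>x. 0 \<le> R x" "(LINT t|lborel. R t) = m" for R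
    proof -
      have Rm[measurable]: "R \<in> borel_measurable lborel"
        using R(1) by (rule borel_measurable_integrable)
      have "(\<integral>\<^sup>+x. ennreal (R x / m) \<partial>lborel) = ennreal (LINT t|lborel. R t / m)"
        using R mpos by (intro nn_integral_eq_integral) auto
      also have "\<dots> = 1"
        using R(3) mpos by simp
      finally have "prob_space (density lborel (\<lambda>x. ennreal (R x / m)))"
        by (intro prob_spaceI) (simp add: emeasure_density)
      then show ?thesis
        by (simp add: real_distribution_def real_distribution_axioms_def)
    qed
    have char: "char (density lborel (\<lambda>x. ennreal (R x / m))) w = (LINT t|lborel. of_real (R t) * iexp (w * t)) / m"
      if R: "integrable lborel R" "\<And>x. 0 \<le> R x" for R w
    proof -
      have Rm[measurable]: "R \<in> borel_measurable lborel"
        using R(1) by (rule borel_measurable_integrable)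
      have "char (density lborel (\<lambda>x. ennreal (R x / m))) w = (LINT t|lborel. (R t / m) *\<^sub>R iexp (w * t))"
        unfolding char_def using R(2) mpos by (intro integral_density) auto
      also have "\<dots> = (LINT t|lborel. (of_real (R t) * iexp (w * t)) / m)"
        by (simp add: scaleR_conv_of_real)
      finally show ?thesis by simp
    qed
    have "density lborel (\<lambda>x. ennreal (P x / m)) = density lborel (\<lambda>x. ennreal (Q x / m))"
    proof (rule Levy_uniqueness)
      show "real_distribution (density lborel (\<lambda>x. ennreal (P x / m)))"
        by (rule dist[OF Pi]) (auto simp: PQ m_def)
      show "real_distribution (density lborel (\<lambda>x. ennreal (Q x / m)))"
        by (rule dist[OF Qi]) (auto simp: PQ mQ)
      show "char (density lborel (\<lambda>x. ennreal (P x / m))) = char (density lborel (\<lambda>x. ennreal (Q x / m)))"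
        using char[OF Pi PQ(2)] char[OF Qi PQ(3)] eq by (intro ext) simp
    qed
    then have "AE x in lborel. ennreal (P x / m) = ennreal (Q x / m)"
      by (subst (asm) sigma_finite_measure.density_unique_iff[OF sigma_finite_lborel]) auto
    then show ?thesis
      by eventually_elim (use PQ mpos in auto)
  qed
  then have "AE t in lborel. f t = 0"
    by eventually_elim (simp add: PQ(1))
  then have "AE t in lebesgue. f t = 0"
    by (rule AE_completion)
  then show ?thesis
    using \<phi>f' by eventually_elim simp
qed

text \<open>On the imaginary axis the transform is, up to a dilation and a factor without zeros, the
Fourier transform of \<open>\<phi> t = k t * exp (- \<pi> t\<^sup>2)\<close>. Conjugation shows that the Fourier transform of
\<open>cnj \<phi>\<close> vanishes too, hence those of the real and imaginary parts.\<close>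

lemma bargmann_injective:
  assumes k: "k \<in> L2" and zero: "\<And>z. bargmann k z = 0"
  shows "AE t in lebesgue. k t = 0"
proof -
  define \<phi> where "\<phi> t = k t * of_real (exp (- pi * t\<^sup>2))" for t
  have L0: "laplace_gauss k z = 0" for z
    using zero[of z] by (simp add: bargmann_def)
  have iexp_eq: "k t * gauss_kernel t (\<i> * of_real (w / (2 * pi))) = \<phi> t * iexp (w * t)" for t w
  proof -
    have "of_real (2 * pi * t) * (\<i> * of_real (w / (2 * pi))) = \<i> * of_real (w * t)"
      by (simp add: field_simps)
    then show ?thesis
      unfolding \<phi>_def exp_add exp_of_real[symmetric] by (simp only: mult.assoc)
  qed
  have int: "integrable lebesgue (\<lambda>t. \<phi> t * iexp (w * t))" for w
    using laplace_gauss_integrable[OF k, of "\<i> * of_real (w / (2 * pi))"] unfolding iexp_eq .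
  have F0: "(LINT t|lebesgue. \<phi> t * iexp (w * t)) = 0" for w
    using L0[of "\<i> * of_real (w / (2 * pi))"] unfolding laplace_gauss_def iexp_eq .
  have cnj_eq: "cnj (\<phi> t * iexp (- w * t)) = cnj (\<phi> t) * iexp (w * t)" for t w
    by (simp add: exp_cnj)
  have intc: "integrable lebesgue (\<lambda>t. cnj (\<phi> t) * iexp (w * t))" for w
    using int[of "- w"] unfolding cnj_eq[symmetric] by (simp only: integrable_cnj)
  have F0c: "(LINT t|lebesgue. cnj (\<phi> t) * iexp (w * t)) = 0" for w
    using F0[of "- w"] unfolding cnj_eq[symmetric] by (simp only: Bochner_Integration.integral_cnj complex_cnj_zero)
  have \<phi>i: "integrable lebesgue \<phi>"
    using int[of 0] by simp
  have re: "complex_of_real (Re z) * e = (z * e + cnj z * e) / 2" for z e :: complex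
    by (simp add: complex_eq_iff algebra_simps)
  have im: "complex_of_real (Im z) * e = (z * e - cnj z * e) / (2 * \<i>)" for z e :: complex
  proof -
    have "z - cnj z = 2 * \<i> * of_real (Im z)"
      by (simp add: complex_eq_iff)
    then show ?thesis
      by (simp add: left_diff_distrib[symmetric])
  qed
  have "AE t in lebesgue. Re (\<phi> t) = 0"
  proof (rule fourier_injective_real)
    show "integrable lebesgue (\<lambda>t. Re (\<phi> t))"
      using \<phi>i by (rule integrable_Re)
    show "(LINT t|lebesgue. of_real (Re (\<phi> t)) * iexp (w * t)) = 0" for w
      unfolding re using int[of w] intc[of w] F0[of w] F0c[of w] by simp
  qed
  moreover have "AE t in lebesgue. Im (\<phi> t) = 0"
  proof (rule fourier_injective_real)
    show "integrable lebesgue (\<lambda>t. Im (\<phi> t))"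
      using \<phi>i by (rule integrable_Im)
    show "(LINT t|lebesgue. of_real (Im (\<phi> t)) * iexp (w * t)) = 0" for w
      unfolding im using int[of w] intc[of w] F0[of w] F0c[of w] by simp
  qed
  ultimately show ?thesis
    by eventually_elim (auto simp: \<phi>_def complex_eq_iff)
qed

lemma L2_diff_scaled:
  assumes "g \<in> L2" "h \<in> L2"
  shows "(\<lambda>t. g t - c * h t) \<in> L2"
proof -
  have m: "(\<lambda>t. g t - c * h t) \<in> borel_measurable lebesgue"
    using assms[THEN L2_measurable] by measurable
  have "integrable lebesgue (\<lambda>t. 2 * (cmod (g t))\<^sup>2 + 2 * (cmod c)\<^sup>2 * (cmod (h t))\<^sup>2)"
    using assms by (intro Bochner_Integration.integrable_add integrable_mult_right) (auto simp: L2_def)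
  then have "integrable lebesgue (\<lambda>t. (cmod (g t - c * h t))\<^sup>2)"
  proof (rule Bochner_Integration.integrable_bound)
    show "(\<lambda>t. (cmod (g t - c * h t))\<^sup>2) \<in> borel_measurable lebesgue"
      using m by measurable
    have "(cmod (g t - c * h t))\<^sup>2 \<le> 2 * (cmod (g t))\<^sup>2 + 2 * (cmod c)\<^sup>2 * (cmod (h t))\<^sup>2" for t
    proof -
      have "(cmod (g t - c * h t))\<^sup>2 \<le> (cmod (g t) + cmod c * cmod (h t))\<^sup>2"
        using norm_triangle_ineq4[of "g t" "c * h t"] by (intro power_mono) (auto simp: norm_mult)
      also have "\<dots> \<le> 2 * (cmod (g t))\<^sup>2 + 2 * (cmod c * cmod (h t))\<^sup>2"
        using zero_le_power2[of "cmod (g t) - cmod c * cmod (h t)"] by (simp add: power2_eq_square algebra_simps)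
      finally show ?thesis by (simp add: power_mult_distrib)
    qed
    then show "AE t in lebesgue. norm ((cmod (g t - c * h t))\<^sup>2) \<le> norm (2 * (cmod (g t))\<^sup>2 + 2 * (cmod c)\<^sup>2 * (cmod (h t))\<^sup>2)"
      by (intro AE_I2) simp
  qed
  then show ?thesis
    using m by (simp add: L2_def)
qed

lemma bargmann_diff_scaled:
  assumes "g \<in> L2" "h \<in> L2"
  shows "bargmann (\<lambda>t. g t - c * h t) z = bargmann g z - c * bargmann h z"
proof -
  let ?e = "\<lambda>t. gauss_kernel t z"
  have "laplace_gauss (\<lambda>t. g t - c * h t) z = (LINT t|lebesgue. g t * ?e t - c * (h t * ?e t))"
    unfolding laplace_gauss_def by (intro Bochner_Integration.integral_cong) (auto simp: algebra_simps)
  also have "\<dots> = laplace_gauss g z - c * laplace_gauss h z"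
    unfolding laplace_gauss_def
    using laplace_gauss_integrable[OF assms(1), of z] laplace_gauss_integrable[OF assms(2), of z]
    by (simp only: Bochner_Integration.integral_diff integral_mult_right_zero integrable_mult_right)
  finally have L: "laplace_gauss (\<lambda>t. g t - c * h t) z = laplace_gauss g z - c * laplace_gauss h z" .
  show ?thesis
    unfolding bargmann_def L by (simp add: algebra_simps)
qed

section \<open>Uniqueness of Gabor phase retrieval from triangles\<close>

definition plane_to_complex :: "real^2 \<Rightarrow> complex" where
  "plane_to_complex u = Complex (u $ 1) (u $ 2)"

text \<open>The Gabor transform lives at \<open>x - i \<omega>\<close>; for real-valued \<open>g\<close> the modulus is the same at \<open>x + i \<omega>\<close>.\<close>

lemma norm_gabor_even_real:
  assumes "g \<in> L2_even_real"
  shows "norm (gabor g u) = exp (- (pi / 2) * (cmod (plane_to_complex u))\<^sup>2) * cmod (bargmann g (plane_to_complex u))"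
proof -
  have g: "g \<in> L2" "AE t in lebesgue. g t \<in> \<real>"
    using assms by (auto simp: L2_even_real_def)
  have "Complex (u $ 1) (- u $ 2) = cnj (plane_to_complex u)"
    by (simp add: plane_to_complex_def complex_eq_iff)
  then show ?thesis
    using norm_gabor_eq_bargmann[of g u] bargmann_cnj[OF g, of "plane_to_complex u"] by simp
qed

text \<open>For even real-valued \<open>g\<close> the modulus of the Bargmann transform is invariant under \<open>z \<mapsto> cnj z\<close>
and \<open>z \<mapsto> - z\<close>. So the three sample points may be spread over the discs around \<open>l\<close>, \<open>cnj l\<close> and \<open>- l\<close>:
reflected into the disc around \<open>l\<close>, they form the triangle that \<open>entire_phase_retrieval\<close> needs.\<close>

theorem gabor_uniqueness_of_triangles:
  fixes a b \<gamma> :: real and U :: "(real^2) set"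
  assumes ab: "a > 0" "b > 0" "2 * a * b < 1" and \<gamma>: "2 * pi \<le> \<gamma>" and E: "finite E"
    and triangle: "\<And>k l r. k \<notin> E \<Longrightarrow> fst k \<noteq> 0 \<Longrightarrow> snd k \<noteq> 0 \<Longrightarrow>
      l = lattice_point a b k \<Longrightarrow> r = exp (- (\<gamma> * (cmod l)\<^sup>2)) \<Longrightarrow>
      \<exists>u\<in>U. \<exists>v\<in>U. \<exists>w\<in>U. \<exists>p q s. p = plane_to_complex u \<and> q = cnj (plane_to_complex v) \<and> s = - plane_to_complex w \<and>
        cmod (p - l) \<le> r \<and> cmod (q - l) \<le> r \<and> cmod (s - l) \<le> r \<and>
        exp (- (cmod l)\<^sup>2) * r\<^sup>2 \<le> \<bar>Im (cnj (q - p) * (s - p))\<bar>"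
  shows "gabor_uniqueness_set U L2_even_real"
  unfolding gabor_uniqueness_set_def
proof (intro ballI impI)
  fix g h assume gh: "g \<in> L2_even_real" "h \<in> L2_even_real"
    and same: "\<forall>u\<in>U. norm (gabor g u) = norm (gabor h u)"
  have g: "g \<in> L2" "AE t in lebesgue. g t \<in> \<real>" "AE t in lebesgue. g (- t) = g t"
    and h: "h \<in> L2" "AE t in lebesgue. h t \<in> \<real>" "AE t in lebesgue. h (- t) = h t"
    using gh by (auto simp: L2_even_real_def)
  have eq: "cmod (bargmann g (plane_to_complex u)) = cmod (bargmann h (plane_to_complex u))" if "u \<in> U" for u
    using same that unfolding norm_gabor_even_real[OF gh(1)] norm_gabor_even_real[OF gh(2)] by simp
  obtain c where c: "cmod c = 1" "\<And>z. bargmann g z = c * bargmann h z"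
  proof (rule entire_phase_retrieval[OF ab \<gamma> bargmann_holomorphic[OF g(1)] bargmann_growth[OF g(1)]
        bargmann_holomorphic[OF h(1)] bargmann_growth[OF h(1)] E])
    fix k :: "int \<times> int" and l r
    assume k: "k \<notin> E" "fst k \<noteq> 0" "snd k \<noteq> 0" "l = lattice_point a b k" "r = exp (- (\<gamma> * (cmod l)\<^sup>2))"
    then obtain u v w p q s where uvw: "u \<in> U" "v \<in> U" "w \<in> U"
      and pqs: "p = plane_to_complex u" "q = cnj (plane_to_complex v)" "s = - plane_to_complex w"
      and near: "cmod (p - l) \<le> r" "cmod (q - l) \<le> r" "cmod (s - l) \<le> r"
        "exp (- (cmod l)\<^sup>2) * r\<^sup>2 \<le> \<bar>Im (cnj (q - p) * (s - p))\<bar>"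
      using triangle[OF k] by metis
    have "cmod (bargmann g p) = cmod (bargmann h p)"
      unfolding pqs using eq[OF uvw(1)] .
    moreover have "cmod (bargmann g q) = cmod (bargmann h q)"
      unfolding pqs bargmann_cnj[OF g(1,2)] bargmann_cnj[OF h(1,2)] using eq[OF uvw(2)] by simp
    moreover have "cmod (bargmann g s) = cmod (bargmann h s)"
      unfolding pqs bargmann_even[OF g(1,3)] bargmann_even[OF h(1,3)] using eq[OF uvw(3)] .
    ultimately show "\<exists>p q s. cmod (p - l) \<le> r \<and> cmod (q - l) \<le> r \<and> cmod (s - l) \<le> r \<and>
        cmod (bargmann g p) = cmod (bargmann h p) \<and> cmod (bargmann g q) = cmod (bargmann h q) \<and>
        cmod (bargmann g s) = cmod (bargmann h s) \<and>
        exp (- (cmod l)\<^sup>2) * r\<^sup>2 \<le> \<bar>Im (cnj (q - p) * (s - p))\<bar>"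
      using near by blast
  qed blast
  have "AE t in lebesgue. g t - c * h t = 0"
  proof (rule bargmann_injective)
    show "(\<lambda>t. g t - c * h t) \<in> L2"
      by (rule L2_diff_scaled[OF g(1) h(1)])
    show "bargmann (\<lambda>t. g t - c * h t) z = 0" for z
      unfolding bargmann_diff_scaled[OF g(1) h(1)] c(2) by simp
  qed
  then have "AE t in lebesgue. g t = c * h t"
    by eventually_elim simp
  then show "\<exists>\<tau>. cmod \<tau> = 1 \<and> (AE t in lebesgue. g t = \<tau> * h t)"
    using c(1) by blast
qed

section \<open>Three random points rarely form a thin triangle\<close>

text \<open>A linear map of determinant \<open>\<plusminus> \<beta>\<close> sends the intersection into a box with sides \<open>2 r\<close> and \<open>2 w\<close>.\<close>

lemma measure_cball_strip_le:
  fixes l :: "real^2" and i j :: 2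
  assumes ij: "i \<noteq> j" and \<beta>: "\<beta> \<noteq> 0" and r: "0 \<le> r" and w: "0 \<le> w"
  shows "measure lebesgue (cball l r \<inter> {v. \<bar>\<alpha> * v $ i + \<beta> * v $ j - c\<bar> \<le> w}) \<le> 4 * r * w / \<bar>\<beta>\<bar>"
proof -
  define S where "S = cball l r \<inter> {v. \<bar>\<alpha> * v $ i + \<beta> * v $ j - c\<bar> \<le> w}"
  define A :: "real^2^2" where "A = (\<chi> m n. if m = i then (if n = i then 1 else 0) else (if n = i then \<alpha> else \<beta>))"
  define lo hi :: "real^2" where "lo = (\<chi> m. if m = i then l $ i - r else c - w)" and "hi = (\<chi> m. if m = i then l $ i + r else c + w)"
  have ij_cases: "(i = 1 \<and> j = 2) \<or> (i = 2 \<and> j = 1)"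
    using ij exhaust_2[of i] exhaust_2[of j] by auto
  have det: "\<bar>det A\<bar> = \<bar>\<beta>\<bar>"
    using ij_cases by (auto simp: det_2 A_def)
  have Av: "(A *v v) $ m = (if m = i then v $ i else \<alpha> * v $ i + \<beta> * v $ j)" for v m
    using ij_cases exhaust_2[of m] by (auto simp: A_def matrix_vector_mult_def sum_2)
  have "closed {v::real^2. \<bar>\<alpha> * v $ i + \<beta> * v $ j - c\<bar> \<le> w}"
    by (intro closed_Collect_le continuous_intros)
  then have "compact S"
    unfolding S_def by (intro compact_Int_closed compact_cball)
  then have S: "S \<in> lmeasurable"
    by (rule lmeasurable_compact)
  have "(*v) A ` S \<subseteq> cbox lo hi"
  proof
    fix u assume "u \<in> (*v) A ` S"
    then obtain v where v: "v \<in> S" "u = A *v v" by blast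
    have "\<bar>(v - l) $ i\<bar> \<le> norm (v - l)"
      by (rule component_le_norm_cart)
    then have "\<bar>v $ i - l $ i\<bar> \<le> r"
      using v(1) by (simp add: S_def dist_norm norm_minus_commute)
    moreover have "\<bar>\<alpha> * v $ i + \<beta> * v $ j - c\<bar> \<le> w"
      using v(1) by (simp add: S_def)
    ultimately have "\<bar>u $ m - (if m = i then l $ i else c)\<bar> \<le> (if m = i then r else w)" for m
      unfolding v(2) Av by simp
    then have "lo $ m \<le> u $ m \<and> u $ m \<le> hi $ m" for m
      unfolding lo_def hi_def by (auto simp: abs_le_iff dest: spec[of _ m]) (smt (verit))+
    then show "u \<in> cbox lo hi"
      by (simp add: mem_box_cart)
  qed
  moreover have "(*v) A ` S \<in> lmeasurable"
    using S by (intro measurable_linear_image) auto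
  ultimately have "measure lebesgue ((*v) A ` S) \<le> measure lebesgue (cbox lo hi)"
    by (intro measure_mono_fmeasurable) auto
  also have "measure lebesgue (cbox lo hi) = (2 * r) * (2 * w)"
  proof -
    have le: "lo $ m \<le> hi $ m" for m
      using r w by (simp add: lo_def hi_def)
    then have "cbox lo hi \<noteq> {}"
      by (auto simp: interval_eq_empty_cart not_less)
    then have "measure lebesgue (cbox lo hi) = (\<Prod>m\<in>UNIV. hi $ m - lo $ m)"
      by (simp add: content_cbox_cart)
    also have "\<dots> = (2 * r) * (2 * w)"
      using ij_cases by (auto simp: UNIV_2 lo_def hi_def)
    finally show ?thesis .
  qed
  also have "measure lebesgue ((*v) A ` S) = \<bar>\<beta>\<bar> * measure lebesgue S"
    using measure_linear_image[of "(*v) A" S] S det by simp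
  finally show ?thesis
    using \<beta> unfolding S_def[symmetric] by (simp add: field_simps)
qed

lemma uniform_cball_strip_le:
  fixes l :: "real^2" and i j :: 2
  assumes ij: "i \<noteq> j" and \<beta>: "\<beta> \<noteq> 0" and r: "0 < r" and w: "0 \<le> w"
  shows "emeasure (uniform_measure lborel (cball l r)) {v. \<bar>\<alpha> * v $ i + \<beta> * v $ j - c\<bar> \<le> w} \<le> ennreal (2 * w / (r * \<bar>\<beta>\<bar>))"
proof -
  let ?S = "{v::real^2. \<bar>\<alpha> * v $ i + \<beta> * v $ j - c\<bar> \<le> w}"
  have cl: "closed ?S"
    by (intro closed_Collect_le continuous_intros)
  have bs: "?S \<in> sets borel" "cball l r \<in> sets borel" "cball l r \<inter> ?S \<in> sets borel"
    using cl by (auto intro: borel_closed)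
  have ball: "emeasure lborel (cball l r) = ennreal (pi * r\<^sup>2)"
    using r by (simp add: emeasure_cball unit_ball_vol_2)
  have fin: "emeasure lborel (cball l r \<inter> ?S) < \<infinity>"
    using emeasure_mono[of "cball l r \<inter> ?S" "cball l r" lborel] bs ball by (simp add: order_le_less_trans[OF _ ennreal_less_top])
  have "emeasure lborel (cball l r \<inter> ?S) = ennreal (measure lborel (cball l r \<inter> ?S))"
    using fin by (intro emeasure_eq_ennreal_measure) auto
  also have "measure lborel (cball l r \<inter> ?S) = measure lebesgue (cball l r \<inter> ?S)"
    using bs by (simp add: measure_completion)
  also have "ennreal \<dots> \<le> ennreal (4 * r * w / \<bar>\<beta>\<bar>)"
    using measure_cball_strip_le[OF ij \<beta> _ w, of r l \<alpha> c] r by (intro ennreal_leI) auto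
  finally have num: "emeasure lborel (cball l r \<inter> ?S) \<le> ennreal (4 * r * w / \<bar>\<beta>\<bar>)" .
  have "emeasure (uniform_measure lborel (cball l r)) ?S = emeasure lborel (cball l r \<inter> ?S) / emeasure lborel (cball l r)"
    using bs by (intro emeasure_uniform_measure) auto
  also have "\<dots> \<le> ennreal (4 * r * w / \<bar>\<beta>\<bar>) / ennreal (pi * r\<^sup>2)"
    unfolding ball by (intro divide_right_mono_ennreal num)
  also have "\<dots> = ennreal (4 * r * w / \<bar>\<beta>\<bar> / (pi * r\<^sup>2))"
    using r w by (intro divide_ennreal) auto
  also have "\<dots> \<le> ennreal (2 * w / (r * \<bar>\<beta>\<bar>))"
  proof (rule ennreal_leI)
    have "4 * r * w / \<bar>\<beta>\<bar> / (pi * r\<^sup>2) = (2 * w / (r * \<bar>\<beta>\<bar>)) * (2 / pi)"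
      using r by (simp add: field_simps power2_eq_square)
    also have "\<dots> \<le> (2 * w / (r * \<bar>\<beta>\<bar>)) * 1"
      using r w pi_gt3 by (intro mult_left_mono) auto
    finally show "4 * r * w / \<bar>\<beta>\<bar> / (pi * r\<^sup>2) \<le> 2 * w / (r * \<bar>\<beta>\<bar>)" by simp
  qed
  finally show ?thesis .
qed

text \<open>Fubini's theorem for the joint distribution, which is a product measure.\<close>

lemma (in prob_space) indep_var_section_bound:
  assumes ind: "indep_var S X T Y" and A: "A \<in> sets (S \<Otimes>\<^sub>M T)"
    and sec: "\<And>x. x \<in> space S \<Longrightarrow> emeasure (distr M T Y) (Pair x -` A) \<le> e"
  shows "emeasure M {\<omega>\<in>space M. (X \<omega>, Y \<omega>) \<in> A} \<le> e"
proof -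
  have X: "X \<in> measurable M S" and Y: "Y \<in> measurable M T"
    and eq: "distr M S X \<Otimes>\<^sub>M distr M T Y = distr M (S \<Otimes>\<^sub>M T) (\<lambda>\<omega>. (X \<omega>, Y \<omega>))"
    using ind by (auto simp: indep_var_distribution_eq)
  interpret Y: prob_space "distr M T Y"
    using Y by (rule prob_space_distr)
  interpret X: prob_space "distr M S X"
    using X by (rule prob_space_distr)
  have "emeasure M {\<omega>\<in>space M. (X \<omega>, Y \<omega>) \<in> A} = emeasure (distr M (S \<Otimes>\<^sub>M T) (\<lambda>\<omega>. (X \<omega>, Y \<omega>))) A"
    using X Y A by (subst emeasure_distr) (auto intro!: arg_cong[where f="emeasure M"])
  also have "\<dots> = (\<integral>\<^sup>+x. emeasure (distr M T Y) (Pair x -` A) \<partial>distr M S X)"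
    unfolding eq[symmetric] using A by (intro Y.emeasure_pair_measure_alt) simp
  also have "\<dots> \<le> (\<integral>\<^sup>+x. e \<partial>distr M S X)"
    using sec by (intro nn_integral_mono) simp
  also have "\<dots> = e"
    using X.emeasure_space_1 by simp
  finally show ?thesis .
qed

lemma borel_measurable_vec_nth [measurable]: "(\<lambda>v::real^2. v $ i) \<in> borel_measurable borel"
  by (intro borel_measurable_continuous_onI continuous_intros)

text \<open>Twice the signed area of the triangle with the vertices \<open>u\<close>, \<open>cnj v\<close> and \<open>- w\<close>, for points of the
complex plane.\<close>

definition reflected_area :: "real^2 \<Rightarrow> real^2 \<Rightarrow> real^2 \<Rightarrow> real" where
  "reflected_area u v w = (v $ 1 - u $ 1) * (- (w $ 2) - u $ 2) - (- (v $ 2) - u $ 2) * (- (w $ 1) - u $ 1)"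

text \<open>Except with probability \<open>2 d\<close>, the first coordinates of \<open>X\<close> and \<open>Y\<close> differ by more than \<open>d r\<close>.
Given such \<open>X\<close> and \<open>Y\<close>, the area is an affine function of \<open>V\<close> whose slope in the second coordinate
exceeds \<open>d r\<close> in modulus, and it is small only if \<open>V\<close> lies in a narrow strip; this has probability at
most \<open>2 d\<close>. The variable \<open>V\<close> is doubled because \<^const>\<open>prob_space.indep_var\<close> relates random variables with
values in the same type.\<close>

lemma (in prob_space) degenerate_triangle_prob:
  fixes X Y V :: "'a \<Rightarrow> real^2"
  assumes ind1: "indep_var borel X borel Y"
    and ind2: "indep_var (borel \<Otimes>\<^sub>M borel) (\<lambda>\<omega>. (X \<omega>, Y \<omega>)) (borel \<Otimes>\<^sub>M borel) (\<lambda>\<omega>. (V \<omega>, V \<omega>))"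
    and Y: "distr M borel Y = uniform_measure lborel (cball y r)"
    and V: "distr M borel V = uniform_measure lborel (cball v r)"
    and r: "0 < r" and d: "0 < d"
  shows "prob {\<omega>\<in>space M. \<bar>reflected_area (X \<omega>) (Y \<omega>) (V \<omega>)\<bar> \<le> d\<^sup>2 * r\<^sup>2} \<le> 4 * d"
proof -
  have Xm[measurable]: "X \<in> borel_measurable M" and Ym[measurable]: "Y \<in> borel_measurable M"
    using indep_var_rv1[OF ind1] indep_var_rv2[OF ind1] by auto
  have VV: "(\<lambda>\<omega>. (V \<omega>, V \<omega>)) \<in> measurable M (borel \<Otimes>\<^sub>M borel)"
    using indep_var_rv2[OF ind2] .
  then have Vm[measurable]: "V \<in> borel_measurable M"
    using measurable_compose[OF VV measurable_fst] by simp
  define A where "A = {z::(real^2)\<times>(real^2). \<bar>snd z $ 1 - fst z $ 1\<bar> \<le> d * r}"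
  define B where "B = {z::((real^2)\<times>(real^2))\<times>((real^2)\<times>(real^2)). d * r < \<bar>snd (fst z) $ 1 - fst (fst z) $ 1\<bar> \<and>
      \<bar>reflected_area (fst (fst z)) (snd (fst z)) (fst (snd z))\<bar> \<le> d\<^sup>2 * r\<^sup>2}"
  have c1: "(\<lambda>z. fst z $ i) \<in> borel_measurable ((borel :: (real^2) measure) \<Otimes>\<^sub>M N)" for i :: 2 and N :: "(real^2) measure"
    by (rule measurable_compose[OF measurable_fst borel_measurable_vec_nth])
  have c2: "(\<lambda>z. snd z $ i) \<in> borel_measurable (N \<Otimes>\<^sub>M (borel :: (real^2) measure))" for i :: 2 and N :: "(real^2) measure"
    by (rule measurable_compose[OF measurable_snd borel_measurable_vec_nth])
  have [measurable]: "(\<lambda>z. fst (fst z) $ i) \<in> borel_measurable ((borel \<Otimes>\<^sub>M borel) \<Otimes>\<^sub>M (borel \<Otimes>\<^sub>M borel) :: (((real^2) \<times> (real^2)) \<times> ((real^2) \<times> (real^2))) measure)"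
      "(\<lambda>z. snd (fst z) $ i) \<in> borel_measurable ((borel \<Otimes>\<^sub>M borel) \<Otimes>\<^sub>M (borel \<Otimes>\<^sub>M borel) :: (((real^2) \<times> (real^2)) \<times> ((real^2) \<times> (real^2))) measure)"
      "(\<lambda>z. fst (snd z) $ i) \<in> borel_measurable ((borel \<Otimes>\<^sub>M borel) \<Otimes>\<^sub>M (borel \<Otimes>\<^sub>M borel) :: (((real^2) \<times> (real^2)) \<times> ((real^2) \<times> (real^2))) measure)" for i :: 2
    by (rule measurable_compose[OF measurable_fst c1] measurable_compose[OF measurable_fst c2]
        measurable_compose[OF measurable_snd c1])+
  note c1[measurable] c2[measurable]
  have Am: "A \<in> sets (borel \<Otimes>\<^sub>M borel)"
  proof -
    have "{z \<in> space (borel \<Otimes>\<^sub>M borel :: ((real^2) \<times> (real^2)) measure). \<bar>snd z $ 1 - fst z $ 1\<bar> \<le> d * r} \<in> sets (borel \<Otimes>\<^sub>M (borel :: (real^2) measure))"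
      by measurable
    then show ?thesis
      by (simp add: A_def space_pair_measure)
  qed
  have Bm: "B \<in> sets ((borel \<Otimes>\<^sub>M borel) \<Otimes>\<^sub>M (borel \<Otimes>\<^sub>M borel))"
  proof -
    have "{z \<in> space ((borel \<Otimes>\<^sub>M borel) \<Otimes>\<^sub>M (borel \<Otimes>\<^sub>M borel) :: (((real^2) \<times> (real^2)) \<times> ((real^2) \<times> (real^2))) measure). d * r < \<bar>snd (fst z) $ 1 - fst (fst z) $ 1\<bar> \<and>
      \<bar>reflected_area (fst (fst z)) (snd (fst z)) (fst (snd z))\<bar> \<le> d\<^sup>2 * r\<^sup>2} \<in> sets ((borel \<Otimes>\<^sub>M borel) \<Otimes>\<^sub>M (borel \<Otimes>\<^sub>M (borel :: (real^2) measure)))"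
      unfolding reflected_area_def by measurable
    then show ?thesis
      by (simp add: B_def space_pair_measure)
  qed
  have PA: "emeasure M {\<omega>\<in>space M. (X \<omega>, Y \<omega>) \<in> A} \<le> ennreal (2 * d)"
  proof (rule indep_var_section_bound[OF ind1 Am])
    fix x :: "real^2"
    have "Pair x -` A = {v. \<bar>0 * v $ 2 + 1 * v $ 1 - x $ 1\<bar> \<le> d * r}"
      by (auto simp: A_def)
    then show "emeasure (distr M borel Y) (Pair x -` A) \<le> ennreal (2 * d)"
      using uniform_cball_strip_le[of 2 1 1 r "d * r" y 0 "x $ 1"] r d unfolding Y by simp
  qed
  have PB: "emeasure M {\<omega>\<in>space M. ((X \<omega>, Y \<omega>), (V \<omega>, V \<omega>)) \<in> B} \<le> ennreal (2 * d)"
  proof (rule indep_var_section_bound[OF ind2 Bm])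
    fix x :: "(real^2) \<times> (real^2)"
    obtain p q where x: "x = (p, q)" by (cases x)
    define \<beta> where "\<beta> = - (q $ 1 - p $ 1)"
    define \<alpha> where "\<alpha> = - (q $ 2 + p $ 2)"
    define c where "c = (q $ 1 - p $ 1) * p $ 2 + (q $ 2 + p $ 2) * p $ 1"
    show "emeasure (distr M (borel \<Otimes>\<^sub>M borel) (\<lambda>\<omega>. (V \<omega>, V \<omega>))) (Pair x -` B) \<le> ennreal (2 * d)"
    proof (cases "d * r < \<bar>q $ 1 - p $ 1\<bar>")
      case False
      then have "Pair x -` B = {}"
        by (auto simp: B_def x)
      then show ?thesis by simp
    next
      case True
      have area: "reflected_area p q w = \<alpha> * w $ 1 + \<beta> * w $ 2 - c" for w
        by (simp add: reflected_area_def \<alpha>_def \<beta>_def c_def algebra_simps)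
      have \<beta>: "d * r < \<bar>\<beta>\<bar>" "\<beta> \<noteq> 0"
        using True mult_pos_pos[OF d r] by (auto simp: \<beta>_def abs_minus_commute)
      let ?C = "{w::real^2. \<bar>\<alpha> * w $ 1 + \<beta> * w $ 2 - c\<bar> \<le> d\<^sup>2 * r\<^sup>2}"
      have Cm: "?C \<in> sets borel"
        by measurable
      have "Pair x -` B = {w. fst w \<in> ?C}"
        using True by (auto simp: B_def x area)
      moreover have "Pair x -` B \<in> sets (borel \<Otimes>\<^sub>M borel)"
        using Bm by (rule sets_Pair1)
      ultimately have "emeasure (distr M (borel \<Otimes>\<^sub>M borel) (\<lambda>\<omega>. (V \<omega>, V \<omega>))) (Pair x -` B) = emeasure (distr M borel V) ?C"
        using VV Vm Cm by (simp add: emeasure_distr vimage_def)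
      also have "emeasure (distr M borel V) ?C \<le> ennreal (2 * (d\<^sup>2 * r\<^sup>2) / (r * \<bar>\<beta>\<bar>))"
        using uniform_cball_strip_le[of 1 2 \<beta> r "d\<^sup>2 * r\<^sup>2" v \<alpha> c] r \<beta> unfolding V by simp
      also have "\<dots> \<le> ennreal (2 * d)"
      proof (rule ennreal_leI)
        have "2 * (d\<^sup>2 * r\<^sup>2) / (r * \<bar>\<beta>\<bar>) \<le> 2 * (d\<^sup>2 * r\<^sup>2) / (r * (d * r))"
          using \<beta> r d by (intro divide_left_mono mult_left_mono) auto
        also have "\<dots> = 2 * d"
          using r d by (simp add: power2_eq_square)
        finally show "2 * (d\<^sup>2 * r\<^sup>2) / (r * \<bar>\<beta>\<bar>) \<le> 2 * d" .
      qed
      finally show ?thesis .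
    qed
  qed
  have sA: "{\<omega>\<in>space M. (X \<omega>, Y \<omega>) \<in> A} \<in> sets M" 
    using measurable_sets[OF measurable_Pair[OF Xm Ym] Am] by (simp add: vimage_def Int_def conj_commute)
  have sB: "{\<omega>\<in>space M. ((X \<omega>, Y \<omega>), (V \<omega>, V \<omega>)) \<in> B} \<in> sets M" 
    using measurable_sets[OF measurable_Pair[OF measurable_Pair[OF Xm Ym] VV] Bm] by (simp add: vimage_def Int_def conj_commute)
  have "{\<omega>\<in>space M. \<bar>reflected_area (X \<omega>) (Y \<omega>) (V \<omega>)\<bar> \<le> d\<^sup>2 * r\<^sup>2} \<subseteq>
      {\<omega>\<in>space M. (X \<omega>, Y \<omega>) \<in> A} \<union> {\<omega>\<in>space M. ((X \<omega>, Y \<omega>), (V \<omega>, V \<omega>)) \<in> B}"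
    by (auto simp: A_def B_def)
  then have "prob {\<omega>\<in>space M. \<bar>reflected_area (X \<omega>) (Y \<omega>) (V \<omega>)\<bar> \<le> d\<^sup>2 * r\<^sup>2} \<le>
      prob ({\<omega>\<in>space M. (X \<omega>, Y \<omega>) \<in> A} \<union> {\<omega>\<in>space M. ((X \<omega>, Y \<omega>), (V \<omega>, V \<omega>)) \<in> B})"
    using sA sB by (intro finite_measure_mono) auto
  also have "\<dots> \<le> prob {\<omega>\<in>space M. (X \<omega>, Y \<omega>) \<in> A} + prob {\<omega>\<in>space M. ((X \<omega>, Y \<omega>), (V \<omega>, V \<omega>)) \<in> B}"
    using sA sB by (rule measure_Un_le)
  also have "\<dots> \<le> 2 * d + 2 * d"
    using PA PB d by (intro add_mono) (auto simp: emeasure_eq_measure)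
  finally show ?thesis by simp
qed

lemma (in prob_space) indep_vars_triple:
  assumes ind: "indep_vars (\<lambda>_. borel) Z I" and I: "i \<in> I" "j \<in> I" "k \<in> I" "i \<noteq> j" "i \<noteq> k" "j \<noteq> k"
  shows "indep_var borel (Z i) borel (Z j)"
    and "indep_var (borel \<Otimes>\<^sub>M borel) (\<lambda>\<omega>. (Z i \<omega>, Z j \<omega>)) (borel \<Otimes>\<^sub>M borel) (\<lambda>\<omega>. (Z k \<omega>, Z k \<omega>))"
proof -
  have "indep_var borel ((\<lambda>f. f i) \<circ> (\<lambda>\<omega>. restrict (\<lambda>l. Z l \<omega>) {i})) borel ((\<lambda>f. f j) \<circ> (\<lambda>\<omega>. restrict (\<lambda>l. Z l \<omega>) {j}))"
    using I by (intro indep_var_compose[OF indep_var_restrict[OF ind]]) auto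
  then show "indep_var borel (Z i) borel (Z j)"
    by (simp add: comp_def)
  have "indep_var (borel \<Otimes>\<^sub>M borel) ((\<lambda>f. (f i, f j)) \<circ> (\<lambda>\<omega>. restrict (\<lambda>l. Z l \<omega>) {i, j}))
      (borel \<Otimes>\<^sub>M borel) ((\<lambda>f. (f k, f k)) \<circ> (\<lambda>\<omega>. restrict (\<lambda>l. Z l \<omega>) {k}))"
    using I by (intro indep_var_compose[OF indep_var_restrict[OF ind]]) auto
  then show "indep_var (borel \<Otimes>\<^sub>M borel) (\<lambda>\<omega>. (Z i \<omega>, Z j \<omega>)) (borel \<Otimes>\<^sub>M borel) (\<lambda>\<omega>. (Z k \<omega>, Z k \<omega>))"
    by (simp add: comp_def)
qed

section \<open>Random perturbations of a grid\<close>

definition grid_point :: "real \<Rightarrow> real \<Rightarrow> int \<times> int \<Rightarrow> real^2" where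
  "grid_point a b k = vector [a * of_int (fst k), b * of_int (snd k)]"

lemma grid_point_component [simp]:
  "grid_point a b k $ 1 = a * of_int (fst k)" "grid_point a b k $ 2 = b * of_int (snd k)"
  by (simp_all add: grid_point_def)

lemma norm_plane: "norm (u::real^2) = sqrt ((u $ 1)\<^sup>2 + (u $ 2)\<^sup>2)"
  by (simp add: norm_vec_def L2_set_def sum_2)

lemma plane_to_complex_grid: "plane_to_complex (grid_point a b k) = lattice_point a b k"
  by (simp add: plane_to_complex_def lattice_point_def)

lemma norm_grid_point: "norm (grid_point a b k) = cmod (lattice_point a b k)"
  by (simp add: norm_plane lattice_point_def cmod_def)

lemma reflected_area_eq_Im:
  "Im (cnj (cnj (plane_to_complex v) - plane_to_complex u) * (- plane_to_complex w - plane_to_complex u)) = reflected_area u v w"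
  by (simp add: plane_to_complex_def reflected_area_def algebra_simps)

lemma (in prob_space) AE_mem_cball:
  fixes X :: "'a \<Rightarrow> real^2"
  assumes X: "X \<in> borel_measurable M" and d: "distr M borel X = uniform_measure lborel (cball l r)"
  shows "AE \<omega> in M. X \<omega> \<in> cball l r"
proof (rule AE_distrD[OF X])
  show "AE v in distr M borel X. v \<in> cball l r"
    unfolding d by (rule AE_uniform_measureI) auto
qed

text \<open>With \<open>d k = exp (- \<bar>l\<bar>\<^sup>2 / 2)\<close> for the lattice point \<open>l\<close> with index \<open>k\<close>, the probabilities of thin
triangles are summable over the lattice. By the Borel-Cantelli lemma only finitely many triangles
are thin, almost surely. The points \<open>l\<close>, \<open>cnj l\<close> and \<open>- l\<close> are distinct only off the axes, which is why
the axes have to be excluded.\<close>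

lemma (in prob_space) AE_gabor_uniqueness_set:
  fixes Z :: "real^2 \<Rightarrow> 'a \<Rightarrow> real^2" and a b \<gamma> :: real
  assumes ab: "a > 0" "b > 0" "2 * a * b < 1" and \<gamma>: "2 * pi \<le> \<gamma>"
    and grid: "range (grid_point a b) \<subseteq> \<Lambda>"
    and ind: "indep_vars (\<lambda>_. borel) Z \<Lambda>"
    and unif: "\<And>l. l \<in> \<Lambda> \<Longrightarrow> distr M borel (Z l) = uniform_measure lborel (cball l (exp (- \<gamma> * (norm l)\<^sup>2)))"
  shows "AE \<omega> in M. gabor_uniqueness_set {Z l \<omega> | l. l \<in> \<Lambda>} L2_even_real"
proof -
  define P where "P = grid_point a b"
  define u where "u k = Z (P k)" for k
  define v where "v k = Z (P (fst k, - snd k))" for k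
  define w where "w k = Z (P (- fst k, - snd k))" for k
  define r where "r k = exp (- (\<gamma> * (cmod (lattice_point a b k))\<^sup>2))" for k
  define d where "d k = exp (- (1 / 2 * (cmod (lattice_point a b k))\<^sup>2))" for k
  have P\<Lambda>: "P k \<in> \<Lambda>" for k
    using grid by (auto simp: P_def)
  have rv: "Z l \<in> borel_measurable M" if "l \<in> \<Lambda>" for l
    using ind that by (auto simp: indep_vars_def)
  have refl: "cmod (lattice_point a b (fst k, - snd k)) = cmod (lattice_point a b k)"
      "cmod (lattice_point a b (- fst k, - snd k)) = cmod (lattice_point a b k)" for k
    by (simp_all add: lattice_point_def cmod_def)
  have rP: "exp (- \<gamma> * (norm (P k))\<^sup>2) = r k" for k
    by (simp add: P_def norm_grid_point r_def)
  have r_refl: "r (fst k, - snd k) = r k" "r (- fst k, - snd k) = r k" for k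
    by (simp_all add: r_def refl)
  have unif_v: "distr M borel (v k) = uniform_measure lborel (cball (P (fst k, - snd k)) (r k))"
    and unif_w: "distr M borel (w k) = uniform_measure lborel (cball (P (- fst k, - snd k)) (r k))" for k
    using unif[OF P\<Lambda>, of "(fst k, - snd k)"] unif[OF P\<Lambda>, of "(- fst k, - snd k)"]
    by (simp_all only: v_def w_def rP r_refl)
  define bad where "bad k = {\<omega>\<in>space M. \<bar>reflected_area (u k \<omega>) (v k \<omega>) (w k \<omega>)\<bar> \<le> (d k)\<^sup>2 * (r k)\<^sup>2}" for k
  have Pinj: "P k = P k' \<Longrightarrow> k = k'" for k k'
    using ab by (auto simp: P_def vec_eq_iff forall_2 prod_eq_iff)
  have bad_prob: "prob (bad k) \<le> 4 * d k" if k: "fst k \<noteq> 0" "snd k \<noteq> 0" for k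
    unfolding bad_def
  proof (rule degenerate_triangle_prob)
    have ne: "P k \<noteq> P (fst k, - snd k)" "P k \<noteq> P (- fst k, - snd k)" "P (fst k, - snd k) \<noteq> P (- fst k, - snd k)"
      using k by (auto dest!: Pinj simp: prod_eq_iff)
    show "indep_var borel (u k) borel (v k)"
      unfolding u_def v_def by (rule indep_vars_triple(1)[OF ind P\<Lambda> P\<Lambda> P\<Lambda> ne])
    show "indep_var (borel \<Otimes>\<^sub>M borel) (\<lambda>\<omega>. (u k \<omega>, v k \<omega>)) (borel \<Otimes>\<^sub>M borel) (\<lambda>\<omega>. (w k \<omega>, w k \<omega>))"
      unfolding u_def v_def w_def by (rule indep_vars_triple(2)[OF ind P\<Lambda> P\<Lambda> P\<Lambda> ne])
  qed (use unif_v unif_w in \<open>auto simp: r_def d_def\<close>)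
  have bad_sets: "bad k \<in> sets M" for k
  proof -
    have [measurable]: "u k \<in> borel_measurable M" "v k \<in> borel_measurable M" "w k \<in> borel_measurable M"
      unfolding u_def v_def w_def by (rule rv[OF P\<Lambda>])+
    show ?thesis
      unfolding bad_def reflected_area_def by measurable
  qed
  obtain e :: "nat \<Rightarrow> int \<times> int" where e: "bij e"
    using bij_betw_from_nat_into[of "UNIV :: (int \<times> int) set"] infinite_UNIV_int
    by (auto simp: finite_prod)
  \<comment> \<open>On the axes the three random points are not independent, and no event is recorded.\<close>
  define A where "A n = (if fst (e n) \<noteq> 0 \<and> snd (e n) \<noteq> 0 then bad (e n) else {})" for n
  obtain B where B: "\<And>F. finite F \<Longrightarrow> (\<Sum>k\<in>F. d k) \<le> B"
    using lattice_gauss_sum_bound[OF ab(1,2), of "1 / 2"] unfolding d_def by auto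
  have "summable (\<lambda>n. d (e n))"
  proof (rule summableI_nonneg_bounded)
    show "0 \<le> d (e n)" for n
      by (simp add: d_def)
    show "(\<Sum>i<n. d (e i)) \<le> B" for n
    proof -
      have "(\<Sum>i<n. d (e i)) = (\<Sum>k\<in>e ` {..<n}. d k)"
        using e by (subst sum.reindex) (auto simp: bij_def inj_on_def)
      then show ?thesis
        using B[of "e ` {..<n}"] by simp
    qed
  qed
  then have "summable (\<lambda>n. 4 * d (e n))"
    by (rule summable_mult)
  then have sum: "summable (\<lambda>n. prob (A n))"
  proof (rule summable_comparison_test')
    show "norm (prob (A n)) \<le> 4 * d (e n)" if "n \<ge> 0" for n
      using bad_prob[of "e n"] by (auto simp: A_def) (simp_all add: d_def)
  qed
  have "AE \<omega> in M. eventually (\<lambda>n. \<omega> \<in> space M - A n) sequentially"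
    using bad_sets sum by (intro borel_cantelli_AE1) (auto simp: A_def emeasure_eq_measure)
  moreover have "AE \<omega> in M. \<forall>k. Z (P k) \<omega> \<in> cball (P k) (r k)"
    unfolding AE_all_countable
  proof
    fix k
    show "AE \<omega> in M. Z (P k) \<omega> \<in> cball (P k) (r k)"
      using unif[OF P\<Lambda>, of k] unfolding rP by (rule AE_mem_cball[OF rv[OF P\<Lambda>]])
  qed
  ultimately show ?thesis
  proof eventually_elim
    fix \<omega>
    assume ev: "eventually (\<lambda>n. \<omega> \<in> space M - A n) sequentially"
      and near: "\<forall>k. Z (P k) \<omega> \<in> cball (P k) (r k)"
    obtain N where N: "\<And>n. n \<ge> N \<Longrightarrow> \<omega> \<in> space M - A n"
      using ev unfolding eventually_sequentially by blast
    show "gabor_uniqueness_set {Z l \<omega> | l. l \<in> \<Lambda>} L2_even_real"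
    proof (rule gabor_uniqueness_of_triangles[OF ab \<gamma>])
      show "finite (e ` {..<N})" by simp
      fix k l \<rho>
      assume k: "k \<notin> e ` {..<N}" "fst k \<noteq> 0" "snd k \<noteq> 0"
        and l: "l = lattice_point a b k" and \<rho>: "\<rho> = exp (- (\<gamma> * (cmod l)\<^sup>2))"
      have \<rho>r: "\<rho> = r k"
        by (simp add: \<rho> l r_def)
      obtain n where n: "k = e n"
        using e by (metis bij_pointE)
      then have "n \<ge> N"
        using k(1) by (meson image_eqI lessThan_iff not_le)
      then have "\<omega> \<in> space M" "\<omega> \<notin> bad k"
        using N[of n] k(2,3) by (auto simp: A_def n)
      then have area: "(d k)\<^sup>2 * (r k)\<^sup>2 \<le> \<bar>reflected_area (u k \<omega>) (v k \<omega>) (w k \<omega>)\<bar>"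
        by (auto simp: bad_def)
      have d2: "(d k)\<^sup>2 = exp (- (cmod l)\<^sup>2)"
        unfolding d_def l power2_eq_square[of "exp _"] by (simp add: exp_add[symmetric])
      define p q s where "p = plane_to_complex (u k \<omega>)" and "q = cnj (plane_to_complex (v k \<omega>))"
        and "s = - plane_to_complex (w k \<omega>)"
      have close: "cmod (plane_to_complex (Z (P k) \<omega>) - lattice_point a b k) \<le> r k" for k
      proof -
        have "cmod (plane_to_complex x - plane_to_complex y) = norm (x - y)" for x y
          by (simp add: plane_to_complex_def cmod_def norm_plane)
        then show ?thesis
          using near[rule_format, of k]
          by (simp add: plane_to_complex_grid[symmetric] P_def dist_norm norm_minus_commute)
      qed
      have t1: "cmod (p - l) \<le> \<rho>"
        unfolding \<rho>r p_def u_def l by (rule close)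
      have t2: "cmod (q - l) \<le> \<rho>"
      proof -
        have "q - l = cnj (plane_to_complex (v k \<omega>) - lattice_point a b (fst k, - snd k))"
          by (simp add: q_def l lattice_point_def complex_eq_iff)
        then show ?thesis
          using close[of "(fst k, - snd k)"] by (simp only: \<rho>r v_def complex_mod_cnj r_refl)
      qed
      have t3: "cmod (s - l) \<le> \<rho>"
      proof -
        have "s - l = - (plane_to_complex (w k \<omega>) - lattice_point a b (- fst k, - snd k))"
          by (simp add: s_def l lattice_point_def complex_eq_iff)
        then show ?thesis
          using close[of "(- fst k, - snd k)"] by (simp only: \<rho>r w_def norm_minus_cancel r_refl)
      qed
      have t4: "exp (- (cmod l)\<^sup>2) * \<rho>\<^sup>2 \<le> \<bar>Im (cnj (q - p) * (s - p))\<bar>"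
        using area unfolding p_def q_def s_def reflected_area_eq_Im \<rho>r d2 .
      have mem: "u k \<omega> \<in> {Z l \<omega> | l. l \<in> \<Lambda>}" "v k \<omega> \<in> {Z l \<omega> | l. l \<in> \<Lambda>}" "w k \<omega> \<in> {Z l \<omega> | l. l \<in> \<Lambda>}"
        unfolding u_def v_def w_def using P\<Lambda> by blast+
      show "\<exists>u\<in>{Z l \<omega> | l. l \<in> \<Lambda>}. \<exists>v\<in>{Z l \<omega> | l. l \<in> \<Lambda>}. \<exists>w\<in>{Z l \<omega> | l. l \<in> \<Lambda>}. \<exists>p q s.
          p = plane_to_complex u \<and> q = cnj (plane_to_complex v) \<and> s = - plane_to_complex w \<and>
          cmod (p - l) \<le> \<rho> \<and> cmod (q - l) \<le> \<rho> \<and> cmod (s - l) \<le> \<rho> \<and>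
          exp (- (cmod l)\<^sup>2) * \<rho>\<^sup>2 \<le> \<bar>Im (cnj (q - p) * (s - p))\<bar>"
        by (rule bexI[OF bexI[OF bexI[OF _ mem(3)] mem(2)] mem(1)])
           (intro exI[of _ p] exI[of _ q] exI[of _ s] conjI p_def q_def s_def t1 t2 t3 t4)
    qed
  qed
qed

section \<open>Separation of perturbed grids\<close>

lemma grid_point_dist:
  assumes "p > 0" "q > 0" "k \<noteq> k'"
  shows "min p q \<le> norm (grid_point p q k - grid_point p q k')"
proof -
  have int: "c \<le> \<bar>c * of_int m - c * of_int m'\<bar>" if "c > 0" "m \<noteq> m'" for c :: real and m m' :: int
  proof -
    have "1 \<le> \<bar>m - m'\<bar>" using that(2) by auto
    then have "real_of_int 1 \<le> of_int \<bar>m - m'\<bar>" by (simp only: of_int_le_iff)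
    then have "c * 1 \<le> c * \<bar>real_of_int m - of_int m'\<bar>"
      using that(1) by (intro mult_left_mono) auto
    also have "\<dots> = \<bar>c * of_int m - c * of_int m'\<bar>"
      using that(1) by (simp add: abs_mult right_diff_distrib[symmetric])
    finally show ?thesis by simp
  qed
  have comp: "\<bar>(grid_point p q k - grid_point p q k') $ i\<bar> \<le> norm (grid_point p q k - grid_point p q k')" for i
    by (rule component_le_norm_cart)
  show ?thesis
  proof (cases "fst k = fst k'")
    case True
    then have "snd k \<noteq> snd k'" using assms(3) by (simp add: prod_eq_iff)
    then show ?thesis
      using int[OF assms(2)] comp[of 2] by (force simp: min_le_iff_disj)
  next
    case False
    then show ?thesis
      using int[OF assms(1)] comp[of 1] by (force simp: min_le_iff_disj)
  qed
qed

lemma finite_grid_ball: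
  assumes "p > 0" "q > 0"
  shows "finite {l \<in> range (grid_point p q). norm l \<le> R}"
proof -
  have bound: "\<bar>m\<bar> \<le> \<lceil>R / c\<rceil>" if "c > 0" "\<bar>c * of_int m\<bar> \<le> R" for c and m :: int
  proof -
    have "of_int \<bar>m\<bar> \<le> R / c"
      using that by (simp add: abs_mult field_simps)
    then show ?thesis by linarith
  qed
  have "{l \<in> range (grid_point p q). norm l \<le> R} \<subseteq>
      grid_point p q ` ({- \<lceil>R / p\<rceil>..\<lceil>R / p\<rceil>} \<times> {- \<lceil>R / q\<rceil>..\<lceil>R / q\<rceil>})"
  proof
    fix l assume "l \<in> {l \<in> range (grid_point p q). norm l \<le> R}"
    then obtain k where k: "l = grid_point p q k" "norm l \<le> R" by auto
    have "\<bar>p * of_int (fst k)\<bar> \<le> R" "\<bar>q * of_int (snd k)\<bar> \<le> R"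
      using component_le_norm_cart[of l 1] component_le_norm_cart[of l 2] k by auto
    then have "\<bar>fst k\<bar> \<le> \<lceil>R / p\<rceil>" "\<bar>snd k\<bar> \<le> \<lceil>R / q\<rceil>"
      using bound assms by auto
    then have "k \<in> {- \<lceil>R / p\<rceil>..\<lceil>R / p\<rceil>} \<times> {- \<lceil>R / q\<rceil>..\<lceil>R / q\<rceil>}"
      by (auto simp: mem_Times_iff abs_le_iff)
    then show "l \<in> grid_point p q ` ({- \<lceil>R / p\<rceil>..\<lceil>R / p\<rceil>} \<times> {- \<lceil>R / q\<rceil>..\<lceil>R / q\<rceil>})"
      using k(1) by blast
  qed
  then show ?thesis
    by (rule finite_subset) auto
qed

text \<open>Far from the origin the perturbations are at most a quarter of the distance \<open>d\<close> between grid
points. So all but finitely many pairs stay \<open>d / 2\<close> apart, and a finite set of positive distances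
has a positive minimum.\<close>

lemma separated_set_perturbed_grid:
  fixes z :: "real^2 \<Rightarrow> real^2"
  assumes pq: "p > 0" "q > 0" and sub: "\<Lambda> \<subseteq> range (grid_point p q)" and \<gamma>: "\<gamma> > 0"
    and near: "\<And>l. l \<in> \<Lambda> \<Longrightarrow> norm (z l - l) \<le> exp (- \<gamma> * (norm l)\<^sup>2)"
  shows "separated_set {z l | l. l \<in> \<Lambda>}"
proof -
  define d where "d = min p q"
  have d: "d > 0" using pq by (simp add: d_def)
  have apart: "d \<le> norm (l - l')" if ll: "l \<in> \<Lambda>" "l' \<in> \<Lambda>" "l \<noteq> l'" for l l'
  proof -
    obtain k k' where k: "l = grid_point p q k" "l' = grid_point p q k'"
      using sub ll(1,2) by (meson imageE subsetD)
    then have "k \<noteq> k'"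
      using ll(3) by auto
    then show ?thesis
      using grid_point_dist[OF pq] unfolding d_def k by simp
  qed
  have "((\<lambda>x. exp (- \<gamma> * x\<^sup>2)) \<longlongrightarrow> 0) at_top"
    using \<gamma> by real_asymp
  then have "eventually (\<lambda>x. exp (- \<gamma> * x\<^sup>2) < d / 4) at_top"
    using d by (intro order_tendstoD(2)) auto
  then obtain R where R: "\<And>x. x \<ge> R \<Longrightarrow> exp (- \<gamma> * x\<^sup>2) < d / 4"
    unfolding eventually_at_top_linorder by blast
  define K where "K = {l \<in> \<Lambda>. norm l \<le> R + 2 + d}"
  have "K \<subseteq> {l \<in> range (grid_point p q). norm l \<le> R + 2 + d}"
    using sub by (auto simp: K_def)
  then have K: "finite K"
    by (rule finite_subset) (rule finite_grid_ball[OF pq])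
  have near1: "norm (z l - l) \<le> 1" if "l \<in> \<Lambda>" for l
    using near[OF that] \<gamma> by (intro order_trans[OF near[OF that]]) auto
  have tri: "norm (l - l') \<le> norm (z l - z l') + norm (z l - l) + norm (z l' - l')" for l l'
  proof -
    have eq: "(z l - z l') - (z l - l) + (z l' - l') = l - l'" by simp
    show ?thesis
      using norm_triangle_ineq[of "(z l - z l') - (z l - l)" "z l' - l'"]
        norm_triangle_ineq4[of "z l - z l'" "z l - l"]
      unfolding eq by linarith
  qed
  have close: "l \<in> K \<and> l' \<in> K" if l: "l \<in> \<Lambda>" "l' \<in> \<Lambda>" "l \<noteq> l'" and c: "norm (z l - z l') < d / 2" for l l'
  proof -
    have le: "norm (l - l') \<le> d / 2 + 2"
      using tri[of l l'] near1[OF l(1)] near1[OF l(2)] c by linarith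
    have "norm l < R \<or> norm l' < R"
    proof (rule ccontr)
      assume "\<not> ?thesis"
      then have "norm (z l - l) < d / 4" "norm (z l' - l') < d / 4"
        using R near l by (meson le_less_trans not_le)+
      then show False
        using tri[of l l'] apart[OF l] c by linarith
    qed
    then show ?thesis
      using l(1,2) le d norm_triangle_ineq2[of l l'] norm_triangle_ineq3[of l l'] unfolding K_def by (auto simp: abs_le_iff)
  qed
  define F where "F = {x \<in> (\<lambda>(l, l'). norm (z l - z l')) ` (K \<times> K). 0 < x}"
  have F: "finite F" using K by (simp add: F_def)
  define \<epsilon> where "\<epsilon> = Min (insert (d / 2) F)"
  have \<epsilon>: "\<epsilon> > 0"
    unfolding \<epsilon>_def using F d by (subst Min_gr_iff) (auto simp: F_def)
  have "ereal \<epsilon> \<le> Inf {ereal (norm (u - u')) | u u'. u \<in> {z l | l. l \<in> \<Lambda>} \<and> u' \<in> {z l | l. l \<in> \<Lambda>} \<and> u \<noteq> u'}"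
  proof (rule Inf_greatest)
    fix x assume "x \<in> {ereal (norm (u - u')) | u u'. u \<in> {z l | l. l \<in> \<Lambda>} \<and> u' \<in> {z l | l. l \<in> \<Lambda>} \<and> u \<noteq> u'}"
    then obtain l l' where l: "l \<in> \<Lambda>" "l' \<in> \<Lambda>" "z l \<noteq> z l'" and x: "x = ereal (norm (z l - z l'))"
      by auto
    have "\<epsilon> \<le> norm (z l - z l')"
    proof (cases "norm (z l - z l') < d / 2")
      case True
      have "l \<noteq> l'" using l(3) by auto
      then have "l \<in> K" "l' \<in> K"
        using close[OF l(1,2) _ True] by auto
      then have "norm (z l - z l') \<in> F"
        using l(3) unfolding F_def by (auto intro!: image_eqI[of _ _ "(l, l')"])
      then show ?thesis
        unfolding \<epsilon>_def using F by (intro Min_le) auto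
    next
      case False
      have "\<epsilon> \<le> d / 2"
        unfolding \<epsilon>_def using F by (intro Min_le) auto
      then show ?thesis using False by linarith
    qed
    then show "ereal \<epsilon> \<le> x"
      by (simp add: x)
  qed
  note inf = this
  have "0 < ereal \<epsilon>"
    using \<epsilon> by simp
  then show ?thesis
    unfolding separated_set_def using inf by (rule less_le_trans)
qed

section \<open>Lattices of high density\<close>

text \<open>A rhombic lattice of density \<open>D\<close> contains a rectangular lattice of density \<open>D / 2\<close>, with the
periods \<open>2 \<bar>p\<bar>\<close> and \<open>2 \<bar>q\<bar>\<close>. The condition \<open>2 a b < 1\<close> asks for density greater than 2, so \<open>D > 4\<close>
suffices in both cases.\<close>

lemma dense_rect_lattice_between_grids:
  assumes "\<Lambda> \<in> rect_lattices" "lattice_density \<Lambda> > 4"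
  obtains a b p q where "a > 0" "b > 0" "2 * a * b < 1" "p > 0" "q > 0"
    "range (grid_point a b) \<subseteq> \<Lambda>" "\<Lambda> \<subseteq> range (grid_point p q)"
proof -
  have abs_int: "\<exists>n::int. \<bar>c\<bar> * of_int m = c * of_int n \<and> c * of_int m = \<bar>c\<bar> * of_int n" for c :: real and m :: int
    by (cases "c \<ge> 0") (auto intro: exI[of _ m] exI[of _ "- m"])
  consider (rect) p q where "\<Lambda> = lattice_of (vector [vector [p, 0], vector [0, q]])" "p \<noteq> 0" "q \<noteq> 0"
    | (rhombic) p q where "\<Lambda> = lattice_of (vector [vector [p, p], vector [q, -q]])" "p \<noteq> 0" "q \<noteq> 0"
    using assms(1) unfolding rect_lattices_def by blast
  then show thesis
  proof cases
    case rect
    let ?A = "vector [vector [p, 0], vector [0, q]] :: real^2^2"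
    have det: "det ?A = p * q"
      by (simp add: det_2)
    have density: "lattice_density \<Lambda> = 1 / \<bar>p * q\<bar>"
      using rect by (simp add: lattice_density_def period_area_lattice_of invertible_det_nz det)
    then have "4 * \<bar>p * q\<bar> < 1"
      using assms(2) rect(2,3) unfolding density by (simp add: field_simps)
    then have area: "2 * \<bar>p\<bar> * \<bar>q\<bar> < 1"
      by (simp add: abs_mult)
    have mul: "(?A *v z) $ 1 = p * z $ 1" "(?A *v z) $ 2 = q * z $ 2" for z
      by (simp_all add: matrix_vector_mult_def sum_2)
    have "grid_point \<bar>p\<bar> \<bar>q\<bar> k \<in> \<Lambda>" for k
    proof -
      obtain m n :: int where "\<bar>p\<bar> * of_int (fst k) = p * of_int m" "\<bar>q\<bar> * of_int (snd k) = q * of_int n"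
        using abs_int by metis
      then have "grid_point \<bar>p\<bar> \<bar>q\<bar> k = ?A *v vector [of_int m, of_int n]"
        by (simp add: vec_eq_iff forall_2 mul)
      moreover have "\<forall>i. (vector [of_int m, of_int n] :: real^2) $ i \<in> \<int>"
        by (simp add: forall_2)
      ultimately show ?thesis
        unfolding rect(1) lattice_of_def by blast
    qed
    moreover have "l \<in> range (grid_point \<bar>p\<bar> \<bar>q\<bar>)" if l: "l \<in> \<Lambda>" for l
    proof -
      obtain z where z: "l = ?A *v z" "\<forall>i. z $ i \<in> \<int>"
        using l unfolding rect(1) lattice_of_def by blast
      obtain m n :: int where mn: "z $ 1 = of_int m" "z $ 2 = of_int n"
        using z(2) by (metis Ints_cases)
      obtain m' n' :: int where "p * of_int m = \<bar>p\<bar> * of_int m'" "q * of_int n = \<bar>q\<bar> * of_int n'"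
        using abs_int by metis
      then have "l = grid_point \<bar>p\<bar> \<bar>q\<bar> (m', n')"
        by (simp add: vec_eq_iff forall_2 z(1) mul mn)
      then show ?thesis by blast
    qed
    ultimately have sub: "range (grid_point \<bar>p\<bar> \<bar>q\<bar>) \<subseteq> \<Lambda>" "\<Lambda> \<subseteq> range (grid_point \<bar>p\<bar> \<bar>q\<bar>)"
      by blast+
    show thesis
      by (rule that[OF _ _ area _ _ sub]) (use rect in auto)
  next
    case rhombic
    let ?A = "vector [vector [p, p], vector [q, -q]] :: real^2^2"
    have det: "det ?A = - (2 * (p * q))"
      by (simp add: det_2)
    have density: "lattice_density \<Lambda> = 1 / \<bar>2 * (p * q)\<bar>"
      using rhombic by (simp add: lattice_density_def period_area_lattice_of invertible_det_nz det)
    then have "4 * \<bar>2 * (p * q)\<bar> < 1"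
      using assms(2) rhombic(2,3) unfolding density by (simp add: field_simps)
    then have area: "2 * (2 * \<bar>p\<bar>) * (2 * \<bar>q\<bar>) < 1"
      by (simp add: abs_mult)
    have mul: "(?A *v z) $ 1 = p * (z $ 1 + z $ 2)" "(?A *v z) $ 2 = q * (z $ 1 - z $ 2)" for z
      by (simp_all add: matrix_vector_mult_def sum_2 algebra_simps)
    have "grid_point (2 * \<bar>p\<bar>) (2 * \<bar>q\<bar>) k \<in> \<Lambda>" for k
    proof -
      obtain m n :: int where "\<bar>p\<bar> * of_int (fst k) = p * of_int m" "\<bar>q\<bar> * of_int (snd k) = q * of_int n"
        using abs_int by metis
      then have "grid_point (2 * \<bar>p\<bar>) (2 * \<bar>q\<bar>) k = ?A *v vector [of_int (m + n), of_int (m - n)]"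
        by (simp add: vec_eq_iff forall_2 mul)
      moreover have "\<forall>i. (vector [of_int (m + n), of_int (m - n)] :: real^2) $ i \<in> \<int>"
        by (simp add: forall_2)
      ultimately show ?thesis
        unfolding rhombic(1) lattice_of_def by blast
    qed
    moreover have "l \<in> range (grid_point \<bar>p\<bar> \<bar>q\<bar>)" if l: "l \<in> \<Lambda>" for l
    proof -
      obtain z where z: "l = ?A *v z" "\<forall>i. z $ i \<in> \<int>"
        using l unfolding rhombic(1) lattice_of_def by blast
      obtain m n :: int where mn: "z $ 1 = of_int m" "z $ 2 = of_int n"
        using z(2) by (metis Ints_cases)
      obtain m' n' :: int where "p * of_int (m + n) = \<bar>p\<bar> * of_int m'" "q * of_int (m - n) = \<bar>q\<bar> * of_int n'"
        using abs_int by metis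
      then have "l = grid_point \<bar>p\<bar> \<bar>q\<bar> (m', n')"
        by (simp add: vec_eq_iff forall_2 z(1) mul mn)
      then show ?thesis by blast
    qed
    ultimately have sub: "range (grid_point (2 * \<bar>p\<bar>) (2 * \<bar>q\<bar>)) \<subseteq> \<Lambda>" "\<Lambda> \<subseteq> range (grid_point \<bar>p\<bar> \<bar>q\<bar>)"
      by blast+
    show thesis
      by (rule that[OF _ _ area _ _ sub]) (use rhombic in auto)
  qed
qed

theorem theorem2p11:
  fixes M :: "'a measure"
    and Z :: "real^2 \<Rightarrow> 'a \<Rightarrow> real^2"
    and f :: "real^2 \<Rightarrow> real"
    and \<gamma> :: real
    and \<Lambda> :: "(real^2) set"
  assumes "prob_space M"
    and "\<gamma> > 2 * pi"
    and "f = (\<lambda>z. exp (- \<gamma> * (norm z)\<^sup>2))"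
    and "\<Lambda> \<in> rect_lattices"
    and "lattice_density \<Lambda> > 4"
    and "prob_space.indep_vars M (\<lambda>_. borel) Z \<Lambda>"
    and "\<And>l. l \<in> \<Lambda> \<Longrightarrow> distr M borel (Z l) = uniform_measure lborel (cball l (f l))"
  shows "AE \<omega> in M. separated_set {Z l \<omega> | l. l \<in> \<Lambda>}
           \<and> gabor_uniqueness_set {Z l \<omega> | l. l \<in> \<Lambda>} L2_even_real"
proof -
  interpret prob_space M by (rule assms(1))
  obtain a b p q where ab: "a > 0" "b > 0" "2 * a * b < 1" and pq: "p > 0" "q > 0"
    and sub: "range (grid_point a b) \<subseteq> \<Lambda>" "\<Lambda> \<subseteq> range (grid_point p q)"
    using dense_rect_lattice_between_grids[OF assms(4,5)] by metis
  have unif: "distr M borel (Z l) = uniform_measure lborel (cball l (exp (- \<gamma> * (norm l)\<^sup>2)))" if "l \<in> \<Lambda>" for l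
    using assms(7)[OF that] by (simp add: assms(3))
  have "AE \<omega> in M. gabor_uniqueness_set {Z l \<omega> | l. l \<in> \<Lambda>} L2_even_real"
    by (rule AE_gabor_uniqueness_set[OF ab _ sub(1) assms(6) unif]) (use assms(2) in auto)
  moreover have "AE \<omega> in M. \<forall>l\<in>\<Lambda>. Z l \<omega> \<in> cball l (exp (- \<gamma> * (norm l)\<^sup>2))"
  proof (rule AE_ball_countable')
    show "countable \<Lambda>"
      using sub(2) by (rule countable_subset) simp
    show "AE \<omega> in M. Z l \<omega> \<in> cball l (exp (- \<gamma> * (norm l)\<^sup>2))" if "l \<in> \<Lambda>" for l
    proof (rule AE_mem_cball[OF _ unif[OF that]])
      show "Z l \<in> borel_measurable M"
        using assms(6) that by (auto simp: indep_vars_def)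
    qed
  qed
  ultimately show ?thesis
  proof eventually_elim
    fix \<omega>
    assume u: "gabor_uniqueness_set {Z l \<omega> | l. l \<in> \<Lambda>} L2_even_real"
      and near: "\<forall>l\<in>\<Lambda>. Z l \<omega> \<in> cball l (exp (- \<gamma> * (norm l)\<^sup>2))"
    have "separated_set {Z l \<omega> | l. l \<in> \<Lambda>}"
    proof (rule separated_set_perturbed_grid[OF pq sub(2)])
      show "\<gamma> > 0"
        using assms(2) pi_gt_zero by linarith
      show "norm (Z l \<omega> - l) \<le> exp (- \<gamma> * (norm l)\<^sup>2)" if "l \<in> \<Lambda>" for l
        using near that by (auto simp: dist_norm norm_minus_commute)
    qed
    then show "separated_set {Z l \<omega> | l. l \<in> \<Lambda>} \<and> gabor_uniqueness_set {Z l \<omega> | l. l \<in> \<Lambda>} L2_even_real"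
      using u by simp
  qed
qed

end
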